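(* Let $\Gamma$ be a row-finite directed graph, $F:\Gamma_{Ar}\to\mathbb R$ a potential and $\beta\in\mathbb R$, and assume that there is a vertex $v_0\in\Gamma_V$ such that $0<\sum_{n=0}^\infty A(\beta)^n_{v_0,v}<\infty$ for all $v\in\Gamma_V$. Let $E$ be a minimal end in $\Gamma$. i) The set of $v_0$-normalized $e^{\beta F}$-conformal measures concentrated on $E$ is a non-empty closed face $M^{v_0}_{\beta F}(E)$ in the simplex of all $v_0$-normalized $e^{\beta F}$-conformal measures on $P(\Gamma)$. ii) Set $\Delta_E=\{\psi\in\Delta_{\beta F}:\ \psi^n_w=0\ \text{for all } w\in\partial D_n\setminus E_{D_n}\text{ and all } n\}$. Then $M^{v_0}_{\beta F}(E)=\{m^\psi:\psi\in\Delta_E\}$.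
   Context: A countable directed graph $\Gamma$ consists of countable sets $\Gamma_V$ (vertices) and $\Gamma_{Ar}$ (arrows) with source and range maps $s,r:\Gamma_{Ar}\to\Gamma_V$ (multiple arrows and loops allowed); it is row-finite if $\#s^{-1}(v)<\infty$ for all $v$. $P(\Gamma)$ is the set of infinite paths $p=(p_i)_{i\ge1}\in(\Gamma_{Ar})^{\mathbb N}$, $r(p_i)=s(p_{i+1})$, with the topology inherited from the product of discrete spaces. $P_f(\Gamma)$ is the set of finite paths $\mu=a_1\cdots a_n$ (vertices are paths of length $0$), $s(\mu)=s(a_1)$, $r(\mu)=r(a_n)$; $Z(\mu)=\{x\in P(\Gamma):x_i=a_i,\ 1\le i\le n\}$, $Z(v)=\{p:s(p_1)=v\}$. The shift is $\sigma(p)_i=p_{i+1}$. $F$ is extended to finite paths by $F(a_1\cdots a_n)=\sum_iF(a_i)$, $F(v)=0$. $A(\beta)_{v,w}=\sum_{a\in s^{-1}(v)\cap r^{-1}(w)}e^{-\beta F(a)}$, with matrix powers $A(\beta)^n$, $A(\beta)^0$ the identity. A non-zero Borel measure $m$ on $P(\Gamma)$ with $m(Z(v))<\infty$ for all $v$ is $e^{\beta F}$-conformal if $m(\sigma(B\cap Z(a)))=e^{\beta F(a)}m(B\cap Z(a))$ for all arrows $a$ and Borel $B$; it is $v_0$-normalized if $m(Z(v_0))=1$, and concentrated on $E$ if $m(P(\Gamma)\setminus E)=0$. The set of $v_0$-normalized $e^{\beta F}$-conformal measures carries the weakest topology making $m\mapsto m(Z(\mu))$ continuous for all finite paths $\mu$.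 $\mathrm{Wan}(\Gamma)$ is the set of $p\in P(\Gamma)$ such that for each finite $H\subseteq\Gamma_V$ there is $N$ with $s(p_i)\notin H$ for all $i\ge N$. For $p,q\in\mathrm{Wan}(\Gamma)$ write $p\to q$ if for every finite $H\subseteq\Gamma_V$ and $N$ there are $n_1,n_2\ge N$ and a finite path from $s(p_{n_1})$ to $s(q_{n_2})$ none of whose vertices is in $H$; $p\sim q$ means $p\to q$ and $q\to p$. An end is a $\sim$-class $\mathcal E(p)$ in $\mathrm{Wan}(\Gamma)$. Ends are partially ordered by $\mathcal E(p)\le\mathcal E(q)$ iff $p\to q$; an end is minimal if it is minimal for this order. For $H\subseteq\Gamma_V$ let $\mathrm{Int}\,H=\{v\in H:r(s^{-1}(v))\subseteq H\}$; $H\sqsubset H'$ means $H\subseteq\mathrm{Int}\,H'$. Fix a sequence $\{v_0\}\sqsubset D_1\sqsubset D_2\sqsubset\cdots$ of finite subsets of $\Gamma_V$ with $\bigcup_nD_n=\Gamma_V$; $D_0=\{v_0\}$. For $w\in D\subseteq\Gamma_V$ let $\Omega_D(w)=\{y\in\mathrm{Wan}(\Gamma):s(y_1)=w,\ s(y_i)\notin D\ \forall i\ge2\}$, $\partial D=\{w\in D:\Omega_D(w)\ne\emptyset\}$. For $v\in D$, $w\notin D$, $L_D(v,w)$ is the set of finite paths $a_1\cdots a_n$ from $v$ to $w$ with $r(a_i)\notin D$ for all $i$. For $p\in\mathrm{Wan}(\Gamma)$, $[D]_p$ is the set of $v\in D$ such that for all $N$ there is $n\ge N$ with $s(p_n)\notin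 D$ and $L_D(v,s(p_n))\ne\emptyset$. For finite $D$, $[D]_p$ depends only on the end of $p$ and is contained in $\partial D$; for an end $E$, $E_{D_n}$ denotes the set $[D_n]_p$, $p\in E$. For $n\ge0$, $M(n)_{v,w}=\sum_{\mu\in L_{D_n}(v,w)}e^{-\beta F(\mu)}$ for $v\in\partial D_n$, $w\in\partial D_{n+1}$. $\Delta_{\beta F}$ is the set of sequences $(\psi^k)_{k=1}^\infty\in\prod_{k=1}^\infty[0,\infty)^{\partial D_k}$ such that $M(0)\psi^1=\big(\sum_{k=0}^\infty A(\beta)^k_{v_0,v_0}\big)^{-1}$ and $M(n)\psi^{n+1}=\psi^n$ for $n\ge1$. For $\psi\in\Delta_{\beta F}$, $m^\psi$ denotes the unique $v_0$-normalized $e^{\beta F}$-conformal measure on $P(\Gamma)$ with $m^\psi(\Omega_{D_k}(w))=\psi^k_w$ for all $w\in\partial D_k$, $k\ge1$. *)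

theory Defs
  imports "HOL-Analysis.Analysis" "Graph_Theory.Arc_Walk"
begin

text \<open>
  Directed graphs are the records of the Graph Theory library: \<^term>\<open>tail G\<close> is the source map s
  and \<^term>\<open>head G\<close> is the range map r.  A finite path from v to w is a list of arrows \<^term>\<open>as\<close>
  with \<^term>\<open>pre_digraph.awalk G v as w\<close>; the initial vertex is carried separately, so that the empty
  list, together with a vertex v, is the path v of length 0.
  Infinite paths are indexed from 0, so the i-th arrow of the usual notation is \<^term>\<open>p (i - 1)\<close>.
\<close>

definition row_finite_digraph :: "('v, 'a) pre_digraph \<Rightarrow> bool" where
  "row_finite_digraph G \<longleftrightarrow>
     wf_digraph G \<and> countable (verts G) \<and> countable (arcs G) \<and>
     (\<forall>v\<in>verts G. finite (out_arcs G v))"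

section \<open>The path space\<close>

definition inf_paths :: "('v, 'a) pre_digraph \<Rightarrow> (nat \<Rightarrow> 'a) set" where
  "inf_paths G = {p. (\<forall>i. p i \<in> arcs G) \<and> (\<forall>i. head G (p i) = tail G (p (Suc i)))}"

definition path_topology :: "('v, 'a) pre_digraph \<Rightarrow> (nat \<Rightarrow> 'a) topology" where
  "path_topology G =
     subtopology (product_topology (\<lambda>_. discrete_topology (arcs G)) UNIV) (inf_paths G)"

definition path_borel :: "('v, 'a) pre_digraph \<Rightarrow> (nat \<Rightarrow> 'a) measure" where
  "path_borel G = sigma (inf_paths G) {U. openin (path_topology G) U}"

definition shift :: "(nat \<Rightarrow> 'a) \<Rightarrow> nat \<Rightarrow> 'a" where
  "shift p = (\<lambda>i. p (Suc i))"

text \<open>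
  For the path of length 0 at v this is Z(v); for a non-empty path starting at v the condition on
  \<^term>\<open>tail G (x 0)\<close> is implied by the other one.
\<close>
definition cylinder :: "('v, 'a) pre_digraph \<Rightarrow> 'v \<Rightarrow> 'a list \<Rightarrow> (nat \<Rightarrow> 'a) set" where
  "cylinder G v as = {x \<in> inf_paths G. tail G (x 0) = v \<and> (\<forall>i<length as. x i = as ! i)}"

section \<open>Wandering paths and ends\<close>

definition Wan :: "('v, 'a) pre_digraph \<Rightarrow> (nat \<Rightarrow> 'a) set" where
  "Wan G = {p \<in> inf_paths G.
     \<forall>H. finite H \<and> H \<subseteq> verts G \<longrightarrow> (\<exists>N. \<forall>i\<ge>N. tail G (p i) \<notin> H)}"

definition path_to :: "('v, 'a) pre_digraph \<Rightarrow> (nat \<Rightarrow> 'a) \<Rightarrow> (nat \<Rightarrow> 'a) \<Rightarrow> bool" where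
  "path_to G p q \<longleftrightarrow>
     (\<forall>H N. finite H \<and> H \<subseteq> verts G \<longrightarrow>
        (\<exists>n1\<ge>N. \<exists>n2\<ge>N. \<exists>as. pre_digraph.awalk G (tail G (p n1)) as (tail G (q n2)) \<and>
            set (pre_digraph.awalk_verts G (tail G (p n1)) as) \<inter> H = {}))"

definition end_rel :: "('v, 'a) pre_digraph \<Rightarrow> ((nat \<Rightarrow> 'a) \<times> (nat \<Rightarrow> 'a)) set" where
  "end_rel G = {(p, q). p \<in> Wan G \<and> q \<in> Wan G \<and> path_to G p q \<and> path_to G q p}"

definition ends :: "('v, 'a) pre_digraph \<Rightarrow> (nat \<Rightarrow> 'a) set set" where
  "ends G = Wan G // end_rel G"

text \<open>The order on ends; it does not depend on the choice of the representatives.\<close>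
definition end_le :: "('v, 'a) pre_digraph \<Rightarrow> (nat \<Rightarrow> 'a) set \<Rightarrow> (nat \<Rightarrow> 'a) set \<Rightarrow> bool" where
  "end_le G E E' \<longleftrightarrow> (\<exists>p\<in>E. \<exists>q\<in>E'. path_to G p q)"

definition minimal_end :: "('v, 'a) pre_digraph \<Rightarrow> (nat \<Rightarrow> 'a) set \<Rightarrow> bool" where
  "minimal_end G E \<longleftrightarrow> E \<in> ends G \<and> (\<forall>E'\<in>ends G. end_le G E' E \<longrightarrow> E' = E)"

section \<open>The matrices\<close>

text \<open>
  Matrices are indexed by vertices and have entries in \<^typ>\<open>ennreal\<close>, so that all the
  sums of non-negative terms below are defined without convergence assumptions.
\<close>
definition A_mat ::
  "('v, 'a) pre_digraph \<Rightarrow> ('a \<Rightarrow> real) \<Rightarrow> real \<Rightarrow> 'v \<Rightarrow> 'v \<Rightarrow> ennreal" where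
  "A_mat G F \<beta> v w = (\<Sum>a\<in>out_arcs G v \<inter> in_arcs G w. ennreal (exp (- \<beta> * F a)))"

primrec mat_pow :: "'v set \<Rightarrow> ('v \<Rightarrow> 'v \<Rightarrow> ennreal) \<Rightarrow> nat \<Rightarrow> 'v \<Rightarrow> 'v \<Rightarrow> ennreal" where
  "mat_pow V A 0 = (\<lambda>v w. if v = w then 1 else 0)"
| "mat_pow V A (Suc n) = (\<lambda>v w. \<Sum>\<^sub>\<infinity>u\<in>V. A v u * mat_pow V A n u w)"

definition green ::
  "('v, 'a) pre_digraph \<Rightarrow> ('a \<Rightarrow> real) \<Rightarrow> real \<Rightarrow> 'v \<Rightarrow> 'v \<Rightarrow> ennreal" where
  "green G F \<beta> v w = (\<Sum>n. mat_pow (verts G) (A_mat G F \<beta>) n v w)"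

section \<open>Conformal measures\<close>

definition conformal ::
  "('v, 'a) pre_digraph \<Rightarrow> ('a \<Rightarrow> real) \<Rightarrow> real \<Rightarrow> (nat \<Rightarrow> 'a) measure \<Rightarrow> bool" where
  "conformal G F \<beta> m \<longleftrightarrow>
     space m = inf_paths G \<and> sets m = sets (path_borel G) \<and>
     emeasure m (space m) \<noteq> 0 \<and>
     (\<forall>v\<in>verts G. emeasure m (cylinder G v []) < \<infinity>) \<and>
     (\<forall>a\<in>arcs G. \<forall>B\<in>sets m.
        emeasure m (shift ` (B \<inter> cylinder G (tail G a) [a])) =
        ennreal (exp (\<beta> * F a)) * emeasure m (B \<inter> cylinder G (tail G a) [a]))"

definition normalized_conformal ::
  "('v, 'a) pre_digraph \<Rightarrow> ('a \<Rightarrow> real) \<Rightarrow> real \<Rightarrow> 'v \<Rightarrow> (nat \<Rightarrow> 'a) measure set" where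
  "normalized_conformal G F \<beta> v0 = {m. conformal G F \<beta> m \<and> emeasure m (cylinder G v0 []) = 1}"

text \<open>
  \<^term>\<open>emeasure\<close> is 0 on sets that are not measurable; membership in \<^term>\<open>null_sets\<close> also asserts
  measurability.
\<close>
definition concentrated_on :: "'x measure \<Rightarrow> 'x set \<Rightarrow> bool" where
  "concentrated_on m E \<longleftrightarrow> space m - E \<in> null_sets m"

definition conformal_on_end ::
  "('v, 'a) pre_digraph \<Rightarrow> ('a \<Rightarrow> real) \<Rightarrow> real \<Rightarrow> 'v \<Rightarrow> (nat \<Rightarrow> 'a) set
     \<Rightarrow> (nat \<Rightarrow> 'a) measure set" where
  "conformal_on_end G F \<beta> v0 E = {m \<in> normalized_conformal G F \<beta> v0. concentrated_on m E}"

text \<open>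
  The weakest topology on K for which evaluation at every cylinder of a finite path is
  continuous.
\<close>
definition cylinder_topology ::
  "('v, 'a) pre_digraph \<Rightarrow> (nat \<Rightarrow> 'a) measure set \<Rightarrow> (nat \<Rightarrow> 'a) measure topology" where
  "cylinder_topology G K = topology_generated_by
     {{m \<in> K. measure m (cylinder G v as) \<in> U} | v as w U.
        pre_digraph.awalk G v as w \<and> open (U :: real set)}"

section \<open>Convexity, faces and simplices of measures\<close>

text \<open>
  Measures with values in \<^typ>\<open>ennreal\<close> do not form a real vector space, so the library notions of
  convexity and faces are restated here for measures on a common measurable space.
\<close>
definition add_measure :: "'x measure \<Rightarrow> 'x measure \<Rightarrow> 'x measure" where
  "add_measure m1 m2 = measure_of (space m1) (sets m1) (\<lambda>B. emeasure m1 B + emeasure m2 B)"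

definition mix_measure :: "real \<Rightarrow> 'x measure \<Rightarrow> 'x measure \<Rightarrow> 'x measure" where
  "mix_measure t m1 m2 =
     add_measure (scale_measure (ennreal (1 - t)) m1) (scale_measure (ennreal t) m2)"

definition convex_measures :: "'x measure set \<Rightarrow> bool" where
  "convex_measures K \<longleftrightarrow> (\<forall>m1\<in>K. \<forall>m2\<in>K. \<forall>t\<in>{0..1}. mix_measure t m1 m2 \<in> K)"

definition measure_face_of :: "'x measure set \<Rightarrow> 'x measure set \<Rightarrow> bool" where
  "measure_face_of M K \<longleftrightarrow>
     M \<subseteq> K \<and> convex_measures M \<and>
     (\<forall>m1\<in>K. \<forall>m2\<in>K. \<forall>t\<in>{0<..<1}. mix_measure t m1 m2 \<in> M \<longrightarrow> m1 \<in> M \<and> m2 \<in> M)"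

definition measure_cone :: "'x measure set \<Rightarrow> 'x measure set" where
  "measure_cone K = {scale_measure (ennreal c) m | c m. 0 \<le> c \<and> m \<in> K}"

definition cone_le :: "'x measure set \<Rightarrow> 'x measure \<Rightarrow> 'x measure \<Rightarrow> bool" where
  "cone_le C m1 m2 \<longleftrightarrow> (\<exists>d\<in>C. m2 = add_measure m1 d)"

definition lattice_cone :: "'x measure set \<Rightarrow> bool" where
  "lattice_cone C \<longleftrightarrow>
     (\<forall>a\<in>C. \<forall>b\<in>C.
        (\<exists>s\<in>C. cone_le C a s \<and> cone_le C b s \<and>
           (\<forall>c\<in>C. cone_le C a c \<and> cone_le C b c \<longrightarrow> cone_le C s c)) \<and>
        (\<exists>i\<in>C. cone_le C i a \<and> cone_le C i b \<and>
           (\<forall>c\<in>C. cone_le C c a \<and> cone_le C c b \<longrightarrow> cone_le C c i)))"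

text \<open>
  A Choquet simplex: a compact (Hausdorff) convex set, here the base of a cone of measures, whose
  cone is a lattice in its own order.  This is used only for sets of measures that are all
  normalized on one fixed set, so that they lie in a hyperplane missing 0, with a topology given
  by affine real-valued functions.
\<close>
definition choquet_simplex :: "'x measure topology \<Rightarrow> bool" where
  "choquet_simplex T \<longleftrightarrow>
     compact_space T \<and> Hausdorff_space T \<and> convex_measures (topspace T) \<and>
     lattice_cone (measure_cone (topspace T))"

section \<open>The sets and matrices attached to an exhaustion\<close>

definition interior_verts :: "('v, 'a) pre_digraph \<Rightarrow> 'v set \<Rightarrow> 'v set" where
  "interior_verts G H = {v \<in> H. head G ` out_arcs G v \<subseteq> H}"

definition exhaustion :: "('v, 'a) pre_digraph \<Rightarrow> 'v \<Rightarrow> (nat \<Rightarrow> 'v set) \<Rightarrow> bool" where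
  "exhaustion G v0 D \<longleftrightarrow>
     D 0 = {v0} \<and> (\<forall>n. finite (D n)) \<and>
     (\<forall>n. D n \<subseteq> interior_verts G (D (Suc n))) \<and> (\<Union>n. D n) = verts G"

definition Omega :: "('v, 'a) pre_digraph \<Rightarrow> 'v set \<Rightarrow> 'v \<Rightarrow> (nat \<Rightarrow> 'a) set" where
  "Omega G D w = {y \<in> Wan G. tail G (y 0) = w \<and> (\<forall>i\<ge>1. tail G (y i) \<notin> D)}"

definition bdry :: "('v, 'a) pre_digraph \<Rightarrow> 'v set \<Rightarrow> 'v set" where
  "bdry G D = {w \<in> D. Omega G D w \<noteq> {}}"

definition L_paths :: "('v, 'a) pre_digraph \<Rightarrow> 'v set \<Rightarrow> 'v \<Rightarrow> 'v \<Rightarrow> 'a list set" where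
  "L_paths G D v w = {as. pre_digraph.awalk G v as w \<and> (\<forall>a\<in>set as. head G a \<notin> D)}"

definition bracket :: "('v, 'a) pre_digraph \<Rightarrow> 'v set \<Rightarrow> (nat \<Rightarrow> 'a) \<Rightarrow> 'v set" where
  "bracket G D p = {v \<in> D. \<forall>N. \<exists>n\<ge>N. tail G (p n) \<notin> D \<and> L_paths G D v (tail G (p n)) \<noteq> {}}"

text \<open>For finite D the set \<^term>\<open>bracket G D p\<close> is the same for all p in an end.\<close>
definition end_bracket :: "('v, 'a) pre_digraph \<Rightarrow> (nat \<Rightarrow> 'a) set \<Rightarrow> 'v set \<Rightarrow> 'v set" where
  "end_bracket G E D = bracket G D (SOME p. p \<in> E)"

definition M_mat ::
  "('v, 'a) pre_digraph \<Rightarrow> ('a \<Rightarrow> real) \<Rightarrow> real \<Rightarrow> (nat \<Rightarrow> 'v set) \<Rightarrow> nat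
     \<Rightarrow> 'v \<Rightarrow> 'v \<Rightarrow> ennreal" where
  "M_mat G F \<beta> D n v w =
     (\<Sum>\<^sub>\<infinity>as\<in>L_paths G (D n) v w. ennreal (exp (- \<beta> * sum_list (map F as))))"

text \<open>
  Under the assumption on \<^term>\<open>green\<close>, \<^term>\<open>bdry G (D 0)\<close> is the singleton of v0 as soon as there is a
  wandering path, so the equation for \<^term>\<open>M_mat G F \<beta> D 0\<close> is the one for its only row.
\<close>
definition Delta ::
  "('v, 'a) pre_digraph \<Rightarrow> ('a \<Rightarrow> real) \<Rightarrow> real \<Rightarrow> 'v \<Rightarrow> (nat \<Rightarrow> 'v set)
     \<Rightarrow> (nat \<Rightarrow> 'v \<Rightarrow> real) set" where
  "Delta G F \<beta> v0 D = {\<psi>.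
     \<psi> \<in> (\<Pi>\<^sub>E k\<in>{1..}. \<Pi>\<^sub>E w\<in>bdry G (D k). {0..}) \<and>
     (\<Sum>w\<in>bdry G (D 1). M_mat G F \<beta> D 0 v0 w * ennreal (\<psi> 1 w)) = inverse (green G F \<beta> v0 v0) \<and>
     (\<forall>n\<ge>1. \<forall>v\<in>bdry G (D n).
        (\<Sum>w\<in>bdry G (D (Suc n)). M_mat G F \<beta> D n v w * ennreal (\<psi> (Suc n) w)) = ennreal (\<psi> n v))}"

definition Delta_end ::
  "('v, 'a) pre_digraph \<Rightarrow> ('a \<Rightarrow> real) \<Rightarrow> real \<Rightarrow> 'v \<Rightarrow> (nat \<Rightarrow> 'v set) \<Rightarrow> (nat \<Rightarrow> 'a) set
     \<Rightarrow> (nat \<Rightarrow> 'v \<Rightarrow> real) set" where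
  "Delta_end G F \<beta> v0 D E = {\<psi> \<in> Delta G F \<beta> v0 D.
     \<forall>n\<ge>1. \<forall>w\<in>bdry G (D n) - end_bracket G E (D n). \<psi> n w = 0}"

text \<open>The measure \<^term>\<open>m\<close> attached to \<^term>\<open>\<psi> \<in> Delta G F \<beta> v0 D\<close>, which exists and is unique.\<close>
definition psi_measure ::
  "('v, 'a) pre_digraph \<Rightarrow> ('a \<Rightarrow> real) \<Rightarrow> real \<Rightarrow> 'v \<Rightarrow> (nat \<Rightarrow> 'v set)
     \<Rightarrow> (nat \<Rightarrow> 'v \<Rightarrow> real) \<Rightarrow> (nat \<Rightarrow> 'a) measure" where
  "psi_measure G F \<beta> v0 D \<psi> = (THE m. m \<in> normalized_conformal G F \<beta> v0 \<and>
     (\<forall>k\<ge>1. \<forall>w\<in>bdry G (D k). emeasure m (Omega G (D k) w) = ennreal (\<psi> k w)))"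

end

theory Submission
  imports Defs "HOL-Library.Omega_Words_Fun" "HOL-Complex_Analysis.Great_Picard"
begin

text \<open>
  Write \<open>h v = m (Z v)\<close> for a conformal measure \<open>m\<close>.  Conformality says that putting an arrow \<open>a\<close> in
  front of a set of paths multiplies its measure by \<open>exp (- \<beta> * F a)\<close>.  Hence \<open>h\<close> is harmonic: \<open>h v\<close> is
  the sum of \<open>exp (- \<beta> * F a) * h (head G a)\<close> over the arrows \<open>a\<close> that leave \<open>v\<close>, and \<open>m\<close> is determined
  by \<open>h\<close> (\<open>conformal0_eqI\<close>).  Conversely every non-negative harmonic \<open>h\<close> comes from a conformal measure
  (\<open>path_measure_conformal0\<close>): cut the interval \<open>[0, h v)\<close> into pieces of lengths
  \<open>exp (- \<beta> * F a) * h (head G a)\<close> and stretch the piece of \<open>a\<close> onto \<open>[0, h (head G a))\<close>; a point of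
  \<open>[0, h v)\<close> then runs through a sequence of arrows, and the image of Lebesgue measure under this coding
  is the measure wanted.  So the claims about the simplex are claims about non-negative harmonic
  functions with \<open>h v0 = 1\<close>.  These are bounded at \<open>v\<close> by means of a walk from \<open>v0\<close> to \<open>v\<close>, which gives
  compactness by Tychonoff's theorem; and two harmonic functions have a least harmonic majorant, the
  limit of the iterates of the matrix on their maximum, so that the cone is a lattice.

  Finiteness of the Green function makes almost every path wandering, by the Borel-Cantelli lemma.
  Finite walks and wandering paths can therefore be cut at the first return to a finite set \<open>D\<close> or at
  the last visit to it.  Let \<open>G\<^sup>D v w\<close> be the total weight of the walks from \<open>v\<close> to \<open>w\<close> that do not enter \<open>D\<close>
  after their start (so that \<open>G\<close> for the empty set is the Green function, and the matrices of the
  theorem are of this form), and \<open>R\<^sup>D v d\<close> the weight of the walks that end at their first return to \<open>D\<close>,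
  at \<open>d\<close>.  For finite sets \<open>D\<close> and \<open>D'\<close>, four identities result, which carry the rest of the proof:
  \<^item> \<open>G v u = G\<^sup>D v u + (\<Sum>d\<in>D. R\<^sup>D v d * G d u)\<close> (\<open>first_return_decomposition\<close>);
  \<^item> \<open>G v u = (\<Sum>w\<in>D. G v w * G\<^sup>D w u)\<close> for \<open>v \<in> D\<close> (\<open>last_exit_decomposition\<close>);
  \<^item> \<open>m (Z v) = m (Omega D v) + (\<Sum>d\<in>D. R\<^sup>D v d * m (Z d))\<close> (\<open>first_return_emeasure\<close>);
  \<^item> \<open>m (Omega D v) = (\<Sum>w\<in>D'. G\<^sup>D v w * m (Omega D' w))\<close> for \<open>v \<in> D'\<close>, \<open>D \<subseteq> D'\<close> (\<open>last_exit_emeasure\<close>).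

  The last one says that the numbers \<open>m (Omega D\<^sub>n w)\<close> solve the equations that define \<open>Delta\<close> and that
  they determine \<open>h\<close>.  Conversely a solution \<open>\<psi>\<close> gives the harmonic function
  \<open>h v = (\<Sum>w. G v w * \<psi> n w)\<close>, the same for all \<open>n\<close> with \<open>v \<in> D\<^sub>n\<close>, and comparing the first and third
  identities shows that its measure gives \<open>Omega D\<^sub>n w\<close> the mass \<open>\<psi> n w\<close> (\<open>Delta_measure_exists\<close>).

  Ends enter through one criterion.  By minimality, \<open>E\<close> is the set of all wandering paths \<open>x\<close> with
  \<open>x \<rightarrow> q\<close>, for any \<open>q \<in> E\<close>; and a conformal measure lives on this set if and only if it vanishes on
  \<open>Omega D\<^sub>n y\<close> for all \<open>y \<in> D\<^sub>n\<close> outside the bracket of \<open>q\<close> (\<open>concentrated_upstream_iff\<close>).  By the third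
  identity these are linear equations in finitely many values of \<open>h\<close> each, which makes the set of
  measures on \<open>E\<close> closed, and they are the equations that cut out \<open>Delta_end\<close>.  A measure on \<open>E\<close> is found
  as a limit of the Martin kernels \<open>G v w / G v0 w\<close> with \<open>w\<close> moving along \<open>q\<close>: its mass on \<open>Omega D\<^sub>n y\<close> is
  the limit of \<open>G\<^sup>D y w / G v0 w\<close> with \<open>D = D\<^sub>n\<close>, which is eventually \<open>0\<close> when \<open>y\<close> is outside the bracket.
\<close>

section \<open>Sums over countable sets\<close>

text \<open>
  Both sides are the supremum of the finite partial sums.  Sums over walks are treated as integrals
  against counting measure, because countable additivity of measures then does all rearrangements.
\<close>
lemma infsum_ennreal_eq_nn_integral:
  fixes f :: "'x \<Rightarrow> ennreal"
  assumes "countable A"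
  shows "infsum f A = (\<integral>\<^sup>+x. f x \<partial>count_space A)"
proof (cases "finite A")
  case True
  then show ?thesis by (simp add: nn_integral_count_space_finite)
next
  case False
  let ?g = "from_nat_into A"
  have bij: "bij_betw ?g UNIV A"
    using assms False by (rule bij_betw_from_nat_into)
  have S: "infsum f A = (SUP S\<in>{S. finite S \<and> S \<subseteq> A}. sum f S)"
    by (rule nonneg_infsum_complete) simp
  show ?thesis
  proof (rule antisym)
    have "sum f S \<le> (\<integral>\<^sup>+x. f x \<partial>count_space A)" if "finite S" "S \<subseteq> A" for S
    proof -
      have "sum f S = (\<integral>\<^sup>+x. f x \<partial>count_space S)"
        using that by (simp add: nn_integral_count_space_finite)
      also have "\<dots> = (\<integral>\<^sup>+x. f x * indicator S x \<partial>count_space A)"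
        using that by (subst (1 2) nn_integral_count_space_indicator)
          (auto intro!: nn_integral_cong split: split_indicator)
      also have "\<dots> \<le> (\<integral>\<^sup>+x. f x \<partial>count_space A)"
        by (intro nn_integral_mono) (auto split: split_indicator)
      finally show ?thesis .
    qed
    then show "infsum f A \<le> (\<integral>\<^sup>+x. f x \<partial>count_space A)"
      unfolding S by (intro SUP_least) auto
  next
    have "(\<integral>\<^sup>+x. f x \<partial>count_space A) = (\<integral>\<^sup>+n. f (?g n) \<partial>count_space UNIV)"
      by (rule nn_integral_bij_count_space[OF bij, symmetric])
    also have "\<dots> = (\<Sum>n. f (?g n))"
      by (rule nn_integral_count_space_nat)
    also have "\<dots> = (SUP n. \<Sum>i<n. f (?g i))"
      by (rule suminf_eq_SUP)
    also have "\<dots> \<le> infsum f A"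
    proof (rule SUP_least)
      fix n
      have "inj_on ?g {..<n}" using bij by (auto simp: bij_betw_def inj_on_def)
      then have "(\<Sum>i<n. f (?g i)) = sum f (?g ` {..<n})"
        by (simp add: sum.reindex)
      also have "\<dots> \<le> infsum f A"
        unfolding S using bij by (intro SUP_upper) (auto simp: bij_betw_def)
      finally show "(\<Sum>i<n. f (?g i)) \<le> infsum f A" .
    qed
    finally show "(\<integral>\<^sup>+x. f x \<partial>count_space A) \<le> infsum f A" .
  qed
qed

text \<open>
  This is countable additivity of the measure with density \<open>f\<close> with respect to counting measure.
\<close>
lemma nn_integral_count_space_UN:
  fixes f :: "'x \<Rightarrow> ennreal"
  assumes "countable I" "disjoint_family_on B I"
  shows "(\<integral>\<^sup>+x. f x \<partial>count_space (\<Union>i\<in>I. B i)) = (\<integral>\<^sup>+i. (\<integral>\<^sup>+x. f x \<partial>count_space (B i)) \<partial>count_space I)"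
proof -
  let ?N = "density (count_space UNIV) f"
  have *: "emeasure ?N S = (\<integral>\<^sup>+x. f x \<partial>count_space S)" for S
    by (simp add: emeasure_density, cases "S = UNIV") (simp_all add: nn_integral_count_space_indicator[where X=S])
  have "emeasure ?N (\<Union>(B ` I)) = (\<integral>\<^sup>+i. emeasure ?N (B i) \<partial>count_space I)"
    by (rule emeasure_UN_countable) (use assms in auto)
  then show ?thesis by (simp add: *)
qed

lemma nn_integral_count_space_Sigma:
  fixes f :: "'x \<times> 'y \<Rightarrow> ennreal"
  assumes "countable I"
  shows "(\<integral>\<^sup>+z. f z \<partial>count_space (Sigma I B)) = (\<integral>\<^sup>+i. (\<integral>\<^sup>+x. f (i, x) \<partial>count_space (B i)) \<partial>count_space I)"
proof -
  have eq: "Sigma I B = (\<Union>i\<in>I. Pair i ` B i)" by auto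
  have b: "bij_betw (Pair i) (B i) (Pair i ` B i)" for i
    by (auto simp: bij_betw_def inj_on_def)
  have "(\<integral>\<^sup>+z. f z \<partial>count_space (Sigma I B)) = (\<integral>\<^sup>+i. (\<integral>\<^sup>+x. f x \<partial>count_space (Pair i ` B i)) \<partial>count_space I)"
    unfolding eq by (rule nn_integral_count_space_UN) (use assms in \<open>auto simp: disjoint_family_on_def\<close>)
  then show ?thesis
    by (simp add: nn_integral_bij_count_space[OF b, symmetric])
qed

lemma conc_eq_conc_cases:
  assumes "as \<frown> x = bs \<frown> y" "length as \<le> length bs"
  obtains us where "bs = as @ us" "x = us \<frown> y"
proof -
  have 1: "take (length as) bs = as"
  proof (rule nth_equalityI)
    show "length (take (length as) bs) = length as" using assms by simp
    fix i assume i: "i < length (take (length as) bs)"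
    then have "(as \<frown> x) i = as ! i" "(bs \<frown> y) i = bs ! i" using assms(2) by auto
    then show "take (length as) bs ! i = as ! i" using assms(1) i by simp
  qed
  define us where "us = drop (length as) bs"
  have 2: "bs = as @ us" using 1 us_def by (metis append_take_drop_id)
  have "x n = (us \<frown> y) n" for n
  proof -
    have "(as \<frown> x) (length as + n) = (bs \<frown> y) (length as + n)" using assms by simp
    then show ?thesis unfolding 2 by (simp add: conc_def nth_append split: if_splits)
  qed
  then show thesis using 2 that by blast
qed

section \<open>Weighted walks and the Green function\<close>

locale weighted_digraph = wf_digraph G for G :: "('v, 'a) pre_digraph" +
  fixes F :: "'a \<Rightarrow> real" and \<beta> :: real
  assumes row_finite: "row_finite_digraph G"
begin

lemma countable_verts: "countable (verts G)"
  and countable_arcs: "countable (arcs G)"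
  and finite_out_arcs: "finite (out_arcs G v)"
proof -
  show "countable (verts G)" "countable (arcs G)"
    using row_finite by (auto simp: row_finite_digraph_def)
  show "finite (out_arcs G v)"
  proof (cases "v \<in> verts G")
    case True then show ?thesis using row_finite by (auto simp: row_finite_digraph_def)
  next
    case False then have "out_arcs G v = {}" by (auto simp: out_arcs_def)
    then show ?thesis by simp
  qed
qed

definition wt :: "'a list \<Rightarrow> real" where
  "wt as = exp (- \<beta> * sum_list (map F as))"

lemma wt_Nil [simp]: "wt [] = 1"
  and wt_Cons: "wt (a # as) = wt [a] * wt as"
  and wt_append: "wt (as @ bs) = wt as * wt bs"
  and wt_pos [simp]: "0 < wt as"
  by (auto simp: wt_def exp_add[symmetric] algebra_simps)

lemma wt_nonneg [simp]: "0 \<le> wt as"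
  using wt_pos[of as] by linarith

lemma wt_ne_0 [simp]: "wt as \<noteq> 0"
  using wt_pos[of as] by linarith

lemma wt_ennreal_append: "ennreal (wt (as @ bs)) = ennreal (wt as) * ennreal (wt bs)"
  by (simp add: wt_append ennreal_mult)

definition walk_sum :: "'a list set \<Rightarrow> ennreal" where
  "walk_sum S = (\<integral>\<^sup>+as. ennreal (wt as) \<partial>count_space S)"

lemma walk_sum_mono: "S \<subseteq> T \<Longrightarrow> walk_sum S \<le> walk_sum T"
  unfolding walk_sum_def
  by (subst (1 2) nn_integral_count_space_indicator)
    (auto intro!: nn_integral_mono split: split_indicator)

lemma walk_sum_Un:
  assumes "S \<inter> T = {}"
  shows "walk_sum (S \<union> T) = walk_sum S + walk_sum T"
proof -
  have *: "walk_sum X = (\<integral>\<^sup>+as. ennreal (wt as) * indicator X as \<partial>count_space UNIV)" for X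
    by (cases "X = UNIV") (simp_all add: walk_sum_def nn_integral_count_space_indicator[where X=X])
  show ?thesis unfolding *
    by (subst nn_integral_add[symmetric])
      (use assms in \<open>auto intro!: nn_integral_cong split: split_indicator\<close>)
qed

lemma walk_sum_image_append: "walk_sum ((@) as ` S) = ennreal (wt as) * walk_sum S"
proof -
  have "bij_betw ((@) as) S ((@) as ` S)" by (auto simp: bij_betw_def inj_on_def)
  then have "walk_sum ((@) as ` S) = (\<integral>\<^sup>+bs. ennreal (wt (as @ bs)) \<partial>count_space S)"
    unfolding walk_sum_def by (rule nn_integral_bij_count_space[symmetric])
  then show ?thesis
    by (simp add: wt_ennreal_append walk_sum_def nn_integral_cmult)
qed

lemma walk_sum_Sigma:
  assumes "finite W"
  shows "(\<integral>\<^sup>+z. ennreal (wt (snd z)) * q (fst z) \<partial>count_space (Sigma W P)) = (\<Sum>w\<in>W. walk_sum (P w) * q w)"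
proof -
  have "(\<integral>\<^sup>+z. ennreal (wt (snd z)) * q (fst z) \<partial>count_space (Sigma W P))
    = (\<integral>\<^sup>+w. (\<integral>\<^sup>+as. ennreal (wt as) * q w \<partial>count_space (P w)) \<partial>count_space W)"
    by (subst nn_integral_count_space_Sigma) (use assms in \<open>auto simp: countable_finite\<close>)
  also have "\<dots> = (\<Sum>w\<in>W. walk_sum (P w) * q w)"
    using assms by (simp add: nn_integral_count_space_finite walk_sum_def nn_integral_multc)
  finally show ?thesis .
qed

text \<open>
  If the walks of a family can be cut uniquely into a part from \<open>P w\<close> and a part from \<open>Q w\<close>, then
  multiplicativity of the weight turns the sum over the family into a product of two matrices.
\<close>
lemma walk_sum_concat:
  assumes "finite W" "\<And>w. countable (P w)"
    and disj: "\<And>w w' as as' bs bs'. w \<in> W \<Longrightarrow> w' \<in> W \<Longrightarrow> as \<in> P w \<Longrightarrow> as' \<in> P w'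
      \<Longrightarrow> bs \<in> Q w \<Longrightarrow> bs' \<in> Q w' \<Longrightarrow> as @ bs = as' @ bs' \<Longrightarrow> w = w' \<and> as = as'"
  shows "walk_sum (\<Union>z\<in>Sigma W P. (@) (snd z) ` Q (fst z)) = (\<Sum>w\<in>W. walk_sum (P w) * walk_sum (Q w))"
proof -
  have d: "disjoint_family_on (\<lambda>z. (@) (snd z) ` Q (fst z)) (Sigma W P)"
    unfolding disjoint_family_on_def using disj by (auto; blast)
  have c: "countable (Sigma W P)" using assms by (auto intro: countable_finite)
  have "walk_sum (\<Union>z\<in>Sigma W P. (@) (snd z) ` Q (fst z)) =
      (\<integral>\<^sup>+z. walk_sum ((@) (snd z) ` Q (fst z)) \<partial>count_space (Sigma W P))"
    unfolding walk_sum_def by (rule nn_integral_count_space_UN[OF c d])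
  then show ?thesis
    by (simp add: walk_sum_image_append walk_sum_Sigma[OF assms(1), where q = "\<lambda>w. walk_sum (Q w)"])
qed

lemma countable_walks: "countable {as. awalk v as w \<and> P as}"
  by (rule countable_subset[OF _ countable_lists[OF countable_arcs]]) auto

lemma countable_L_paths: "countable (L_paths G D v w)"
  unfolding L_paths_def by (rule countable_walks)

text \<open>
  For \<open>D = {}\<close> this is the Green function (\<open>green_eq\<close>); for \<open>D = D\<^sub>n\<close> it is the matrix \<open>M(n)\<close>.
\<close>
definition green_off :: "'v set \<Rightarrow> 'v \<Rightarrow> 'v \<Rightarrow> ennreal" where
  "green_off D v w = walk_sum (L_paths G D v w)"

lemma M_mat_eq_green_off: "M_mat G F \<beta> D n v w = green_off (D n) v w"
  unfolding M_mat_def green_off_def walk_sum_def wt_def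
  by (rule infsum_ennreal_eq_nn_integral[OF countable_L_paths])

lemma green_off_mono: "D \<subseteq> D' \<Longrightarrow> green_off D' v w \<le> green_off D v w"
  unfolding green_off_def by (rule walk_sum_mono) (auto simp: L_paths_def)

text \<open>
  The condition on \<^term>\<open>butlast as\<close> leaves the last arrow free: for \<open>d \<in> D\<close> these are the walks that end
  at their first return to \<open>D\<close>.
\<close>
definition return_walks :: "'v set \<Rightarrow> 'v \<Rightarrow> 'v \<Rightarrow> 'a list set" where
  "return_walks D v d = {as. awalk v as d \<and> as \<noteq> [] \<and> (\<forall>a\<in>set (butlast as). head G a \<notin> D)}"

definition return_sum :: "'v set \<Rightarrow> 'v \<Rightarrow> 'v \<Rightarrow> ennreal" where
  "return_sum D v d = walk_sum (return_walks D v d)"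

lemma countable_return_walks: "countable (return_walks D v d)"
  unfolding return_walks_def by (rule countable_walks)

lemma return_sum_le: "return_sum D v d \<le> green_off {} v d"
  unfolding return_sum_def green_off_def
  by (rule walk_sum_mono) (auto simp: L_paths_def return_walks_def)

lemma awalk_last_head: "awalk v as d \<Longrightarrow> as \<noteq> [] \<Longrightarrow> head G (last as) = d"
  using awlast_of_awalk[of v as d] by (simp add: awalk_verts_conv)

lemma return_walks_not_prefix:
  assumes "as \<in> return_walks D v d" "as @ us \<in> return_walks D v d'" "d \<in> D"
  shows "us = []"
proof (rule ccontr)
  assume "us \<noteq> []"
  then have "last as \<in> set (butlast (as @ us))"
    using assms(1) by (auto simp: butlast_append return_walks_def)
  then show False using assms awalk_last_head[of v as d] by (auto simp: return_walks_def)
qed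

lemma return_walks_end_unique: "as \<in> return_walks D v d \<Longrightarrow> as \<in> return_walks D v d' \<Longrightarrow> d = d'"
  using awalk_last_head by (fastforce simp: return_walks_def)

lemma L_paths_end_unique: "as \<in> L_paths G D v d \<Longrightarrow> as \<in> L_paths G D v d' \<Longrightarrow> d = d'"
  using awlast_of_awalk[of v as d] awlast_of_awalk[of v as d'] by (auto simp: L_paths_def)

text \<open>
  A walk that enters \<open>D\<close> after its start splits uniquely behind the first arrow whose head is in \<open>D\<close>;
  the other walks are counted by \<^term>\<open>green_off D v u\<close>.
\<close>
lemma first_return_decomposition:
  assumes "finite D" "D \<subseteq> verts G"
  shows "green_off {} v u = green_off D v u + (\<Sum>d\<in>D. return_sum D v d * green_off {} d u)"
proof -
  let ?R = "\<Union>z\<in>Sigma D (return_walks D v). (@) (snd z) ` L_paths G {} (fst z) u"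
  have R: "walk_sum ?R = (\<Sum>d\<in>D. return_sum D v d * green_off {} d u)"
    unfolding return_sum_def green_off_def
  proof (rule walk_sum_concat[OF assms(1) countable_return_walks])
    fix d d' as as' bs bs'
    assume *: "d \<in> D" "d' \<in> D" "as \<in> return_walks D v d" "as' \<in> return_walks D v d'"
      "as @ bs = as' @ bs'"
    then obtain us where "as = as' @ us \<or> as @ us = as'"
      by (auto simp: append_eq_append_conv2)
    then have "as = as'" using return_walks_not_prefix * by (metis append_Nil2)
    then show "d = d' \<and> as = as'" using * return_walks_end_unique by blast
  qed
  have U: "L_paths G {} v u = L_paths G D v u \<union> ?R"
  proof (intro equalityI subsetI)
    fix as assume as: "as \<in> L_paths G {} v u"
    show "as \<in> L_paths G D v u \<union> ?R"
    proof (cases "\<exists>a\<in>set as. head G a \<in> D")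
      case False then show ?thesis using as by (auto simp: L_paths_def)
    next
      case True
      obtain xs a ys where s: "as = xs @ a # ys" "head G a \<in> D" "\<forall>x\<in>set xs. head G x \<notin> D"
        by (rule split_list_first_propE[OF True])
      have aw: "awalk v ((xs @ [a]) @ ys) u" using as s by (auto simp: L_paths_def)
      then obtain d where d: "awalk v (xs @ [a]) d" "awalk d ys u"
        by (metis awalk_append_iff)
      have "head G a = d" using awalk_last_head[OF d(1)] by simp
      then have "xs @ [a] \<in> return_walks D v d" "d \<in> D"
        using d s by (auto simp: return_walks_def)
      moreover have "ys \<in> L_paths G {} d u" using d by (auto simp: L_paths_def)
      ultimately have "(d, xs @ [a]) \<in> Sigma D (return_walks D v)"
        "as \<in> (@) (snd (d, xs @ [a])) ` L_paths G {} (fst (d, xs @ [a])) u"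
        using s by auto
      then show ?thesis by blast
    qed
  next
    fix as assume "as \<in> L_paths G D v u \<union> ?R"
    then show "as \<in> L_paths G {} v u"
      by (auto simp: L_paths_def return_walks_def intro: awalk_appendI)
  qed
  have I: "L_paths G D v u \<inter> ?R = {}"
  proof -
    have False if "as @ bs \<in> L_paths G D v u" "as \<in> return_walks D v d" "d \<in> D" for as bs d
      using that awalk_last_head[of v as d] by (auto simp: L_paths_def return_walks_def)
    then show ?thesis by auto
  qed
  have "walk_sum (L_paths G D v u \<union> ?R) = walk_sum (L_paths G D v u) + walk_sum ?R"
    by (rule walk_sum_Un[OF I])
  then show ?thesis unfolding green_off_def R[symmetric, unfolded green_off_def] U[symmetric] by simp
qed

text \<open>
  Of two different cutting points the earlier one would be followed by a visit to \<open>D\<close>.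
\<close>
lemma last_exit_unique:
  assumes "w \<in> D" "w' \<in> D" "as \<in> L_paths G D0 v w" "as' \<in> L_paths G D0 v w'"
    "bs \<in> L_paths G D w u" "bs' \<in> L_paths G D w' u" "as @ bs = as' @ bs'"
  shows "w = w' \<and> as = as'"
proof -
  have *: False if "w' \<in> D" "as @ us \<in> L_paths G D0 v w'" "us @ bs' \<in> L_paths G D w u" "us \<noteq> []"
    for as us w w' bs'
    using that awalk_last_head[of v "as @ us" w'] by (auto simp: L_paths_def)
  obtain us where "as = as' @ us \<and> bs' = us @ bs \<or> as @ us = as' \<and> bs = us @ bs'"
    using assms(7) by (auto simp: append_eq_append_conv2)
  then have "us = []" using *[of w as' us bs w'] *[of w' as us bs' w] assms by blast
  then have "as = as'" using \<open>_ \<or> _\<close> by auto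
  then show ?thesis using assms L_paths_end_unique by blast
qed

text \<open>
  A walk from \<open>v \<in> D\<close> splits uniquely at its last visit to \<open>D\<close>, which exists because the walk starts
  there.
\<close>
lemma last_exit_decomposition:
  assumes "finite D" "v \<in> D"
  shows "green_off {} v u = (\<Sum>w\<in>D. green_off {} v w * green_off D w u)"
proof -
  let ?R = "\<Union>z\<in>Sigma D (L_paths G {} v). (@) (snd z) ` L_paths G D (fst z) u"
  have R: "walk_sum ?R = (\<Sum>d\<in>D. green_off {} v d * green_off D d u)"
    unfolding green_off_def
    by (rule walk_sum_concat[OF assms(1) countable_L_paths]) (rule last_exit_unique)
  have "L_paths G {} v u = ?R"
  proof (intro equalityI subsetI)
    fix as assume as: "as \<in> L_paths G {} v u"
    show "as \<in> ?R"
    proof (cases "\<exists>a\<in>set as. head G a \<in> D")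
      case False
      then have "as \<in> L_paths G D v u" "[] \<in> L_paths G {} v v"
        using as by (auto simp: L_paths_def awalk_Nil_iff dest: awalk_hd_in_verts)
      then have "(v, []) \<in> Sigma D (L_paths G {} v)" "as \<in> (@) (snd (v, [])) ` L_paths G D (fst (v, [])) u"
        using assms by auto
      then show ?thesis by blast
    next
      case True
      obtain xs a ys where s: "as = xs @ a # ys" "head G a \<in> D" "\<forall>x\<in>set ys. head G x \<notin> D"
        by (rule split_list_last_propE[OF True])
      have aw: "awalk v ((xs @ [a]) @ ys) u" using as s by (auto simp: L_paths_def)
      then obtain d where d: "awalk v (xs @ [a]) d" "awalk d ys u"
        by (metis awalk_append_iff)
      have "head G a = d" using awalk_last_head[OF d(1)] by simp
      then have "xs @ [a] \<in> L_paths G {} v d" "d \<in> D" "ys \<in> L_paths G D d u"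
        using d s by (auto simp: L_paths_def)
      then have "(d, xs @ [a]) \<in> Sigma D (L_paths G {} v)"
        "as \<in> (@) (snd (d, xs @ [a])) ` L_paths G D (fst (d, xs @ [a])) u"
        using s by auto
      then show ?thesis by blast
    qed
  next
    fix as assume "as \<in> ?R"
    then show "as \<in> L_paths G {} v u"
      by (auto simp: L_paths_def intro: awalk_appendI)
  qed
  then show ?thesis using R by (simp add: green_off_def)
qed

definition walks_len :: "nat \<Rightarrow> 'v \<Rightarrow> 'v \<Rightarrow> 'a list set" where
  "walks_len n v w = {as. awalk v as w \<and> length as = n}"

lemma countable_walks_len: "countable (walks_len n v w)"
  unfolding walks_len_def by (rule countable_walks)

lemma walk_sum_walks_len_Suc:
  "walk_sum (walks_len (Suc n) v w) = (\<Sum>a\<in>out_arcs G v. ennreal (wt [a]) * walk_sum (walks_len n (head G a) w))"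
proof -
  have eq: "walks_len (Suc n) v w = (\<Union>a\<in>out_arcs G v. (@) [a] ` walks_len n (head G a) w)"
    by (auto simp: walks_len_def length_Suc_conv awalk_Cons_iff image_iff)
  have d: "disjoint_family_on (\<lambda>a. (@) [a] ` walks_len n (head G a) w) (out_arcs G v)"
    by (auto simp: disjoint_family_on_def)
  have "walk_sum (walks_len (Suc n) v w) =
      (\<integral>\<^sup>+a. walk_sum ((@) [a] ` walks_len n (head G a) w) \<partial>count_space (out_arcs G v))"
    unfolding walk_sum_def eq
    by (rule nn_integral_count_space_UN[OF _ d]) (simp add: finite_out_arcs countable_finite)
  then show ?thesis
    by (simp only: walk_sum_image_append nn_integral_count_space_finite[OF finite_out_arcs])
qed

text \<open>
  The infinite sum over vertices in the matrix product has only finitely many non-zero terms, by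
  row-finiteness; grouping the arrows by their heads makes it a sum over arrows.
\<close>
lemma mat_pow_A_mat_Suc:
  "mat_pow (verts G) (A_mat G F \<beta>) (Suc n) v w =
    (\<Sum>a\<in>out_arcs G v. ennreal (wt [a]) * mat_pow (verts G) (A_mat G F \<beta>) n (head G a) w)"
proof -
  let ?P = "mat_pow (verts G) (A_mat G F \<beta>) n" and ?H = "head G ` out_arcs G v"
  have fin: "finite ?H" using finite_out_arcs by simp
  have sub: "?H \<subseteq> verts G" by auto
  have "mat_pow (verts G) (A_mat G F \<beta>) (Suc n) v w = (\<Sum>\<^sub>\<infinity>u\<in>verts G. A_mat G F \<beta> v u * ?P u w)"
    by simp
  also have "\<dots> = (\<Sum>\<^sub>\<infinity>u\<in>?H. A_mat G F \<beta> v u * ?P u w)"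
  proof (rule infsum_cong_neutral)
    fix u assume "u \<in> verts G - ?H"
    then have "out_arcs G v \<inter> in_arcs G u = {}" by auto
    then show "A_mat G F \<beta> v u * ?P u w = 0" by (simp add: A_mat_def)
  qed (use sub in auto)
  also have "\<dots> = (\<Sum>u\<in>?H. A_mat G F \<beta> v u * ?P u w)" using fin by simp
  also have "\<dots> = (\<Sum>u\<in>?H. \<Sum>a\<in>{a\<in>out_arcs G v. head G a = u}. ennreal (wt [a]) * ?P (head G a) w)"
  proof (rule sum.cong[OF refl])
    fix u
    have "out_arcs G v \<inter> in_arcs G u = {a\<in>out_arcs G v. head G a = u}" by auto
    then show "A_mat G F \<beta> v u * ?P u w = (\<Sum>a\<in>{a\<in>out_arcs G v. head G a = u}. ennreal (wt [a]) * ?P (head G a) w)"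
      by (simp add: A_mat_def wt_def sum_distrib_right del: sum_ennreal)
  qed
  also have "\<dots> = (\<Sum>a\<in>out_arcs G v. ennreal (wt [a]) * ?P (head G a) w)"
    by (rule sum.group[OF finite_out_arcs fin]) simp
  finally show ?thesis .
qed

lemma mat_pow_A_mat: "v \<in> verts G \<Longrightarrow> mat_pow (verts G) (A_mat G F \<beta>) n v w = walk_sum (walks_len n v w)"
proof (induction n arbitrary: v)
  case 0
  have "walks_len 0 v w = (if v = w then {[]} else {})"
    using 0 by (auto simp: walks_len_def awalk_Nil_iff)
  then show ?case by (simp add: walk_sum_def nn_integral_count_space_finite)
next
  case (Suc n)
  show ?case unfolding mat_pow_A_mat_Suc walk_sum_walks_len_Suc
    by (intro sum.cong refl) (simp add: Suc.IH)
qed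

lemma green_off_empty_eq: "green_off {} v w = (\<Sum>n. walk_sum (walks_len n v w))"
proof -
  have eq: "L_paths G {} v w = (\<Union>n\<in>UNIV. walks_len n v w)"
    by (auto simp: L_paths_def walks_len_def)
  show ?thesis unfolding green_off_def eq walk_sum_def
    by (subst nn_integral_count_space_UN)
      (auto simp: disjoint_family_on_def walks_len_def nn_integral_count_space_nat)
qed

lemma green_eq: "v \<in> verts G \<Longrightarrow> green G F \<beta> v w = green_off {} v w"
  unfolding green_def green_off_empty_eq by (simp add: mat_pow_A_mat)

lemma green_off_step:
  assumes "v \<in> verts G"
  shows "green_off {} v w = (if v = w then 1 else 0) + (\<Sum>a\<in>out_arcs G v. ennreal (wt [a]) * green_off {} (head G a) w)"
proof -
  have 0: "walk_sum (walks_len 0 v w) = (if v = w then 1 else 0)"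
    using mat_pow_A_mat[OF assms, of 0 w] by simp
  have "green_off {} v w = walk_sum (walks_len 0 v w) + (\<Sum>n. walk_sum (walks_len (Suc n) v w))"
    unfolding green_off_empty_eq by (subst suminf_offset[where i=1]) simp_all
  also have "(\<Sum>n. walk_sum (walks_len (Suc n) v w)) = (\<Sum>a\<in>out_arcs G v. ennreal (wt [a]) * green_off {} (head G a) w)"
    unfolding walk_sum_walks_len_Suc green_off_empty_eq
    by (subst suminf_sum) simp_all
  finally show ?thesis unfolding 0 .
qed

lemma green_off_prepend:
  assumes "awalk v as w"
  shows "ennreal (wt as) * green_off {} w u \<le> green_off {} v u"
  unfolding green_off_def walk_sum_image_append[symmetric]
  by (rule walk_sum_mono) (use assms in \<open>auto simp: L_paths_def intro: awalk_appendI\<close>)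

text \<open>
  A non-empty walk that ends in \<open>D\<close> has its last head in \<open>D\<close>, so only the empty walk counts.
\<close>
lemma green_off_in:
  assumes "u \<in> D" "v \<in> verts G"
  shows "green_off D v u = (if v = u then 1 else 0)"
proof -
  have "L_paths G D v u = (if v = u then {[]} else {})"
  proof -
    have "as = []" if "as \<in> L_paths G D v u" for as
      using that awalk_last_head[of v as u] assms by (cases "as = []") (auto simp: L_paths_def)
    moreover have "[] \<in> L_paths G D v u \<longleftrightarrow> v = u" using assms by (auto simp: L_paths_def awalk_Nil_iff)
    ultimately show ?thesis by (auto 4 3)
  qed
  then show ?thesis by (simp add: green_off_def walk_sum_def nn_integral_count_space_finite)
qed

end

section \<open>The Borel structure of the path space\<close>

context weighted_digraph begin

abbreviation Z :: "'v \<Rightarrow> (nat \<Rightarrow> 'a) set" where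
  "Z v \<equiv> cylinder G v []"

lemma inf_paths_arcs: "x \<in> inf_paths G \<Longrightarrow> x i \<in> arcs G"
  and inf_paths_step: "x \<in> inf_paths G \<Longrightarrow> head G (x i) = tail G (x (Suc i))"
  by (auto simp: inf_paths_def)

lemma inf_paths_tail_verts: "x \<in> inf_paths G \<Longrightarrow> tail G (x i) \<in> verts G"
  by (simp add: inf_paths_arcs)

lemma suffix_inf_paths: "x \<in> inf_paths G \<Longrightarrow> suffix n x \<in> inf_paths G"
  by (auto simp: inf_paths_def)

lemma prefix_Suc_snoc: "prefix (Suc n) x = prefix n x @ [x n]"
  by (simp add: subsequence_def)

lemma awalk_prefix:
  assumes "x \<in> inf_paths G"
  shows "awalk (tail G (x 0)) (prefix n x) (tail G (x n))"
proof (induction n)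
  case 0
  then show ?case using inf_paths_tail_verts[OF assms, of 0] by (simp add: awalk_Nil_iff subsequence_def)
next
  case (Suc n)
  have "awalk (tail G (x n)) [x n] (tail G (x (Suc n)))"
    using inf_paths_arcs[OF assms] inf_paths_step[OF assms, of n] by (simp add: awalk_simps flip: inf_paths_step[OF assms])
  then show ?case using Suc unfolding prefix_Suc_snoc by (rule awalk_appendI[rotated])
qed

lemma prefix_conc_suffix: "x = prefix n x \<frown> suffix n x"
  by (auto simp: conc_def subsequence_def fun_eq_iff)

lemma conc_inf_paths:
  assumes "awalk v as w" "y \<in> Z w"
  shows "as \<frown> y \<in> Z v"
  using assms
proof (induction as arbitrary: v)
  case Nil
  then show ?case by (simp add: awalk_Nil_iff)
next
  case (Cons a as)
  then have a: "a \<in> arcs G" "tail G a = v" and IH: "as \<frown> y \<in> Z (head G a)"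
    by (auto simp: awalk_Cons_iff)
  have "((a # as) \<frown> y) n = (if n = 0 then a else (as \<frown> y) (n - 1))" for n
    by (cases n) (auto simp: conc_def)
  moreover have "head G (if i = 0 then a else (as \<frown> y) (i - 1)) = tail G ((as \<frown> y) i)" for i
    using IH by (cases i) (auto simp: cylinder_def inf_paths_def)
  ultimately show ?case using IH a by (auto simp: cylinder_def inf_paths_def)
qed

lemma cylinder_eq_conc:
  assumes "awalk v as w"
  shows "cylinder G v as = (\<lambda>y. as \<frown> y) ` Z w"
proof (intro equalityI subsetI)
  fix x assume x: "x \<in> cylinder G v as"
  then have p: "prefix (length as) x = as" and xi: "x \<in> inf_paths G" and v: "tail G (x 0) = v"
    by (auto simp: cylinder_def subsequence_def intro!: nth_equalityI)
  have "awalk v as (tail G (x (length as)))"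
    using awalk_prefix[OF xi, of "length as"] p v by simp
  then have "tail G (x (length as)) = w"
    using assms awlast_of_awalk[of v as] by auto
  then have "suffix (length as) x \<in> Z w"
    using suffix_inf_paths[OF xi] by (auto simp: cylinder_def)
  moreover have "x = as \<frown> suffix (length as) x"
    using prefix_conc_suffix[of x "length as"] p by simp
  ultimately show "x \<in> (\<lambda>y. as \<frown> y) ` Z w" by blast
next
  fix x assume "x \<in> (\<lambda>y. as \<frown> y) ` Z w"
  then obtain y where "y \<in> Z w" "x = as \<frown> y" by auto
  then show "x \<in> cylinder G v as"
    using conc_inf_paths[OF assms, of y] by (auto simp: cylinder_def)
qed

lemma space_path_borel [simp]: "space (path_borel G) = inf_paths G"
  by (simp add: path_borel_def space_measure_of_conv)

lemma topspace_path_topology: "topspace (path_topology G) = inf_paths G"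
  by (auto simp: path_topology_def inf_paths_def)

lemma openin_path_topology_subset: "openin (path_topology G) U \<Longrightarrow> U \<subseteq> inf_paths G"
  using openin_subset topspace_path_topology by metis

lemma sets_path_borel: "sets (path_borel G) = sigma_sets (inf_paths G) {U. openin (path_topology G) U}"
  unfolding path_borel_def using openin_path_topology_subset by (intro sets_measure_of) blast

lemma openin_coord: "openin (path_topology G) {x \<in> inf_paths G. P (x i)}"
proof -
  have "openin (product_topology (\<lambda>_. discrete_topology (arcs G)) UNIV)
      {x \<in> topspace (product_topology (\<lambda>_. discrete_topology (arcs G)) UNIV). x i \<in> {a \<in> arcs G. P a}}"
    by (rule openin_continuous_map_preimage[OF continuous_map_product_projection]) auto
  then have "openin (path_topology G) ({x \<in> topspace (product_topology (\<lambda>_. discrete_topology (arcs G)) UNIV). x i \<in> {a \<in> arcs G. P a}} \<inter> inf_paths G)"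
    unfolding path_topology_def by (auto simp: openin_subtopology)
  also have "{x \<in> topspace (product_topology (\<lambda>_. discrete_topology (arcs G)) UNIV). x i \<in> {a \<in> arcs G. P a}} \<inter> inf_paths G
      = {x \<in> inf_paths G. P (x i)}"
    by (auto simp: inf_paths_def)
  finally show ?thesis .
qed

lemma coord_measurable [measurable]: "(\<lambda>x. x i) \<in> path_borel G \<rightarrow>\<^sub>M count_space UNIV"
proof (rule measurableI)
  fix A :: "'a set"
  have "(\<lambda>x. x i) -` A \<inter> space (path_borel G) = {x \<in> inf_paths G. x i \<in> A}" by auto
  also have "\<dots> \<in> sets (path_borel G)"
    unfolding sets_path_borel using openin_coord[of "\<lambda>a. a \<in> A" i] by (intro sigma_sets.Basic) simp
  finally show "(\<lambda>x. x i) -` A \<inter> space (path_borel G) \<in> sets (path_borel G)" .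
qed simp

lemma coord_pred: "Measurable.pred (path_borel G) (\<lambda>x. P (x i))"
  by (rule measurable_compose[OF coord_measurable]) simp

lemma sets_coord_pred:
  assumes "Measurable.pred (path_borel G) P"
  shows "{x \<in> inf_paths G. P x} \<in> sets (path_borel G)"
  using predE[OF assms] by simp

lemma cylinder_measurable [measurable]: "cylinder G v as \<in> sets (path_borel G)"
proof -
  have "{x \<in> inf_paths G. tail G (x 0) = v} \<in> sets (path_borel G)"
    by (rule sets_coord_pred[OF coord_pred])
  moreover have "{x \<in> inf_paths G. \<forall>i\<in>{..<length as}. x i = as ! i} \<in> sets (path_borel G)"
    by (rule sets_coord_pred, rule pred_intros_countable_bounded(3), rule coord_pred)
  ultimately have "{x \<in> inf_paths G. tail G (x 0) = v} \<inter> {x \<in> inf_paths G. \<forall>i\<in>{..<length as}. x i = as ! i} \<in> sets (path_borel G)"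
    by (rule sets.Int)
  also have "{x \<in> inf_paths G. tail G (x 0) = v} \<inter> {x \<in> inf_paths G. \<forall>i\<in>{..<length as}. x i = as ! i} = cylinder G v as"
    by (auto simp: cylinder_def)
  finally show ?thesis .
qed

definition cylinders :: "(nat \<Rightarrow> 'a) set set" where
  "cylinders = insert {} {cylinder G v as |v as. True}"

text \<open>
  A basic open set of the product topology restricts finitely many coordinates, hence only
  coordinates below some \<open>n\<close>.
\<close>
lemma openin_ex_cylinder:
  assumes U: "openin (path_topology G) U" and x: "x \<in> U"
  shows "\<exists>n. cylinder G (tail G (x 0)) (prefix n x) \<subseteq> U"
proof -
  obtain T where T: "openin (product_topology (\<lambda>_. discrete_topology (arcs G)) UNIV) T" "U = T \<inter> inf_paths G"
    using U by (auto simp: path_topology_def openin_subtopology)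
  obtain W where W: "finite {i. W i \<noteq> arcs G}" "x \<in> Pi\<^sub>E UNIV W" "Pi\<^sub>E UNIV W \<subseteq> T"
    using T(1) x T(2) by (auto simp: openin_product_topology_alt)
  obtain n where n: "\<forall>i\<in>{i. W i \<noteq> arcs G}. i < n"
    using W(1) finite_nat_set_iff_bounded by blast
  have "cylinder G (tail G (x 0)) (prefix n x) \<subseteq> U"
  proof
    fix y assume y: "y \<in> cylinder G (tail G (x 0)) (prefix n x)"
    have "y i \<in> W i" for i
    proof (cases "i < n")
      case True
      then have "y i = x i" using y by (auto simp: cylinder_def subsequence_def)
      then show ?thesis using W(2) by auto
    next
      case False
      then have "W i = arcs G" using n by blast
      then show ?thesis using y by (auto simp: cylinder_def inf_paths_arcs)
    qed
    then show "y \<in> U" using W(3) y T(2) by (auto simp: cylinder_def)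
  qed
  then show ?thesis by blast
qed

text \<open>
  There are only countably many cylinders, so an open set is a countable union of them.
\<close>
lemma sets_path_borel_cylinders: "sets (path_borel G) = sigma_sets (inf_paths G) cylinders"
proof (rule antisym)
  show "sigma_sets (inf_paths G) cylinders \<subseteq> sets (path_borel G)"
  proof -
    have "cylinders \<subseteq> sets (path_borel G)" by (auto simp: cylinders_def)
    from sets.sigma_sets_subset[OF this] show ?thesis by simp
  qed
  have "U \<in> sigma_sets (inf_paths G) cylinders" if U: "openin (path_topology G) U" for U
  proof -
    let ?I = "{(v, as). v \<in> verts G \<and> as \<in> lists (arcs G) \<and> cylinder G v as \<subseteq> U}"
    have c: "countable ?I"
      by (rule countable_subset[of _ "verts G \<times> lists (arcs G)"])
        (auto simp: countable_verts countable_arcs)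
    have "U = (\<Union>(v, as)\<in>?I. cylinder G v as)"
    proof (intro equalityI subsetI)
      fix x assume x: "x \<in> U"
      then have xi: "x \<in> inf_paths G" using openin_path_topology_subset[OF U] by auto
      obtain n where n: "cylinder G (tail G (x 0)) (prefix n x) \<subseteq> U"
        using openin_ex_cylinder[OF U x] by auto
      have "x \<in> cylinder G (tail G (x 0)) (prefix n x)"
        using xi by (auto simp: cylinder_def subsequence_def)
      moreover have "(tail G (x 0), prefix n x) \<in> ?I"
        using n inf_paths_tail_verts[OF xi] inf_paths_arcs[OF xi] by (auto simp: subsequence_def)
      ultimately show "x \<in> (\<Union>(v, as)\<in>?I. cylinder G v as)" by blast
    qed auto
    moreover have "(\<Union>(v, as)\<in>?I. cylinder G v as) \<in> sigma_sets (inf_paths G) cylinders"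
    proof (rule sigma_sets_UNION)
      show "countable ((\<lambda>(v, as). cylinder G v as) ` ?I)" using c by simp
      show "b \<in> sigma_sets (inf_paths G) cylinders" if "b \<in> (\<lambda>(v, as). cylinder G v as) ` ?I" for b
        using that by (auto simp: cylinders_def intro!: sigma_sets.Basic)
    qed
    ultimately show ?thesis by simp
  qed
  then show "sets (path_borel G) \<subseteq> sigma_sets (inf_paths G) cylinders"
    unfolding sets_path_borel by (intro sigma_sets_mono) auto
qed

lemma Int_stable_cylinders: "Int_stable cylinders"
proof -
  have *: "cylinder G v as \<inter> cylinder G v' as' \<in> cylinders" if "length as \<le> length as'" for v as v' as'
  proof (cases "cylinder G v as \<inter> cylinder G v' as' = {}")
    case False
    then obtain x where x: "x \<in> cylinder G v as" "x \<in> cylinder G v' as'" by auto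
    then have "v = v'" "\<forall>i<length as. as ! i = as' ! i" using that by (auto simp: cylinder_def)
    then have "cylinder G v as \<inter> cylinder G v' as' = cylinder G v' as'"
      using that by (auto simp: cylinder_def)
    then show ?thesis by (auto simp: cylinders_def)
  qed (simp add: cylinders_def)
  have **: "cylinder G v as \<inter> cylinder G v' as' \<in> cylinders" for v as v' as'
    using *[of as as' v v'] *[of as' as v' v] by (cases "length as \<le> length as'") (simp_all add: Int_commute)
  moreover have "{} \<in> cylinders" by (simp add: cylinders_def)
  ultimately show ?thesis unfolding Int_stable_def
  proof (intro ballI)
    fix A B assume *: "A \<in> cylinders" "B \<in> cylinders"
    consider "A = {}" | "B = {}" | v as v' as' where "A = cylinder G v as" "B = cylinder G v' as'"
      using * unfolding cylinders_def by blast
    then show "A \<inter> B \<in> cylinders" by cases (simp_all add: \<open>{} \<in> cylinders\<close> **)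
  qed
qed

text \<open>
  Countability of the set of arrows reduces measurability to the level sets of the coordinates.
\<close>
lemma measurable_into_path_space:
  assumes "\<And>x. x \<in> space M \<Longrightarrow> f x \<in> inf_paths G"
    and "\<And>i a. {x \<in> space M. f x i = a} \<in> sets M"
  shows "f \<in> M \<rightarrow>\<^sub>M path_borel G"
proof (rule measurable_sigma_sets[OF sets_path_borel_cylinders])
  show "cylinders \<subseteq> Pow (inf_paths G)" by (auto simp: cylinders_def cylinder_def)
  show "f \<in> space M \<rightarrow> inf_paths G" using assms by auto
  fix A assume "A \<in> cylinders"
  then consider "A = {}" | v as where "A = cylinder G v as" by (auto simp: cylinders_def)
  then show "f -` A \<inter> space M \<in> sets M"
  proof cases
    case 2
    have tail: "{x \<in> space M. tail G (f x 0) = v} = (\<Union>a\<in>{a\<in>arcs G. tail G a = v}. {x \<in> space M. f x 0 = a})"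
      using assms(1) inf_paths_arcs by auto
    have "{x \<in> space M. tail G (f x 0) = v} \<in> sets M"
      unfolding tail using countable_arcs
      by (intro sets.countable_UN') (auto intro: countable_subset assms(2))
    moreover have "{x \<in> space M. \<forall>i\<in>{..<length as}. f x i = as ! i} \<in> sets M"
      by (rule sets.sets_Collect_finite_All) (use assms(2) in auto)
    ultimately have "{x \<in> space M. tail G (f x 0) = v} \<inter> {x \<in> space M. \<forall>i\<in>{..<length as}. f x i = as ! i} \<in> sets M"
      by auto
    also have "{x \<in> space M. tail G (f x 0) = v} \<inter> {x \<in> space M. \<forall>i\<in>{..<length as}. f x i = as ! i} = f -` A \<inter> space M"
      using 2 assms(1) by (auto simp: cylinder_def)
    finally show ?thesis .
  qed simp
qed

lemma suffix_measurable [measurable]: "suffix n \<in> path_borel G \<rightarrow>\<^sub>M path_borel G"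
proof (rule measurable_into_path_space)
  show "{x \<in> space (path_borel G). suffix n x i = a} \<in> sets (path_borel G)" for i a
    unfolding space_path_borel suffix_nth by (rule sets_coord_pred[OF coord_pred])
qed (simp add: suffix_inf_paths)

lemma conc_image_eq:
  assumes "awalk v as w" "S \<subseteq> Z w"
  shows "(\<lambda>y. as \<frown> y) ` S = cylinder G v as \<inter> (suffix (length as) -` S \<inter> space (path_borel G))"
proof -
  have s: "suffix (length as) (as \<frown> y) = y" for y by (auto simp: fun_eq_iff)
  show ?thesis unfolding cylinder_eq_conc[OF assms(1)]
    using assms conc_inf_paths[OF assms(1)] by (auto simp: s image_iff cylinder_def)
qed

lemma conc_image_measurable:
  assumes "awalk v as w" "S \<subseteq> Z w" "S \<in> sets (path_borel G)"
  shows "(\<lambda>y. as \<frown> y) ` S \<in> sets (path_borel G)"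
  unfolding conc_image_eq[OF assms(1,2)]
  using measurable_sets[OF suffix_measurable assms(3)] by auto

section \<open>Conformal measures, the zero measure included\<close>

text \<open>
  The conformal measures together with the zero measure; unlike the non-zero ones these form a convex
  cone.
\<close>
definition conformal0 :: "(nat \<Rightarrow> 'a) measure \<Rightarrow> bool" where
  "conformal0 m \<longleftrightarrow>
     space m = inf_paths G \<and> sets m = sets (path_borel G) \<and>
     (\<forall>v\<in>verts G. emeasure m (Z v) < \<infinity>) \<and>
     (\<forall>a\<in>arcs G. \<forall>B\<in>sets m.
        emeasure m (shift ` (B \<inter> cylinder G (tail G a) [a])) =
        ennreal (exp (\<beta> * F a)) * emeasure m (B \<inter> cylinder G (tail G a) [a]))"

lemma conformal_iff: "conformal G F \<beta> m \<longleftrightarrow> conformal0 m \<and> emeasure m (space m) \<noteq> 0"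
  unfolding conformal_def conformal0_def by blast

lemma conformal0_space: "conformal0 m \<Longrightarrow> space m = inf_paths G"
  and conformal0_sets [measurable_cong]: "conformal0 m \<Longrightarrow> sets m = sets (path_borel G)"
  and conformal0_finite: "conformal0 m \<Longrightarrow> v \<in> verts G \<Longrightarrow> emeasure m (Z v) < \<infinity>"
  by (auto simp: conformal0_def)

text \<open>
  Conformality, read from right to left and iterated: the shift removes the first arrow, so putting an
  arrow in front multiplies the measure by the weight of the arrow.
\<close>
lemma emeasure_conc_image:
  assumes m: "conformal0 m" and "awalk v as w" "S \<subseteq> Z w" "S \<in> sets (path_borel G)"
  shows "emeasure m ((\<lambda>y. as \<frown> y) ` S) = ennreal (wt as) * emeasure m S"
  using assms(2)
proof (induction as arbitrary: v)
  case Nil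
  then show ?case by simp
next
  case (Cons a as)
  let ?T = "(\<lambda>y. as \<frown> y) ` S" and ?U = "(\<lambda>y. [a] \<frown> y) ` (\<lambda>y. as \<frown> y) ` S"
  have a: "a \<in> arcs G" "tail G a = v" "awalk v [a] (head G a)" and w: "awalk (head G a) as w"
    using Cons.prems by (auto simp: awalk_Cons_iff awalk_Nil_iff)
  have T: "?T \<subseteq> Z (head G a)" "?T \<in> sets (path_borel G)"
    using conc_inf_paths[OF w] assms(3) conc_image_measurable[OF w assms(3,4)] by auto
  have U: "?U \<in> sets m" using conc_image_measurable[OF a(3) T] conformal0_sets[OF m] by simp
  have "?U \<subseteq> cylinder G v [a]" unfolding cylinder_eq_conc[OF a(3)] using T(1) by auto
  then have Ui: "?U \<inter> cylinder G (tail G a) [a] = ?U" using a by auto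
  have "shift ` ?U = ?T"
  proof -
    have "shift ([a] \<frown> y) = y" for y by (auto simp: shift_def conc_def)
    then show ?thesis by (simp add: image_image)
  qed
  then have "emeasure m ?T = ennreal (exp (\<beta> * F a)) * emeasure m ?U"
    using m U a(1) Ui unfolding conformal0_def by metis
  then have "ennreal (wt [a]) * emeasure m ?T = (ennreal (wt [a]) * ennreal (exp (\<beta> * F a))) * emeasure m ?U"
    by (simp add: mult.assoc)
  also have "ennreal (wt [a]) * ennreal (exp (\<beta> * F a)) = 1"
    by (simp add: wt_def flip: ennreal_mult exp_add)
  finally have "emeasure m ?U = ennreal (wt [a]) * emeasure m ?T" by simp
  also have "\<dots> = ennreal (wt (a # as)) * emeasure m S"
    using Cons.IH[OF w] by (simp add: wt_Cons[of a as] ennreal_mult mult.assoc)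
  also have "?U = (\<lambda>y. (a # as) \<frown> y) ` S" by (simp add: image_image)
  finally show ?case .
qed

lemma emeasure_cylinder:
  assumes "conformal0 m" "awalk v as w"
  shows "emeasure m (cylinder G v as) = ennreal (wt as) * emeasure m (Z w)"
  unfolding cylinder_eq_conc[OF assms(2)] by (rule emeasure_conc_image[OF assms]) auto

lemma awalk_end_unique: "awalk v as w \<Longrightarrow> awalk v as w' \<Longrightarrow> w = w'"
  using awlast_of_awalk[of v as w] awlast_of_awalk[of v as w'] by simp

text \<open>
  The counterpart of \<open>walk_sum_concat\<close> for measures of infinite paths.  By symmetry, uniqueness of the
  cut has to be known only when the first walk is not the longer one.
\<close>
lemma emeasure_concat:
  assumes m: "conformal0 m" and "finite W" "\<And>w. countable (P w)"
    and P: "\<And>w as. w \<in> W \<Longrightarrow> as \<in> P w \<Longrightarrow> awalk v as w"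
    and S: "\<And>w. w \<in> W \<Longrightarrow> S w \<subseteq> Z w" "\<And>w. w \<in> W \<Longrightarrow> S w \<in> sets (path_borel G)"
    and disj: "\<And>w w' as as' x x'. w \<in> W \<Longrightarrow> w' \<in> W \<Longrightarrow> as \<in> P w \<Longrightarrow> as' \<in> P w'
      \<Longrightarrow> x \<in> S w \<Longrightarrow> x' \<in> S w' \<Longrightarrow> as \<frown> x = as' \<frown> x' \<Longrightarrow> length as \<le> length as' \<Longrightarrow> as = as'"
  shows "(\<Union>z\<in>Sigma W P. (\<lambda>x. snd z \<frown> x) ` S (fst z)) \<in> sets (path_borel G)" (is "?U \<in> _")
    and "emeasure m (\<Union>z\<in>Sigma W P. (\<lambda>x. snd z \<frown> x) ` S (fst z)) = (\<Sum>w\<in>W. walk_sum (P w) * emeasure m (S w))"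
proof -
  have d: "disjoint_family_on (\<lambda>z. (\<lambda>x. snd z \<frown> x) ` S (fst z)) (Sigma W P)"
    unfolding disjoint_family_on_def
  proof (intro ballI impI)
    fix z z' assume z: "z \<in> Sigma W P" "z' \<in> Sigma W P" "z \<noteq> z'"
    show "(\<lambda>x. snd z \<frown> x) ` S (fst z) \<inter> (\<lambda>x. snd z' \<frown> x) ` S (fst z') = {}"
    proof (rule ccontr)
      assume "\<not> ?thesis"
      then obtain x x' where x: "x \<in> S (fst z)" "x' \<in> S (fst z')" "snd z \<frown> x = snd z' \<frown> x'" by auto
      have "snd z = snd z'"
      proof (cases "length (snd z) \<le> length (snd z')")
        case True
        show ?thesis by (rule disj[OF _ _ _ _ x True]) (use z in auto)
      next
        case False
        then have le: "length (snd z') \<le> length (snd z)" by simp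
        show ?thesis by (rule disj[OF _ _ _ _ x(2,1) x(3)[symmetric] le, symmetric]) (use z in auto)
      qed
      moreover have "fst z = fst z'"
      proof (rule awalk_end_unique)
        show "awalk v (snd z) (fst z)" using z by (intro P) auto
        show "awalk v (snd z) (fst z')" using z \<open>snd z = snd z'\<close> by (intro P) auto
      qed
      ultimately show False using z(3) by (simp add: prod_eq_iff)
    qed
  qed
  have c: "countable (Sigma W P)" using assms by (auto intro: countable_finite)
  have meas: "(\<lambda>x. snd z \<frown> x) ` S (fst z) \<in> sets (path_borel G)" if "z \<in> Sigma W P" for z
    using that by (intro conc_image_measurable[OF P S]) auto
  show "?U \<in> sets (path_borel G)" using meas c by (intro sets.countable_UN') auto
  have "emeasure m ?U = (\<integral>\<^sup>+z. emeasure m ((\<lambda>x. snd z \<frown> x) ` S (fst z)) \<partial>count_space (Sigma W P))"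
    by (rule emeasure_UN_countable[OF _ c d]) (simp add: meas conformal0_sets[OF m])
  also have "\<dots> = (\<integral>\<^sup>+z. ennreal (wt (snd z)) * emeasure m (S (fst z)) \<partial>count_space (Sigma W P))"
    by (intro nn_integral_cong) (auto intro!: emeasure_conc_image[OF m P S])
  also have "\<dots> = (\<Sum>w\<in>W. walk_sum (P w) * emeasure m (S w))"
    by (rule walk_sum_Sigma[OF assms(2), where q="\<lambda>w. emeasure m (S w)"])
  finally show "emeasure m ?U = (\<Sum>w\<in>W. walk_sum (P w) * emeasure m (S w))" .
qed

lemma emeasure_Z_harmonic:
  assumes m: "conformal0 m"
  shows "emeasure m (Z v) = (\<Sum>a\<in>out_arcs G v. ennreal (wt [a]) * emeasure m (Z (head G a)))"
proof -
  have eq: "Z v = (\<Union>a\<in>out_arcs G v. cylinder G v [a])"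
    by (auto simp: cylinder_def inf_paths_arcs)
  have d: "disjoint_family_on (\<lambda>a. cylinder G v [a]) (out_arcs G v)"
    by (auto simp: disjoint_family_on_def cylinder_def)
  have "emeasure m (Z v) = (\<Sum>a\<in>out_arcs G v. emeasure m (cylinder G v [a]))"
    unfolding eq by (rule sum_emeasure[OF _ d finite_out_arcs, symmetric]) (simp add: conformal0_sets[OF m] image_subset_iff)
  also have "\<dots> = (\<Sum>a\<in>out_arcs G v. ennreal (wt [a]) * emeasure m (Z (head G a)))"
    by (intro sum.cong refl emeasure_cylinder[OF m]) (auto simp: awalk_simps)
  finally show ?thesis .
qed

lemma conformal0_eqI:
  assumes m: "conformal0 m" "conformal0 m'" and eq: "\<And>v. v \<in> verts G \<Longrightarrow> emeasure m (Z v) = emeasure m' (Z v)"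
  shows "m = m'"
proof (rule measure_eqI_generator_eq_countable[OF Int_stable_cylinders])
  show "cylinders \<subseteq> Pow (inf_paths G)" by (auto simp: cylinders_def cylinder_def)
  show "sets m = sigma_sets (inf_paths G) cylinders" "sets m' = sigma_sets (inf_paths G) cylinders"
    using m by (simp_all add: conformal0_sets sets_path_borel_cylinders)
  show "(Z ` verts G) \<subseteq> cylinders" "countable (Z ` verts G)"
    by (auto simp: cylinders_def countable_verts)
  show "\<Union> (Z ` verts G) = inf_paths G"
    using inf_paths_tail_verts by (auto simp: cylinder_def)
  show "emeasure m A \<noteq> \<infinity>" if "A \<in> Z ` verts G" for A
    using that conformal0_finite[OF m(1)] by (auto simp: less_top)
  fix A assume "A \<in> cylinders"
  then consider "A = {}" | v as where "A = cylinder G v as" by (auto simp: cylinders_def)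
  then show "emeasure m A = emeasure m' A"
  proof cases
    case (2 v as)
    show ?thesis
    proof (cases "cylinder G v as = {}")
      case False
      then obtain x where x: "x \<in> cylinder G v as" by auto
      then have "prefix (length as) x = as" "x \<in> inf_paths G" "tail G (x 0) = v"
        by (auto simp: cylinder_def subsequence_def intro!: nth_equalityI)
      then have "awalk v as (tail G (x (length as)))" using awalk_prefix[of x "length as"] by simp
      then show ?thesis unfolding 2
        using emeasure_cylinder[OF m(1)] emeasure_cylinder[OF m(2)] eq awalk_last_in_verts by metis
    qed (simp add: 2)
  qed simp
qed

end

section \<open>Wandering paths and the decompositions of their measure\<close>

context weighted_digraph begin

lemma Wan_iff: "x \<in> Wan G \<longleftrightarrow> x \<in> inf_paths G \<and> (\<forall>u\<in>verts G. \<exists>N. \<forall>i\<ge>N. tail G (x i) \<noteq> u)"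
proof
  assume x: "x \<in> Wan G"
  have "\<exists>N. \<forall>i\<ge>N. tail G (x i) \<noteq> u" if "u \<in> verts G" for u
  proof -
    have "\<exists>N. \<forall>i\<ge>N. tail G (x i) \<notin> {u}" using x that unfolding Wan_def by blast
    then show ?thesis by simp
  qed
  then show "x \<in> inf_paths G \<and> (\<forall>u\<in>verts G. \<exists>N. \<forall>i\<ge>N. tail G (x i) \<noteq> u)"
    using x by (simp add: Wan_def)
next
  assume x: "x \<in> inf_paths G \<and> (\<forall>u\<in>verts G. \<exists>N. \<forall>i\<ge>N. tail G (x i) \<noteq> u)"
  have "\<exists>N. \<forall>i\<ge>N. tail G (x i) \<notin> H" if "finite H" "H \<subseteq> verts G" for H
    using that
  proof (induction H rule: finite_induct)
    case (insert u H)
    then obtain N where N: "\<forall>i\<ge>N. tail G (x i) \<notin> H" by auto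
    obtain N' where N': "\<forall>i\<ge>N'. tail G (x i) \<noteq> u" using x insert.prems by blast
    show ?case using N N' by (intro exI[of _ "max N N'"]) auto
  qed simp
  then show "x \<in> Wan G" using x by (simp add: Wan_def)
qed

lemma Wan_inf_paths: "x \<in> Wan G \<Longrightarrow> x \<in> inf_paths G"
  by (simp add: Wan_def)

lemma Wan_measurable: "Wan G \<in> sets (path_borel G)"
proof -
  let ?R = "\<lambda>u. {x \<in> inf_paths G. \<forall>N. \<exists>i\<in>{N..}. tail G (x i) = u}"
  have "?R u \<in> sets (path_borel G)" for u
    by (rule sets_coord_pred) (intro pred_intros_countable_bounded(4) pred_intros_countable(1) coord_pred)
  then have "space (path_borel G) - (\<Union>u\<in>verts G. ?R u) \<in> sets (path_borel G)"
    using countable_verts by (intro sets.compl_sets sets.countable_UN') auto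
  also have "space (path_borel G) - (\<Union>u\<in>verts G. ?R u) = Wan G"
    by (simp add: set_eq_iff Wan_iff Ball_def Bex_def) blast
  finally show ?thesis .
qed

lemma suffix_Wan: "x \<in> Wan G \<Longrightarrow> suffix n x \<in> Wan G"
  using suffix_inf_paths trans_le_add2 unfolding Wan_iff suffix_nth by meson

lemma conc_Wan:
  assumes "as \<frown> y \<in> inf_paths G" "y \<in> Wan G"
  shows "as \<frown> y \<in> Wan G"
  unfolding Wan_iff
proof (intro conjI ballI)
  fix u assume "u \<in> verts G"
  then obtain N where N: "\<forall>i\<ge>N. tail G (y i) \<noteq> u" using assms(2) by (auto simp: Wan_iff)
  show "\<exists>N. \<forall>i\<ge>N. tail G ((as \<frown> y) i) \<noteq> u"
    using N by (intro exI[of _ "N + length as"]) (auto simp: conc_def)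
qed fact

lemma tails_avoid_iff_heads_avoid:
  assumes "x \<in> inf_paths G"
  shows "(\<forall>i\<ge>1. tail G (x i) \<notin> D) \<longleftrightarrow> (\<forall>i. head G (x i) \<notin> D)"
proof -
  have "(\<forall>i\<ge>1. tail G (x i) \<notin> D) \<longleftrightarrow> (\<forall>i. tail G (x (Suc i)) \<notin> D)"
    by (metis Suc_le_D One_nat_def Suc_le_mono zero_le)
  then show ?thesis by (simp add: inf_paths_step[OF assms])
qed

lemma Omega_iff: "x \<in> Omega G D w \<longleftrightarrow> x \<in> Wan G \<and> x \<in> Z w \<and> (\<forall>i. head G (x i) \<notin> D)"
  using tails_avoid_iff_heads_avoid[of x D] by (auto simp: Omega_def cylinder_def Wan_def)

lemma heads_conc: "(\<forall>i. head G ((as \<frown> y) i) \<notin> D) \<longleftrightarrow> (\<forall>a\<in>set as. head G a \<notin> D) \<and> (\<forall>i. head G (y i) \<notin> D)"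
proof -
  have *: "(\<forall>i. head G (x i) \<notin> D) \<longleftrightarrow> (\<forall>a\<in>range x. head G a \<notin> D)" for x by auto
  show ?thesis unfolding *[of "as \<frown> y"] *[of y] range_conc ball_Un by simp
qed

lemma avoiding_measurable: "{x \<in> Z v. \<forall>i. head G (x i) \<notin> D} \<in> sets (path_borel G)"
proof -
  have "{x \<in> inf_paths G. \<forall>i. head G (x i) \<notin> D} \<in> sets (path_borel G)"
    by (rule sets_coord_pred) (intro pred_intros_countable coord_pred)
  moreover have "{x \<in> Z v. \<forall>i. head G (x i) \<notin> D} = Z v \<inter> {x \<in> inf_paths G. \<forall>i. head G (x i) \<notin> D}"
    by (auto simp: cylinder_def)
  ultimately show ?thesis by auto
qed

lemma Omega_measurable: "Omega G D w \<in> sets (path_borel G)"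
proof -
  have "Omega G D w = {x \<in> Z w. \<forall>i. head G (x i) \<notin> D} \<inter> Wan G" by (auto simp: Omega_iff)
  then show ?thesis using avoiding_measurable Wan_measurable by auto
qed

lemma prefix_in_L_paths:
  assumes "x \<in> Z v" "\<forall>j<n. head G (x j) \<notin> D"
  shows "prefix n x \<in> L_paths G D v (tail G (x n))"
  using awalk_prefix[of x n] assms by (auto simp: L_paths_def cylinder_def subsequence_def)

text \<open>
  A wandering path visits the finite set \<open>D\<close> only finitely often, so there is a last visit after time \<open>i\<close>.
\<close>
lemma ex_last_exit:
  assumes x: "x \<in> Wan G" and D: "finite D" "tail G (x i) \<in> D"
  obtains n where "n \<ge> i" "tail G (x n) \<in> D" "suffix n x \<in> Omega G D (tail G (x n))"
proof -
  have xi: "x \<in> inf_paths G" using x by (rule Wan_inf_paths)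
  have "D \<inter> verts G \<subseteq> verts G" "finite (D \<inter> verts G)" using D by auto
  then obtain N where N: "\<forall>i\<ge>N. tail G (x i) \<notin> D \<inter> verts G"
    using x unfolding Wan_def by blast
  let ?I = "{i. tail G (x i) \<in> D}"
  have "?I \<subseteq> {..<N}" using N inf_paths_tail_verts[OF xi] by (auto simp: not_le[symmetric])
  then have fin: "finite ?I" by (rule finite_subset) simp
  \<comment> \<open>the last visit overall is also the last one after time \<open>i\<close>\<close>
  define n where "n = Max ?I"
  have i: "i \<in> ?I" using D by simp
  then have n: "tail G (x n) \<in> D" using Max_in[OF fin] n_def by blast
  have after: "tail G (x i) \<notin> D" if "i > n" for i
    using Max_ge[OF fin, of i] that n_def by auto
  have "head G (suffix n x i) \<notin> D" for i
    using after[of "Suc (n + i)"] inf_paths_step[OF xi, of "n + i"] by simp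
  then have "suffix n x \<in> Omega G D (tail G (x n))"
    using suffix_Wan[OF x] suffix_inf_paths[OF xi] by (auto simp: Omega_iff cylinder_def)
  moreover have "n \<ge> i" using Max_ge[OF fin i] n_def by simp
  ultimately show thesis using n that by blast
qed

text \<open>
  Cut a wandering path at its last visit to \<open>D'\<close>.  For \<open>D = {}\<close> this computes the measure of the set of
  wandering paths in \<open>Z v\<close> from the measures of the sets \<open>Omega D' w\<close>; for consecutive sets of an exhaustion it is the equation that
  defines \<open>Delta\<close>.
\<close>
lemma last_exit_emeasure:
  assumes m: "conformal0 m" and D: "finite D'" "D \<subseteq> D'" "v \<in> D'"
  shows "emeasure m (Omega G D v) = (\<Sum>w\<in>D'. green_off D v w * emeasure m (Omega G D' w))"
proof -
  let ?U = "\<Union>z\<in>Sigma D' (L_paths G D v). (\<lambda>x. snd z \<frown> x) ` Omega G D' (fst z)"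
  have "Omega G D v = ?U"
  proof (intro equalityI subsetI)
    fix x assume x: "x \<in> Omega G D v"
    then have xs: "x \<in> Wan G" "x \<in> inf_paths G" "x \<in> Z v" "tail G (x 0) = v" "\<And>i. head G (x i) \<notin> D"
      by (auto simp: Omega_iff Wan_def cylinder_def)
    have "tail G (x 0) \<in> D'" using D xs by simp
    then obtain n where n: "tail G (x n) \<in> D'" and "suffix n x \<in> Omega G D' (tail G (x n))"
      using ex_last_exit[OF xs(1) D(1)] by blast
    moreover have "prefix n x \<in> L_paths G D v (tail G (x n))"
      by (rule prefix_in_L_paths) (use xs in auto)
    ultimately have "(tail G (x n), prefix n x) \<in> Sigma D' (L_paths G D v)"
      "x \<in> (\<lambda>x. snd (tail G (x n), prefix n x) \<frown> x) ` Omega G D' (fst (tail G (x n), prefix n x)) \<or>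
       x = prefix n x \<frown> suffix n x \<and> suffix n x \<in> Omega G D' (tail G (x n))"
      using n prefix_conc_suffix[of x n] by auto
    then show "x \<in> ?U" using prefix_conc_suffix[of x n] \<open>suffix n x \<in> _\<close>
      by (intro UN_I[of "(tail G (x n), prefix n x)"]) (auto intro!: image_eqI[of _ _ "suffix n x"])
  next
    fix x assume "x \<in> ?U"
    then obtain w as y where *: "w \<in> D'" "as \<in> L_paths G D v w" "y \<in> Omega G D' w" "x = as \<frown> y"
      by auto
    then have "as \<frown> y \<in> Z v" by (intro conc_inf_paths[of v as w]) (auto simp: L_paths_def Omega_iff)
    moreover from this have "as \<frown> y \<in> Wan G"
      using * by (intro conc_Wan) (auto simp: Omega_iff cylinder_def)
    ultimately show "x \<in> Omega G D v"
      using * D by (auto simp: Omega_iff heads_conc L_paths_def)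
  qed
  moreover have "emeasure m ?U = (\<Sum>w\<in>D'. walk_sum (L_paths G D v w) * emeasure m (Omega G D' w))"
  proof (rule emeasure_concat[OF m D(1) countable_L_paths])
    fix w w' as as' x x'
    assume *: "w \<in> D'" "w' \<in> D'" "as \<in> L_paths G D v w" "as' \<in> L_paths G D v w'"
      "x \<in> Omega G D' w" "x' \<in> Omega G D' w'" "as \<frown> x = as' \<frown> x'" "length as \<le> length as'"
    then obtain us where us: "as' = as @ us" "x = us \<frown> x'" by (auto elim: conc_eq_conc_cases)
    have "us = []"
    proof (rule ccontr)
      assume "us \<noteq> []"
      then have "last us \<in> set us" "head G (last us) = w'"
        using awalk_last_head[of v as' w'] * us by (auto simp: L_paths_def)
      moreover have "\<forall>a\<in>set us. head G a \<notin> D'"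
        using *(5) by (auto simp: us(2) Omega_iff heads_conc)
      ultimately show False using *(2) by auto
    qed
    then show "as = as'" using us by simp
  qed (auto simp: L_paths_def Omega_iff Omega_measurable)
  ultimately show ?thesis by (simp add: green_off_def)
qed

text \<open>
  Cut a path at its first return to \<open>D\<close>.  What remains are the paths that never return; that almost all
  of these are wandering is a separate matter, see \<open>first_return_emeasure\<close>.
\<close>
lemma first_return_emeasure_avoiding:
  assumes m: "conformal0 m" and D: "finite D"
  shows "emeasure m (Z v) = emeasure m {x \<in> Z v. \<forall>i. head G (x i) \<notin> D}
    + (\<Sum>d\<in>D. return_sum D v d * emeasure m (Z d))"
proof -
  let ?U = "\<Union>z\<in>Sigma D (return_walks D v). (\<lambda>x. snd z \<frown> x) ` Z (fst z)"
  let ?V = "{x \<in> Z v. \<forall>i. head G (x i) \<notin> D}"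
  have aw: "w \<in> D \<Longrightarrow> as \<in> return_walks D v w \<Longrightarrow> awalk v as w" for w as
    by (auto simp: return_walks_def)
  have disj: "as = as'" if *: "w \<in> D" "w' \<in> D" "as \<in> return_walks D v w" "as' \<in> return_walks D v w'"
      "as \<frown> x = as' \<frown> x'" "length as \<le> length as'" for w w' as as' x x'
  proof -
    obtain us where us: "as' = as @ us" "x = us \<frown> x'" using * by (auto elim: conc_eq_conc_cases)
    then show ?thesis using return_walks_not_prefix[of as D v w us w'] * by auto
  qed
  have U: "?U \<in> sets (path_borel G)"
    "emeasure m ?U = (\<Sum>d\<in>D. walk_sum (return_walks D v d) * emeasure m (Z d))"
    by (rule emeasure_concat[OF m D countable_return_walks aw]; (rule disj | simp); assumption)+
  have "Z v = ?V \<union> ?U"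
  proof (intro equalityI subsetI)
    fix x assume x: "x \<in> Z v"
    then have xi: "x \<in> inf_paths G" by (simp add: cylinder_def)
    show "x \<in> ?V \<union> ?U"
    proof (cases "\<forall>i. head G (x i) \<notin> D")
      case False
      define n where "n = (LEAST i. head G (x i) \<in> D)"
      have n: "head G (x n) \<in> D" using False unfolding n_def by (metis (mono_tags) LeastI_ex)
      have before: "head G (x i) \<notin> D" if "i < n" for i
        using not_less_Least that unfolding n_def by blast
      have "awalk v (prefix (Suc n) x) (tail G (x (Suc n)))"
        using awalk_prefix[OF xi, of "Suc n"] x by (simp add: cylinder_def)
      moreover have "\<forall>a\<in>set (prefix n x). head G a \<notin> D" using before by (auto simp: subsequence_def)
      ultimately have "prefix (Suc n) x \<in> return_walks D v (tail G (x (Suc n)))"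
        unfolding return_walks_def by (simp add: prefix_Suc_snoc)
      moreover have "tail G (x (Suc n)) \<in> D" using n inf_paths_step[OF xi, of n] by simp
      moreover have "suffix (Suc n) x \<in> Z (tail G (x (Suc n)))"
        using suffix_inf_paths[OF xi] by (simp add: cylinder_def)
      ultimately have "x \<in> ?U" using prefix_conc_suffix[of x "Suc n"]
        by (intro UN_I[of "(tail G (x (Suc n)), prefix (Suc n) x)"]) (auto intro!: image_eqI[of _ _ "suffix (Suc n) x"])
      then show ?thesis by simp
    qed (use x in simp)
  next
    fix x assume "x \<in> ?V \<union> ?U"
    then show "x \<in> Z v" using conc_inf_paths by (auto dest!: aw)
  qed
  moreover have "?V \<inter> ?U = {}"
  proof -
    have False if "as \<in> return_walks D v d" "d \<in> D" "\<forall>i. head G ((as \<frown> y) i) \<notin> D" for as d y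
    proof -
      have "as \<noteq> []" "head G (last as) = d" using that awalk_last_head[of v as d] by (auto simp: return_walks_def)
      then show False using that by (auto simp: heads_conc)
    qed
    then show ?thesis by auto
  qed
  ultimately have "emeasure m (Z v) = emeasure m ?V + emeasure m ?U"
    using U avoiding_measurable plus_emeasure[of ?V m ?U] conformal0_sets[OF m] by simp
  then show ?thesis using U by (simp add: return_sum_def)
qed

lemma emeasure_visits:
  assumes m: "conformal0 m"
  shows "{x \<in> Z v. tail G (x n) = u} \<in> sets (path_borel G)"
    and "emeasure m {x \<in> Z v. tail G (x n) = u} = walk_sum (walks_len n v u) * emeasure m (Z u)"
proof -
  let ?A = "{x \<in> Z v. tail G (x n) = u}"
  let ?U = "\<Union>z\<in>Sigma {u} (walks_len n v). (\<lambda>x. snd z \<frown> x) ` Z (fst z)"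
  have "?A = ?U"
  proof (intro equalityI subsetI)
    fix x assume x: "x \<in> ?A"
    then have xi: "x \<in> inf_paths G" by (simp add: cylinder_def)
    have "prefix n x \<in> walks_len n v u" "suffix n x \<in> Z u"
      using awalk_prefix[OF xi, of n] suffix_inf_paths[OF xi] x
      by (auto simp: walks_len_def cylinder_def subsequence_def)
    then show "x \<in> ?U" using prefix_conc_suffix[of x n] by (auto intro!: bexI[of _ "prefix n x"] image_eqI[of _ _ "suffix n x"])
  next
    fix x assume "x \<in> ?U"
    then obtain as y where "awalk v as u" "length as = n" "y \<in> Z u" "x = as \<frown> y"
      by (auto simp: walks_len_def)
    then show "x \<in> ?A" using conc_inf_paths[of v as u y] by (auto simp: cylinder_def conc_def)
  qed
  moreover have "?U \<in> sets (path_borel G)"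
    "emeasure m ?U = (\<Sum>w\<in>{u}. walk_sum (walks_len n v w) * emeasure m (Z w))"
    by (rule emeasure_concat[OF m _ countable_walks_len];
        auto simp: walks_len_def elim: conc_eq_conc_cases)+
  ultimately show "?A \<in> sets (path_borel G)" "emeasure m ?A = walk_sum (walks_len n v u) * emeasure m (Z u)"
    by simp_all
qed

end

locale transient_digraph = weighted_digraph +
  fixes v0 :: 'a
  assumes v0: "v0 \<in> verts G"
    and green_v0: "\<And>v. v \<in> verts G \<Longrightarrow> 0 < green G F \<beta> v0 v \<and> green G F \<beta> v0 v < \<infinity>"
begin

lemma ex_walk_from_v0:
  assumes "v \<in> verts G"
  obtains as where "awalk v0 as v"
proof -
  have "L_paths G {} v0 v \<noteq> {}"
  proof
    assume "L_paths G {} v0 v = {}"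
    then have "green_off {} v0 v = 0" by (simp add: green_off_def walk_sum_def nn_integral_count_space_finite)
    then show False using green_v0[OF assms] green_eq[OF v0] by simp
  qed
  then show thesis using that by (auto simp: L_paths_def)
qed

text \<open>
  Walks from \<open>v\<close> can be continued backwards to \<open>v0\<close>, where the Green function is finite.
\<close>
lemma green_off_finite:
  assumes "v \<in> verts G" "w \<in> verts G"
  shows "green_off D v w < \<infinity>"
proof -
  obtain as where as: "awalk v0 as v" using ex_walk_from_v0[OF assms(1)] .
  have "ennreal (wt as) * green_off {} v w \<le> green_off {} v0 w" by (rule green_off_prepend[OF as])
  also have "\<dots> < \<infinity>" using green_v0[OF assms(2)] green_eq[OF v0] by simp
  finally have "green_off {} v w < \<infinity>"
    by (metis ennreal_eq_0_iff ennreal_mult_eq_top_iff infinity_ennreal_def not_le top.not_eq_extremum wt_pos)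
  moreover have "green_off D v w \<le> green_off {} v w" by (rule green_off_mono) simp
  ultimately show ?thesis by (rule order.strict_trans1[rotated])
qed

lemma return_sum_finite: "v \<in> verts G \<Longrightarrow> w \<in> verts G \<Longrightarrow> return_sum D v w < \<infinity>"
  using return_sum_le green_off_finite by (rule order.strict_trans1)

text \<open>
  The paths from \<open>v\<close> that are in \<open>u\<close> at time \<open>n\<close> have measure \<open>m (Z u)\<close> times the weight of the walks of
  length \<open>n\<close>.  The sum of these measures over \<open>n\<close> is \<open>green_off {} v u * m (Z u)\<close>, which is finite, and
  the Borel-Cantelli lemma applies.
\<close>
lemma Wan_conull:
  assumes m: "conformal0 m"
  shows "inf_paths G - Wan G \<in> null_sets m"
proof -
  have "AE x in m. \<exists>N. \<forall>i\<ge>N. \<not> (x \<in> Z v \<and> tail G (x i) = u)" if v: "v \<in> verts G" and u: "u \<in> verts G" for v u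
  proof -
    let ?A = "\<lambda>n. {x \<in> Z v. tail G (x n) = u}"
    have fin: "emeasure m (?A n) < \<infinity>" for n
    proof -
      have "emeasure m (?A n) \<le> emeasure m (Z v)"
        by (rule emeasure_mono) (auto simp: conformal0_sets[OF m])
      then show ?thesis using conformal0_finite[OF m v] by (rule order.strict_trans1)
    qed
    have "(\<Sum>n. ennreal (measure m (?A n))) = (\<Sum>n. walk_sum (walks_len n v u) * emeasure m (Z u))"
    proof (rule arg_cong[where f=suminf], rule ext)
      fix n
      have "ennreal (measure m (?A n)) = emeasure m (?A n)"
        using fin by (intro emeasure_eq_ennreal_measure[symmetric]) (simp add: less_top)
      then show "ennreal (measure m (?A n)) = walk_sum (walks_len n v u) * emeasure m (Z u)"
        by (simp add: emeasure_visits[OF m])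
    qed
    also have "\<dots> = green_off {} v u * emeasure m (Z u)"
      by (simp add: green_off_empty_eq)
    also have "\<dots> < \<infinity>"
      using green_off_finite[OF v u] conformal0_finite[OF m u] by (simp add: ennreal_mult_less_top)
    finally have "summable (\<lambda>n. measure m (?A n))"
      by (intro summable_suminf_not_top) (auto simp: less_top)
    then have "AE x in m. eventually (\<lambda>n. x \<in> space m - ?A n) sequentially"
      using fin emeasure_visits(1)[OF m] by (intro borel_cantelli_AE1) (auto simp: conformal0_sets[OF m])
    then show ?thesis by eventually_elim (auto simp: eventually_sequentially)
  qed
  then have "AE x in m. \<forall>v\<in>verts G. \<forall>u\<in>verts G. \<exists>N. \<forall>i\<ge>N. \<not> (x \<in> Z v \<and> tail G (x i) = u)"
    by (simp add: AE_ball_countable countable_verts)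
  then have "AE x in m. x \<in> Wan G"
  proof (rule AE_mp, intro AE_I2 impI)
    fix x assume x: "x \<in> space m"
      and *: "\<forall>v\<in>verts G. \<forall>u\<in>verts G. \<exists>N. \<forall>i\<ge>N. \<not> (x \<in> Z v \<and> tail G (x i) = u)"
    have "x \<in> inf_paths G" using x conformal0_space[OF m] by simp
    then have "tail G (x 0) \<in> verts G" "x \<in> Z (tail G (x 0))"
      using inf_paths_tail_verts by (auto simp: cylinder_def)
    then show "x \<in> Wan G" unfolding Wan_iff using * \<open>x \<in> inf_paths G\<close> by blast
  qed
  moreover have "{x \<in> space m. x \<notin> Wan G} = inf_paths G - Wan G" using conformal0_space[OF m] by auto
  moreover have "inf_paths G - Wan G \<in> sets m"
    using Wan_measurable sets.compl_sets[OF Wan_measurable] conformal0_sets[OF m] by simp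
  ultimately show ?thesis using AE_iff_null[of m "\<lambda>x. x \<in> Wan G"] by simp
qed

lemma emeasure_Int_Wan:
  assumes m: "conformal0 m" and S: "S \<in> sets (path_borel G)"
  shows "emeasure m (S \<inter> Wan G) = emeasure m S"
proof -
  have "emeasure m (S - (inf_paths G - Wan G)) = emeasure m S"
    by (rule emeasure_Diff_null_set[OF Wan_conull[OF m]]) (simp add: S conformal0_sets[OF m])
  moreover have "S - (inf_paths G - Wan G) = S \<inter> Wan G"
    using sets.sets_into_space[OF S] by auto
  ultimately show ?thesis by simp
qed

lemma first_return_emeasure:
  assumes m: "conformal0 m" and D: "finite D"
  shows "emeasure m (Z v) = emeasure m (Omega G D v) + (\<Sum>d\<in>D. return_sum D v d * emeasure m (Z d))"
proof -
  have "Omega G D v = {x \<in> Z v. \<forall>i. head G (x i) \<notin> D} \<inter> Wan G" by (auto simp: Omega_iff)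
  then show ?thesis
    using first_return_emeasure_avoiding[OF m D, of v] emeasure_Int_Wan[OF m avoiding_measurable[of v D]] by simp
qed

lemma Omega_empty_emeasure:
  assumes m: "conformal0 m"
  shows "emeasure m (Omega G {} v) = emeasure m (Z v)"
  using first_return_emeasure[OF m, of "{}" v] by simp

end

section \<open>The conformal measure of a harmonic function\<close>

text \<open>
  Intervals of lengths \<open>c a\<close>, put side by side in the order given by the injective labelling \<open>k\<close>, cover
  \<open>[0, sum c A)\<close>.
\<close>
lemma interval_partition_exists:
  fixes c :: "'x \<Rightarrow> real" and k :: "'x \<Rightarrow> nat"
  assumes "finite A" "inj_on k A" "\<And>a. a \<in> A \<Longrightarrow> 0 \<le> c a" "0 \<le> t" "t < sum c A"
  shows "\<exists>a\<in>A. sum c {b \<in> A. k b < k a} \<le> t \<and> t < sum c {b \<in> A. k b < k a} + c a"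
  using assms
proof (induction A rule: finite_ranking_induct[where f=k])
  case empty
  then show ?case by simp
next
  case (insert x A)
  show ?case
  proof (cases "x \<in> A")
    case True
    then show ?thesis using insert.IH insert.prems by (simp add: insert_absorb)
  next
  case x: False
  have lt: "k y < k x" if "y \<in> A" for y
    using insert.hyps(2)[OF that] insert.prems(1) x that
    by (auto simp: inj_on_def le_less)
  show ?thesis
  proof (cases "t < sum c A")
    case True
    then obtain a where a: "a \<in> A" "sum c {b \<in> A. k b < k a} \<le> t" "t < sum c {b \<in> A. k b < k a} + c a"
      using insert by (auto simp: inj_on_def)
    have "{b \<in> insert x A. k b < k a} = {b \<in> A. k b < k a}" using lt[OF a(1)] by auto
    then show ?thesis using a by (intro bexI[of _ a]) simp_all
  next
    case False
    have "{b \<in> insert x A. k b < k x} = A" using lt by auto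
    then show ?thesis using False insert x by auto
  qed
  qed
qed

lemma interval_partition_unique:
  fixes c :: "'x \<Rightarrow> real" and k :: "'x \<Rightarrow> nat"
  assumes "finite A" "inj_on k A" "\<And>a. a \<in> A \<Longrightarrow> 0 \<le> c a" "a \<in> A" "b \<in> A"
    and "sum c {x \<in> A. k x < k a} \<le> t" "t < sum c {x \<in> A. k x < k a} + c a"
    and "sum c {x \<in> A. k x < k b} \<le> t" "t < sum c {x \<in> A. k x < k b} + c b"
  shows "a = b"
proof -
  have *: "sum c {x \<in> A. k x < k a} + c a \<le> sum c {x \<in> A. k x < k b}" if "k a < k b" "a \<in> A" for a b
  proof -
    have "sum c {x \<in> A. k x < k a} + c a = sum c (insert a {x \<in> A. k x < k a})"
      using assms(1) by simp
    also have "\<dots> \<le> sum c {x \<in> A. k x < k b}"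
      using assms(1,3) that by (intro sum_mono2) auto
    finally show ?thesis .
  qed
  have "\<not> k a < k b" "\<not> k b < k a" using *[of a b] *[of b a] assms by auto
  then have "k a = k b" by simp
  then show ?thesis using assms by (auto dest: inj_onD)
qed

context weighted_digraph begin

definition harmonic :: "('v \<Rightarrow> real) \<Rightarrow> bool" where
  "harmonic h \<longleftrightarrow> (\<forall>v\<in>verts G. 0 \<le> h v \<and> h v = (\<Sum>a\<in>out_arcs G v. wt [a] * h (head G a)))"

lemma harmonic_nonneg: "harmonic h \<Longrightarrow> v \<in> verts G \<Longrightarrow> 0 \<le> h v"
  and harmonic_eq: "harmonic h \<Longrightarrow> v \<in> verts G \<Longrightarrow> h v = (\<Sum>a\<in>out_arcs G v. wt [a] * h (head G a))"
  unfolding harmonic_def by blast+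

text \<open>
  The left end point of the piece of \<open>[0, h v)\<close> that belongs to the arrow \<open>a\<close> leaving \<open>v\<close>.
\<close>
definition arc_offset :: "('v \<Rightarrow> real) \<Rightarrow> 'a \<Rightarrow> real" where
  "arc_offset h a = (\<Sum>b\<in>{b \<in> out_arcs G (tail G a). to_nat_on (arcs G) b < to_nat_on (arcs G) a}. wt [b] * h (head G b))"

definition arc_at :: "('v \<Rightarrow> real) \<Rightarrow> 'v \<Rightarrow> real \<Rightarrow> 'a" where
  "arc_at h v t = (THE a. a \<in> out_arcs G v \<and> arc_offset h a \<le> t \<and> t < arc_offset h a + wt [a] * h (head G a))"

abbreviation rescaled :: "('v \<Rightarrow> real) \<Rightarrow> 'v \<Rightarrow> real \<Rightarrow> real" where
  "rescaled h v t \<equiv> (t - arc_offset h (arc_at h v t)) / wt [arc_at h v t]"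

text \<open>
  The arrows met by a parameter \<open>t \<in> [0, h v)\<close> when each piece is stretched affinely onto the interval
  of the head of its arrow.
\<close>
primrec coding :: "('v \<Rightarrow> real) \<Rightarrow> nat \<Rightarrow> 'v \<Rightarrow> real \<Rightarrow> 'a" where
  "coding h 0 v t = arc_at h v t"
| "coding h (Suc n) v t = coding h n (head G (arc_at h v t)) (rescaled h v t)"

definition coded_path :: "('v \<Rightarrow> real) \<Rightarrow> 'v \<Rightarrow> real \<Rightarrow> nat \<Rightarrow> 'a" where
  "coded_path h v t = (\<lambda>n. coding h n v t)"

lemma arc_at_unique:
  assumes h: "harmonic h" and v: "v \<in> verts G" and t: "0 \<le> t" "t < h v"
  shows "\<exists>!a. a \<in> out_arcs G v \<and> arc_offset h a \<le> t \<and> t < arc_offset h a + wt [a] * h (head G a)"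
proof -
  let ?k = "to_nat_on (arcs G)" and ?c = "\<lambda>a. wt [a] * h (head G a)"
  have inj: "inj_on ?k (out_arcs G v)"
    by (rule inj_on_subset[OF inj_on_to_nat_on[OF countable_arcs]]) auto
  have c: "0 \<le> ?c a" if "a \<in> out_arcs G v" for a
    using that harmonic_nonneg[OF h] by (auto intro!: mult_nonneg_nonneg)
  have off: "arc_offset h a = sum ?c {b \<in> out_arcs G v. ?k b < ?k a}" if "a \<in> out_arcs G v" for a
    using that by (simp add: arc_offset_def)
  have "t < sum ?c (out_arcs G v)" using t harmonic_eq[OF h v] by simp
  then obtain a where "a \<in> out_arcs G v" "arc_offset h a \<le> t" "t < arc_offset h a + ?c a"
    using interval_partition_exists[OF finite_out_arcs inj c t(1)] off by force
  moreover have "a = b" if "a \<in> out_arcs G v" "arc_offset h a \<le> t" "t < arc_offset h a + ?c a"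
    "b \<in> out_arcs G v" "arc_offset h b \<le> t" "t < arc_offset h b + ?c b" for a b
    by (rule interval_partition_unique[OF finite_out_arcs inj c, where a=a and b=b and t=t]) (use that off in auto)
  ultimately show ?thesis by blast
qed

lemma arc_at_props:
  assumes h: "harmonic h" and v: "v \<in> verts G" and t: "0 \<le> t" "t < h v"
  shows "arc_at h v t \<in> out_arcs G v" "arc_offset h (arc_at h v t) \<le> t"
    "t < arc_offset h (arc_at h v t) + wt [arc_at h v t] * h (head G (arc_at h v t))"
  using theI'[OF arc_at_unique[OF assms]] unfolding arc_at_def[symmetric] by auto

lemma arc_interval:
  assumes h: "harmonic h" and a: "a \<in> out_arcs G v"
  shows "0 \<le> arc_offset h a" "arc_offset h a + wt [a] * h (head G a) \<le> h v"
proof -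
  let ?k = "to_nat_on (arcs G)" and ?c = "\<lambda>a. wt [a] * h (head G a)"
  have v: "v \<in> verts G" and ta: "tail G a = v" using a by auto
  have c: "0 \<le> ?c a" if "a \<in> out_arcs G v" for a
    using that harmonic_nonneg[OF h] by (auto intro!: mult_nonneg_nonneg)
  show "0 \<le> arc_offset h a" unfolding arc_offset_def ta by (rule sum_nonneg) (use c in auto)
  have "arc_offset h a + ?c a = sum ?c (insert a {b \<in> out_arcs G v. ?k b < ?k a})"
    unfolding arc_offset_def ta using finite_out_arcs[of v] by (subst sum.insert) (auto simp del: in_out_arcs_conv)
  also have "\<dots> \<le> sum ?c (out_arcs G v)"
    by (rule sum_mono2[OF finite_out_arcs]) (use a c in auto)
  finally show "arc_offset h a + ?c a \<le> h v" using harmonic_eq[OF h v] by simp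
qed

lemma arc_at_eq:
  assumes h: "harmonic h" and a: "a \<in> out_arcs G v"
    and "arc_offset h a \<le> t" "t < arc_offset h a + wt [a] * h (head G a)"
  shows "arc_at h v t = a"
proof -
  have t: "0 \<le> t" "t < h v" using arc_interval[OF h a] assms(3,4) by linarith+
  have v: "v \<in> verts G" using a by auto
  show ?thesis unfolding arc_at_def
    by (rule the1_equality[OF arc_at_unique[OF h v t]]) (use assms in auto)
qed

lemma rescaled_parameter:
  assumes h: "harmonic h" and v: "v \<in> verts G" and t: "t \<in> {0..<h v}"
  shows "rescaled h v t \<in> {0..<h (head G (arc_at h v t))}"
  using arc_at_props[OF h v, of t] t by (auto simp: field_simps)

lemma coded_path_0 [simp]: "coded_path h v t 0 = arc_at h v t"
  by (simp add: coded_path_def)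

text \<open>
  The coding conjugates the piecewise affine map with the shift.  Together with the scaling of Lebesgue
  measure under affine maps this yields conformality.
\<close>
lemma coded_path_decompose:
  "coded_path h v t = [arc_at h v t] \<frown> coded_path h (head G (arc_at h v t)) (rescaled h v t)"
proof
  fix n show "coded_path h v t n = ([arc_at h v t] \<frown> coded_path h (head G (arc_at h v t)) (rescaled h v t)) n"
    by (cases n) (simp_all add: coded_path_def conc_def)
qed

lemma coded_path_in_Z:
  assumes h: "harmonic h" and "v \<in> verts G" "t \<in> {0..<h v}"
  shows "coded_path h v t \<in> Z v"
proof -
  have step: "coding h n v t \<in> arcs G \<and> head G (coding h n v t) = tail G (coding h (Suc n) v t)" for n
    using assms(2,3)
  proof (induction n arbitrary: v t)
    case 0
    let ?a = "arc_at h v t"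
    have "?a \<in> out_arcs G v" using arc_at_props[OF h 0(1)] 0(2) by auto
    moreover have "arc_at h (head G ?a) ((t - arc_offset h ?a) / wt [?a]) \<in> out_arcs G (head G ?a)"
      using arc_at_props(1)[OF h, of "head G ?a"] rescaled_parameter[OF h 0] calculation by auto
    ultimately show ?case by simp
  next
    case (Suc n)
    have "head G (arc_at h v t) \<in> verts G" using arc_at_props(1)[OF h Suc.prems(1)] Suc.prems(2) by auto
    from Suc.IH[OF this rescaled_parameter[OF h Suc.prems]] show ?case by simp
  qed
  have "tail G (coded_path h v t 0) = v"
    using arc_at_props(1)[OF h assms(2), of t] assms(3) by (simp add: coded_path_def)
  then show ?thesis using step by (simp add: cylinder_def inf_paths_def coded_path_def)
qed

lemma arc_at_level_set:
  assumes h: "harmonic h" and v: "v \<in> verts G"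
  shows "{t \<in> {0..<h v}. arc_at h v t = a} =
    (if a \<in> out_arcs G v then {arc_offset h a..<arc_offset h a + wt [a] * h (head G a)} else {})"
proof (cases "a \<in> out_arcs G v")
  case True
  have "t \<in> {arc_offset h a..<arc_offset h a + wt [a] * h (head G a)}" if "t \<in> {0..<h v}" "arc_at h v t = a" for t
    using arc_at_props[OF h v, of t] that by auto
  moreover have "t \<in> {0..<h v} \<and> arc_at h v t = a" if "t \<in> {arc_offset h a..<arc_offset h a + wt [a] * h (head G a)}" for t
    using arc_at_eq[OF h True, of t] arc_interval[OF h True] that by auto
  ultimately show ?thesis using True by (simp only: if_True) blast
next
  case False
  have "arc_at h v t \<noteq> a" if "t \<in> {0..<h v}" for t
    using arc_at_props(1)[OF h v, of t] that False by auto
  then show ?thesis using False by auto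
qed

lemma coding_measurable:
  assumes h: "harmonic h" and "v \<in> verts G"
  shows "{t \<in> {0..<h v}. coding h n v t = a} \<in> sets borel"
  using assms(2)
proof (induction n arbitrary: v)
  case 0
  then show ?case using arc_at_level_set[OF h 0, of a] by simp
next
  case (Suc n)
  let ?T = "\<lambda>b t. (t - arc_offset h b) / wt [b]"
  have "{t \<in> {0..<h v}. coding h (Suc n) v t = a} =
    (\<Union>b\<in>out_arcs G v. {t \<in> {0..<h v}. arc_at h v t = b} \<inter> (?T b -` {s \<in> {0..<h (head G b)}. coding h n (head G b) s = a} \<inter> space borel))"
    using arc_at_props(1)[OF h Suc.prems] rescaled_parameter[OF h Suc.prems] by (auto simp: Bex_def)
  also have "\<dots> \<in> sets borel"
  proof (rule sets.finite_UN[OF finite_out_arcs])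
    fix b assume b: "b \<in> out_arcs G v"
    have Tb: "?T b \<in> borel \<rightarrow>\<^sub>M borel" by measurable
    have hb: "head G b \<in> verts G" using b by simp
    have "?T b -` {s \<in> {0..<h (head G b)}. coding h n (head G b) s = a} \<inter> space borel \<in> sets borel"
      by (rule measurable_sets[OF Tb Suc.IH[OF hb]])
    moreover have "{t \<in> {0..<h v}. arc_at h v t = b} \<in> sets borel"
      using arc_at_level_set[OF h Suc.prems, of b] by simp
    ultimately show "{t \<in> {0..<h v}. arc_at h v t = b} \<inter> (?T b -` {s \<in> {0..<h (head G b)}. coding h n (head G b) s = a} \<inter> space borel) \<in> sets borel"
      by (rule sets.Int[rotated])
  qed
  finally show ?case .
qed

lemma coded_path_measurable:
  assumes h: "harmonic h" and v: "v \<in> verts G"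
  shows "coded_path h v \<in> restrict_space lborel {0..<h v} \<rightarrow>\<^sub>M path_borel G"
proof (rule measurable_into_path_space)
  fix t assume "t \<in> space (restrict_space lborel {0..<h v})"
  then show "coded_path h v t \<in> inf_paths G"
    using coded_path_in_Z[OF h v, of t] by (auto simp: space_restrict_space cylinder_def)
next
  fix i a
  have "{t \<in> {0..<h v}. coding h i v t = a} \<in> sets (restrict_space lborel {0..<h v})"
    using coding_measurable[OF h v, of i a] by (subst sets_restrict_space_iff) auto
  then show "{t \<in> space (restrict_space lborel {0..<h v}). coded_path h v t i = a} \<in> sets (restrict_space lborel {0..<h v})"
    by (simp add: space_restrict_space coded_path_def)
qed

definition parameters :: "('v \<Rightarrow> real) \<Rightarrow> 'v \<Rightarrow> (nat \<Rightarrow> 'a) set \<Rightarrow> real set" where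
  "parameters h v B = {t \<in> {0..<h v}. coded_path h v t \<in> B}"

text \<open>
  The image under the coding of Lebesgue measure on the disjoint union of the intervals \<open>[0, h v)\<close>.
\<close>
definition path_measure :: "('v \<Rightarrow> real) \<Rightarrow> (nat \<Rightarrow> 'a) measure" where
  "path_measure h = measure_of (inf_paths G) (sets (path_borel G))
     (\<lambda>B. \<integral>\<^sup>+v. emeasure lborel (parameters h v B) \<partial>count_space (verts G))"

lemma parameters_measurable:
  assumes "harmonic h" "v \<in> verts G" "B \<in> sets (path_borel G)"
  shows "parameters h v B \<in> sets borel"
proof -
  have "coded_path h v -` B \<inter> space (restrict_space lborel {0..<h v}) \<in> sets (restrict_space lborel {0..<h v})"
    by (rule measurable_sets[OF coded_path_measurable]) fact+
  moreover have "coded_path h v -` B \<inter> space (restrict_space lborel {0..<h v}) = parameters h v B"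
    by (auto simp: parameters_def space_restrict_space)
  ultimately show ?thesis by (subst (asm) sets_restrict_space_iff) auto
qed

lemma space_path_measure: "space (path_measure h) = inf_paths G"
  by (simp add: path_measure_def space_measure_of_conv)

lemma sets_path_measure: "sets (path_measure h) = sets (path_borel G)"
  unfolding path_measure_def
  using sets.sigma_sets_eq[of "path_borel G"] sets.space_closed[of "path_borel G"] by (simp add: sets_measure_of)

lemma emeasure_path_measure:
  assumes h: "harmonic h" and B: "B \<in> sets (path_borel G)"
  shows "emeasure (path_measure h) B = (\<integral>\<^sup>+v. emeasure lborel (parameters h v B) \<partial>count_space (verts G))"
  unfolding path_measure_def
proof (rule emeasure_measure_of_sigma[OF _ _ _ B])
  let ?\<mu> = "\<lambda>B. \<integral>\<^sup>+v. emeasure lborel (parameters h v B) \<partial>count_space (verts G)"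
  show "sigma_algebra (inf_paths G) (sets (path_borel G))"
    using sets.sigma_algebra_axioms[of "path_borel G"] by simp
  show "positive (sets (path_borel G)) ?\<mu>"
    by (simp add: positive_def parameters_def)
  show "countably_additive (sets (path_borel G)) ?\<mu>"
  proof (rule countably_additiveI)
    fix A :: "nat \<Rightarrow> (nat \<Rightarrow> 'a) set"
    assume A: "range A \<subseteq> sets (path_borel G)" "disjoint_family A"
    have "(\<Sum>i. ?\<mu> (A i)) = (\<integral>\<^sup>+v. (\<Sum>i. emeasure lborel (parameters h v (A i))) \<partial>count_space (verts G))"
      by (rule nn_integral_suminf[symmetric]) simp
    also have "\<dots> = ?\<mu> (\<Union>i. A i)"
    proof (rule nn_integral_cong)
      fix v assume "v \<in> space (count_space (verts G))"
      then have v: "v \<in> verts G" by simp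
      have "range (\<lambda>i. parameters h v (A i)) \<subseteq> sets lborel"
        using parameters_measurable[OF h v] A(1) by auto
      moreover have "disjoint_family (\<lambda>i. parameters h v (A i))"
        using A(2) unfolding disjoint_family_on_def parameters_def by blast
      moreover have "(\<Union>i. parameters h v (A i)) = parameters h v (\<Union>i. A i)"
        by (auto simp: parameters_def)
      ultimately show "(\<Sum>i. emeasure lborel (parameters h v (A i))) = emeasure lborel (parameters h v (\<Union>i. A i))"
        using suminf_emeasure[of "\<lambda>i. parameters h v (A i)" lborel] by simp
    qed
    finally show "(\<Sum>i. ?\<mu> (A i)) = ?\<mu> (\<Union> (range A))" .
  qed
qed

lemma emeasure_path_measure_subset_Z:
  assumes h: "harmonic h" and B: "B \<in> sets (path_borel G)" "B \<subseteq> Z v" and v: "v \<in> verts G"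
  shows "emeasure (path_measure h) B = emeasure lborel (parameters h v B)"
proof -
  have "parameters h w B = {}" if "w \<in> verts G" "w \<noteq> v" for w
    using coded_path_in_Z[OF h that(1)] B(2) that(2) by (auto simp: parameters_def cylinder_def)
  then have "emeasure (path_measure h) B = (\<Sum>w\<in>{v}. emeasure lborel (parameters h w B))"
    unfolding emeasure_path_measure[OF h B(1)]
    by (intro nn_integral_count_space') (use v in auto)
  then show ?thesis by simp
qed

lemma emeasure_path_measure_Z:
  assumes h: "harmonic h" and v: "v \<in> verts G"
  shows "emeasure (path_measure h) (Z v) = ennreal (h v)"
proof -
  have "parameters h v (Z v) = {0..<h v}" using coded_path_in_Z[OF h v] by (auto simp: parameters_def)
  then show ?thesis
    using emeasure_path_measure_subset_Z[OF h _ _ v, of "Z v"] harmonic_nonneg[OF h v] by simp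
qed

lemma conc_preimage_measurable:
  assumes "awalk v as w" "C \<in> sets (path_borel G)"
  shows "{y \<in> Z w. as \<frown> y \<in> C} \<in> sets (path_borel G)"
proof -
  let ?R = "restrict_space (path_borel G) (Z w)"
  have sp: "space ?R = Z w" by (auto simp: space_restrict_space cylinder_def)
  have Zm: "Z w \<inter> inf_paths G \<in> sets (path_borel G)"
    using sets.Int[OF cylinder_measurable sets.top, of w "[]"] by simp
  have "(\<lambda>y. as \<frown> y) \<in> ?R \<rightarrow>\<^sub>M path_borel G"
  proof (rule measurable_into_path_space)
    show "as \<frown> y \<in> inf_paths G" if "y \<in> space ?R" for y
      using conc_inf_paths[OF assms(1), of y] that[unfolded sp] by (simp add: cylinder_def)
    fix i a
    have "{y \<in> inf_paths G. (as \<frown> y) i = a} \<in> sets (path_borel G)"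
    proof (cases "i < length as")
      case False
      have "{y \<in> inf_paths G. y (i - length as) = a} \<in> sets (path_borel G)"
        by (rule sets_coord_pred[OF coord_pred])
      then show ?thesis using False by simp
    next
      case True
      then show ?thesis using sets.top[of "path_borel G"] by (cases "as ! i = a") auto
    qed
    moreover have "{y \<in> space ?R. (as \<frown> y) i = a} = Z w \<inter> {y \<in> inf_paths G. (as \<frown> y) i = a}"
      unfolding sp by (auto simp: cylinder_def)
    ultimately show "{y \<in> space ?R. (as \<frown> y) i = a} \<in> sets ?R"
      using Zm by (subst sets_restrict_space_iff) auto
  qed
  from measurable_sets[OF this assms(2)] have "{y \<in> Z w. as \<frown> y \<in> C} \<in> sets ?R"
    by (simp add: sp vimage_def Int_def conj_commute)
  then show ?thesis using Zm by (subst (asm) sets_restrict_space_iff) auto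
qed

text \<open>
  For \<open>C \<subseteq> Z(a)\<close> the parameters of \<open>shift ` C\<close> are the preimage of the parameters of \<open>C\<close> under the affine
  map with slope \<open>wt [a]\<close>, and Lebesgue measure scales by the slope.
\<close>
theorem path_measure_conformal0:
  assumes h: "harmonic h"
  shows "conformal0 (path_measure h)"
  unfolding conformal0_def
proof (intro conjI ballI)
  show "space (path_measure h) = inf_paths G" "sets (path_measure h) = sets (path_borel G)"
    by (rule space_path_measure sets_path_measure)+
  show "emeasure (path_measure h) (Z v) < \<infinity>" if "v \<in> verts G" for v
    using emeasure_path_measure_Z[OF h that] by simp
  fix a B assume a: "a \<in> arcs G" and B: "B \<in> sets (path_measure h)"
  let ?C = "B \<inter> cylinder G (tail G a) [a]" and ?v = "tail G a" and ?w = "head G a"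
  have out: "a \<in> out_arcs G ?v" and v: "?v \<in> verts G" and w: "?w \<in> verts G" using a by auto
  have aw: "awalk ?v [a] ?w" using a by (simp add: awalk_simps)
  have C: "?C \<in> sets (path_borel G)"
    using B cylinder_measurable[of "tail G a" "[a]"] unfolding sets_path_measure by (rule sets.Int)
  have CZ: "?C \<subseteq> Z ?v" by (auto simp: cylinder_def)
  have shift_conc: "shift ([a] \<frown> y) = y" for y by (auto simp: shift_def conc_def)
  have "shift ` ?C = {y \<in> Z ?w. [a] \<frown> y \<in> ?C}"
  proof (intro equalityI subsetI)
    fix y assume "y \<in> shift ` ?C"
    then obtain x where x: "x \<in> ?C" "y = shift x" by auto
    then obtain z where "z \<in> Z ?w" "x = [a] \<frown> z" using cylinder_eq_conc[OF aw] by auto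
    then show "y \<in> {y \<in> Z ?w. [a] \<frown> y \<in> ?C}" using x shift_conc by auto
  next
    fix y assume "y \<in> {y \<in> Z ?w. [a] \<frown> y \<in> ?C}"
    then show "y \<in> shift ` ?C" using shift_conc[of y] by (metis (no_types, lifting) imageI mem_Collect_eq)
  qed
  then have S: "shift ` ?C \<in> sets (path_borel G)" "shift ` ?C \<subseteq> Z ?w"
    "shift ` ?C = {y \<in> Z ?w. [a] \<frown> y \<in> ?C}"
    using conc_preimage_measurable[OF aw C] by auto
  let ?f = "\<lambda>s. arc_offset h a + wt [a] * s"
  have "?f -` parameters h ?v ?C = parameters h ?w (shift ` ?C)"
  proof (intro equalityI subsetI)
    fix s assume "s \<in> ?f -` parameters h ?v ?C"
    then have s: "?f s \<in> {0..<h ?v}" "coded_path h ?v (?f s) \<in> ?C" by (auto simp: parameters_def)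
    have at: "arc_at h ?v (?f s) = a" using s(2) by (auto simp: cylinder_def)
    then have "coded_path h ?v (?f s) = [a] \<frown> coded_path h ?w s"
      using coded_path_decompose[of h ?v "?f s"] by simp
    moreover have "s \<in> {0..<h ?w}" using rescaled_parameter[OF h v s(1)] at by simp
    ultimately show "s \<in> parameters h ?w (shift ` ?C)"
      using s(2) coded_path_in_Z[OF h w] unfolding S(3) by (auto simp: parameters_def)
  next
    fix s assume "s \<in> parameters h ?w (shift ` ?C)"
    then have s: "s \<in> {0..<h ?w}" "[a] \<frown> coded_path h ?w s \<in> ?C" unfolding S(3) by (auto simp: parameters_def)
    then have in_int: "arc_offset h a \<le> ?f s" "?f s < arc_offset h a + wt [a] * h ?w" by auto
    then have at: "arc_at h ?v (?f s) = a" by (rule arc_at_eq[OF h out])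
    then have "coded_path h ?v (?f s) = [a] \<frown> coded_path h ?w s"
      using coded_path_decompose[of h ?v "?f s"] by simp
    moreover have "?f s \<in> {0..<h ?v}"
      using in_int arc_interval[OF h out] unfolding atLeastLessThan_iff by linarith
    ultimately show "s \<in> ?f -` parameters h ?v ?C" using s(2) by (auto simp: parameters_def)
  qed
  then have "emeasure lborel (parameters h ?v ?C) = ennreal (wt [a]) * emeasure lborel (parameters h ?w (shift ` ?C))"
    using parameters_measurable[OF h v C]
    by (subst lborel_real_affine[of "wt [a]" "arc_offset h a"])
      (simp_all add: emeasure_density nn_integral_cmult_indicator nn_integral_distr emeasure_distr emeasure_density_const)
  then have "emeasure (path_measure h) ?C = ennreal (wt [a]) * emeasure (path_measure h) (shift ` ?C)"
    using emeasure_path_measure_subset_Z[OF h C CZ v] emeasure_path_measure_subset_Z[OF h S(1,2) w] by simp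
  then have "ennreal (exp (\<beta> * F a)) * emeasure (path_measure h) ?C
      = (ennreal (exp (\<beta> * F a)) * ennreal (wt [a])) * emeasure (path_measure h) (shift ` ?C)"
    by (simp add: mult.assoc)
  also have "ennreal (exp (\<beta> * F a)) * ennreal (wt [a]) = 1"
    by (simp add: wt_def flip: ennreal_mult exp_add)
  finally show "emeasure (path_measure h) (shift ` ?C) = ennreal (exp (\<beta> * F a)) * emeasure (path_measure h) ?C"
    by simp
qed

lemma harmonic_measure_Z:
  assumes m: "conformal0 m"
  shows "harmonic (\<lambda>v. measure m (Z v))"
  unfolding harmonic_def
proof (intro ballI conjI)
  fix v assume v: "v \<in> verts G"
  have e: "emeasure m (Z u) = ennreal (measure m (Z u))" if "u \<in> verts G" for u
    using conformal0_finite[OF m that] by (intro emeasure_eq_ennreal_measure) (simp add: less_top)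
  have "ennreal (measure m (Z v)) = (\<Sum>a\<in>out_arcs G v. ennreal (wt [a]) * ennreal (measure m (Z (head G a))))"
    unfolding e[OF v, symmetric] emeasure_Z_harmonic[OF m, of v] by (intro sum.cong refl) (simp add: e)
  also have "\<dots> = ennreal (\<Sum>a\<in>out_arcs G v. wt [a] * measure m (Z (head G a)))"
    by (simp add: ennreal_mult[symmetric] sum_ennreal)
  finally show "measure m (Z v) = (\<Sum>a\<in>out_arcs G v. wt [a] * measure m (Z (head G a)))"
    by (subst (asm) ennreal_inj) (auto intro!: sum_nonneg)
qed simp

lemma path_measure_measure_Z:
  assumes m: "conformal0 m"
  shows "path_measure (\<lambda>v. measure m (Z v)) = m"
proof (rule conformal0_eqI[OF path_measure_conformal0[OF harmonic_measure_Z[OF m]] m])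
  fix v assume v: "v \<in> verts G"
  show "emeasure (path_measure (\<lambda>v. measure m (Z v))) (Z v) = emeasure m (Z v)"
    using emeasure_path_measure_Z[OF harmonic_measure_Z[OF m] v] conformal0_finite[OF m v]
    by (simp add: emeasure_eq_ennreal_measure less_top)
qed

lemma path_measure_cong:
  assumes "harmonic h" "\<And>v. v \<in> verts G \<Longrightarrow> h v = h' v"
  shows "harmonic h'" "path_measure h = path_measure h'"
proof -
  show h': "harmonic h'"
    unfolding harmonic_def
  proof (intro ballI conjI)
    fix v assume v: "v \<in> verts G"
    show "0 \<le> h' v" using harmonic_nonneg[OF assms(1) v] assms(2)[OF v] by simp
    have "h' v = (\<Sum>a\<in>out_arcs G v. wt [a] * h (head G a))"
      using harmonic_eq[OF assms(1) v] assms(2)[OF v] by simp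
    also have "\<dots> = (\<Sum>a\<in>out_arcs G v. wt [a] * h' (head G a))"
      by (intro sum.cong refl) (simp add: assms(2))
    finally show "h' v = (\<Sum>a\<in>out_arcs G v. wt [a] * h' (head G a))" .
  qed
  show "path_measure h = path_measure h'"
    by (rule conformal0_eqI) (use assms h' in \<open>auto simp: path_measure_conformal0 emeasure_path_measure_Z\<close>)
qed

lemma measure_path_measure_Z: "harmonic h \<Longrightarrow> v \<in> verts G \<Longrightarrow> measure (path_measure h) (Z v) = h v"
  by (simp add: measure_def emeasure_path_measure_Z harmonic_nonneg)

end

section \<open>Sums and mixtures of measures\<close>

lemma space_add_measure [simp]: "space (add_measure m1 m2) = space m1"
  by (simp add: add_measure_def space_measure_of_conv)

lemma sets_add_measure [simp]: "sets (add_measure m1 m2) = sets m1"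
  unfolding add_measure_def
  using sets.sigma_sets_eq[of m1] sets.space_closed[of m1] by (simp add: sets_measure_of)

lemma emeasure_add_measure:
  assumes "sets m1 = sets m2"
  shows "emeasure (add_measure m1 m2) X = emeasure m1 X + emeasure m2 X"
proof (cases "X \<in> sets m1")
  case True
  show ?thesis unfolding add_measure_def
  proof (rule emeasure_measure_of_sigma[OF _ _ _ True])
    show "sigma_algebra (space m1) (sets m1)" by (rule sets.sigma_algebra_axioms)
    show "positive (sets m1) (\<lambda>B. emeasure m1 B + emeasure m2 B)" by (simp add: positive_def)
    show "countably_additive (sets m1) (\<lambda>B. emeasure m1 B + emeasure m2 B)"
    proof (rule countably_additiveI)
      fix A :: "nat \<Rightarrow> 'a set" assume A: "range A \<subseteq> sets m1" "disjoint_family A"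
      show "(\<Sum>i. emeasure m1 (A i) + emeasure m2 (A i)) = emeasure m1 (\<Union> (range A)) + emeasure m2 (\<Union> (range A))"
        using suminf_emeasure[OF A] suminf_emeasure[of A m2] A assms by (simp add: suminf_add[symmetric])
    qed
  qed
next
  case False
  then show ?thesis using assms by (simp add: emeasure_notin_sets)
qed

lemma space_mix_measure [simp]: "space (mix_measure t m1 m2) = space m1"
  and sets_mix_measure [simp]: "sets (mix_measure t m1 m2) = sets m1"
  by (simp_all add: mix_measure_def space_scale_measure)

lemma emeasure_mix_measure:
  assumes "sets m1 = sets m2"
  shows "emeasure (mix_measure t m1 m2) X = ennreal (1 - t) * emeasure m1 X + ennreal t * emeasure m2 X"
  using assms by (simp add: mix_measure_def emeasure_add_measure)

section \<open>The simplex of normalized conformal measures\<close>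

context weighted_digraph begin

lemma conformal0_add_measure:
  assumes m: "conformal0 m1" "conformal0 m2"
  shows "conformal0 (add_measure m1 m2)"
proof -
  have s: "sets m1 = sets m2" using m by (simp add: conformal0_sets)
  show ?thesis unfolding conformal0_def
  proof (intro conjI ballI)
    show "space (add_measure m1 m2) = inf_paths G" "sets (add_measure m1 m2) = sets (path_borel G)"
      using m(1) by (simp_all add: conformal0_space conformal0_sets)
    show "emeasure (add_measure m1 m2) (Z v) < \<infinity>" if "v \<in> verts G" for v
      using conformal0_finite[OF m(1) that] conformal0_finite[OF m(2) that] by (simp add: emeasure_add_measure[OF s])
    fix a B assume "a \<in> arcs G" "B \<in> sets (add_measure m1 m2)"
    then show "emeasure (add_measure m1 m2) (shift ` (B \<inter> cylinder G (tail G a) [a])) =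
        ennreal (exp (\<beta> * F a)) * emeasure (add_measure m1 m2) (B \<inter> cylinder G (tail G a) [a])"
      using m s unfolding conformal0_def emeasure_add_measure[OF s] by (simp add: distrib_left)
  qed
qed

lemma conformal0_scale_measure:
  assumes m: "conformal0 m"
  shows "conformal0 (scale_measure (ennreal c) m)"
  using m unfolding conformal0_def
  by (simp add: ennreal_mult_less_top mult.left_commute space_scale_measure)

lemma conformal0_mix_measure:
  "conformal0 m1 \<Longrightarrow> conformal0 m2 \<Longrightarrow> conformal0 (mix_measure t m1 m2)"
  unfolding mix_measure_def by (intro conformal0_add_measure conformal0_scale_measure)

lemma emeasure_Z_eq: "conformal0 m \<Longrightarrow> v \<in> verts G \<Longrightarrow> emeasure m (Z v) = ennreal (measure m (Z v))"
  using conformal0_finite[of m v] by (intro emeasure_eq_ennreal_measure) (simp add: less_top)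

lemma measure_cylinder:
  assumes "conformal0 m" "awalk v as w"
  shows "measure m (cylinder G v as) = wt as * measure m (Z w)"
  by (simp add: measure_def emeasure_cylinder[OF assms] enn2real_mult)

lemma harmonic_diff:
  assumes "harmonic f" "harmonic g" "\<And>v. v \<in> verts G \<Longrightarrow> f v \<le> g v"
  shows "harmonic (\<lambda>v. g v - f v)"
  unfolding harmonic_def
proof (intro ballI conjI)
  fix v assume v: "v \<in> verts G"
  show "0 \<le> g v - f v" using assms(3)[OF v] by simp
  show "g v - f v = (\<Sum>a\<in>out_arcs G v. wt [a] * (g (head G a) - f (head G a)))"
    using harmonic_eq[OF assms(1) v] harmonic_eq[OF assms(2) v]
    by (simp add: right_diff_distrib sum_subtractf)
qed

lemma harmonic_add:
  assumes "harmonic f" "harmonic g"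
  shows "harmonic (\<lambda>v. f v + g v)"
  unfolding harmonic_def
proof (intro ballI conjI)
  fix v assume v: "v \<in> verts G"
  show "0 \<le> f v + g v" using harmonic_nonneg[OF assms(1) v] harmonic_nonneg[OF assms(2) v] by simp
  show "f v + g v = (\<Sum>a\<in>out_arcs G v. wt [a] * (f (head G a) + g (head G a)))"
    using harmonic_eq[OF assms(1) v] harmonic_eq[OF assms(2) v]
    by (simp add: distrib_left sum.distrib)
qed

text \<open>
  The iterates \<open>A\<^sup>n (max f g)\<close> of the matrix increase, because \<open>max f g \<le> A (max f g)\<close>, and stay below every
  harmonic function above \<open>f\<close> and \<open>g\<close>, for instance \<open>f + g\<close>.  Their limit is harmonic since the sums in \<open>A\<close>
  are finite.
\<close>
lemma harmonic_least_upper_bound: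
  assumes f: "harmonic f" and g: "harmonic g"
  obtains s where "harmonic s" "\<And>v. v \<in> verts G \<Longrightarrow> f v \<le> s v" "\<And>v. v \<in> verts G \<Longrightarrow> g v \<le> s v"
    "\<And>c v. harmonic c \<Longrightarrow> (\<And>v. v \<in> verts G \<Longrightarrow> f v \<le> c v) \<Longrightarrow> (\<And>v. v \<in> verts G \<Longrightarrow> g v \<le> c v)
      \<Longrightarrow> v \<in> verts G \<Longrightarrow> s v \<le> c v"
proof -
  define step where "step u v = (\<Sum>a\<in>out_arcs G v. wt [a] * u (head G a))" for u :: "'v \<Rightarrow> real" and v
  define u where "u n = (step ^^ n) (\<lambda>v. max (f v) (g v))" for n
  have u0: "u 0 = (\<lambda>v. max (f v) (g v))" and uS: "u (Suc n) = step (u n)" for n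
    by (simp_all add: u_def)
  have step_mono: "step p v \<le> step q v" if "\<And>w. w \<in> verts G \<Longrightarrow> p w \<le> q w" for p q v
    unfolding step_def by (intro sum_mono mult_left_mono that) auto
  have step_harm: "step h v = h v" if "harmonic h" "v \<in> verts G" for h v
    using harmonic_eq[OF that] by (simp add: step_def)
  have inc: "u n v \<le> u (Suc n) v" if "v \<in> verts G" for n v
    using that
  proof (induction n arbitrary: v)
    case 0
    have "f v \<le> step (u 0) v" "g v \<le> step (u 0) v"
      using step_mono[of f "u 0" v] step_mono[of g "u 0" v] step_harm[OF f 0] step_harm[OF g 0] by (auto simp: u0)
    then show ?case by (simp add: uS u0)
  next
    case (Suc n)
    then show ?case unfolding uS[of "Suc n"] uS[of n] by (intro step_mono) (simp add: uS)
  qed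
  have bound: "u n v \<le> c v" if "harmonic c" "\<And>v. v \<in> verts G \<Longrightarrow> f v \<le> c v" "\<And>v. v \<in> verts G \<Longrightarrow> g v \<le> c v"
    "v \<in> verts G" for c n v
    using that(4)
  proof (induction n arbitrary: v)
    case 0
    then show ?case using that by (simp add: u0)
  next
    case (Suc n)
    have "step (u n) v \<le> step c v" by (intro step_mono Suc.IH)
    then show ?case using step_harm[OF that(1) Suc.prems] by (simp add: uS)
  qed
  define s where "s v = lim (\<lambda>n. u n v)" for v
  have lim: "(\<lambda>n. u n v) \<longlonglongrightarrow> s v" if v: "v \<in> verts G" for v
  proof -
    have "u n v \<le> f v + g v" for n
      by (rule bound[OF harmonic_add[OF f g] _ _ v]) (use harmonic_nonneg[OF f] harmonic_nonneg[OF g] in auto)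
    then have "convergent (\<lambda>n. u n v)"
      using inc[OF v] by (metis incseq_SucI incseq_convergent convergentI)
    then show ?thesis by (simp add: convergent_LIMSEQ_iff s_def)
  qed
  have ge: "u 0 v \<le> s v" if v: "v \<in> verts G" for v
    using incseq_le[OF incseq_SucI[of "\<lambda>n. u n v", OF inc[OF v]] lim[OF v]] .
  have "harmonic s" unfolding harmonic_def
  proof (intro ballI conjI)
    fix v assume v: "v \<in> verts G"
    show "0 \<le> s v" using ge[OF v] harmonic_nonneg[OF f v] by (simp add: u0)
    have "(\<lambda>n. step (u n) v) \<longlonglongrightarrow> (\<Sum>a\<in>out_arcs G v. wt [a] * s (head G a))"
      unfolding step_def by (intro tendsto_sum tendsto_mult tendsto_const lim) auto
    moreover have "(\<lambda>n. step (u n) v) \<longlonglongrightarrow> s v"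
      using LIMSEQ_Suc[OF lim[OF v]] by (simp add: uS)
    ultimately show "s v = (\<Sum>a\<in>out_arcs G v. wt [a] * s (head G a))"
      by (rule LIMSEQ_unique[symmetric])
  qed
  then show thesis
  proof (rule that)
    show "f v \<le> s v" "g v \<le> s v" if "v \<in> verts G" for v using ge[OF that] by (auto simp: u0)
    show "s v \<le> c v" if "harmonic c" "\<And>v. v \<in> verts G \<Longrightarrow> f v \<le> c v" "\<And>v. v \<in> verts G \<Longrightarrow> g v \<le> c v"
      "v \<in> verts G" for c v
      by (rule LIMSEQ_le_const2[OF lim[OF that(4)]]) (use bound[OF that] in blast)
  qed
qed

text \<open>
  The difference of two harmonic functions is harmonic as soon as it is non-negative, and has a measure.
\<close>
lemma cone_le_conformal0_iff:
  assumes "conformal0 a" "conformal0 b"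
  shows "cone_le (Collect conformal0) a b \<longleftrightarrow> (\<forall>v\<in>verts G. measure a (Z v) \<le> measure b (Z v))"
proof
  assume "cone_le (Collect conformal0) a b"
  then obtain d where d: "conformal0 d" "b = add_measure a d" by (auto simp: cone_le_def)
  then have "sets a = sets d" using assms by (simp add: conformal0_sets)
  then have le: "emeasure a (Z v) \<le> emeasure b (Z v)" for v
    by (simp add: d(2) emeasure_add_measure)
  show "\<forall>v\<in>verts G. measure a (Z v) \<le> measure b (Z v)"
  proof
    fix v assume "v \<in> verts G"
    then show "measure a (Z v) \<le> measure b (Z v)"
      using le[of v] assms by (simp add: emeasure_Z_eq)
  qed
next
  assume le: "\<forall>v\<in>verts G. measure a (Z v) \<le> measure b (Z v)"
  let ?h = "\<lambda>v. measure b (Z v) - measure a (Z v)"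
  have h: "harmonic ?h" using assms le by (intro harmonic_diff harmonic_measure_Z) auto
  have d: "conformal0 (path_measure ?h)" by (rule path_measure_conformal0[OF h])
  have s: "sets a = sets (path_measure ?h)" using assms(1) d by (simp add: conformal0_sets)
  have "b = add_measure a (path_measure ?h)"
  proof (rule conformal0_eqI[OF assms(2) conformal0_add_measure[OF assms(1) d]])
    fix v assume v: "v \<in> verts G"
    show "emeasure b (Z v) = emeasure (add_measure a (path_measure ?h)) (Z v)"
      using le v assms by (simp add: emeasure_add_measure[OF s] emeasure_path_measure_Z[OF h] emeasure_Z_eq flip: ennreal_plus)
  qed
  then show "cone_le (Collect conformal0) a b" using d by (auto simp: cone_le_def)
qed

text \<open>
  If \<open>s\<close> is the least harmonic majorant of \<open>f\<close> and \<open>g\<close>, then \<open>f + g - s\<close> is their greatest harmonic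
  minorant, since \<open>c \<mapsto> f + g - c\<close> reverses the order.
\<close>
lemma lattice_cone_conformal0: "lattice_cone (Collect conformal0)"
  unfolding lattice_cone_def
proof (intro ballI conjI)
  let ?C = "Collect conformal0"
  fix a b assume ab: "a \<in> ?C" "b \<in> ?C"
  let ?f = "\<lambda>v. measure a (Z v)" and ?g = "\<lambda>v. measure b (Z v)"
  have f: "harmonic ?f" and g: "harmonic ?g" using ab by (auto intro: harmonic_measure_Z)
  obtain s where s: "harmonic s" "\<And>v. v \<in> verts G \<Longrightarrow> ?f v \<le> s v" "\<And>v. v \<in> verts G \<Longrightarrow> ?g v \<le> s v"
    "\<And>c v. harmonic c \<Longrightarrow> (\<And>v. v \<in> verts G \<Longrightarrow> ?f v \<le> c v) \<Longrightarrow> (\<And>v. v \<in> verts G \<Longrightarrow> ?g v \<le> c v)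
      \<Longrightarrow> v \<in> verts G \<Longrightarrow> s v \<le> c v"
    using harmonic_least_upper_bound[OF f g] by blast
  have "s v \<le> ?f v + ?g v" if "v \<in> verts G" for v
    by (rule s(4)[OF harmonic_add[OF f g] _ _ that]) auto
  then have i: "harmonic (\<lambda>v. ?f v + ?g v - s v)"
    by (intro harmonic_diff[OF s(1) harmonic_add[OF f g]])
  show "\<exists>s\<in>?C. cone_le ?C a s \<and> cone_le ?C b s \<and>
           (\<forall>c\<in>?C. cone_le ?C a c \<and> cone_le ?C b c \<longrightarrow> cone_le ?C s c)"
  proof (intro bexI[of _ "path_measure s"] conjI ballI impI)
    have pm: "conformal0 (path_measure s)" by (rule path_measure_conformal0[OF s(1)])
    then show "path_measure s \<in> ?C" by simp
    show "cone_le ?C a (path_measure s)" "cone_le ?C b (path_measure s)"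
      using ab pm s(2,3) by (auto simp: cone_le_conformal0_iff measure_path_measure_Z[OF s(1)])
    fix c assume c: "c \<in> ?C" "cone_le ?C a c \<and> cone_le ?C b c"
    then have le: "?f v \<le> measure c (Z v)" "?g v \<le> measure c (Z v)" if "v \<in> verts G" for v
      using ab that by (auto simp: cone_le_conformal0_iff)
    have "s v \<le> measure c (Z v)" if "v \<in> verts G" for v
      by (rule s(4)[OF harmonic_measure_Z le that]) (use c in auto)
    then show "cone_le ?C (path_measure s) c"
      using c(1) pm by (simp add: cone_le_conformal0_iff measure_path_measure_Z[OF s(1)])
  qed
  let ?i = "path_measure (\<lambda>v. ?f v + ?g v - s v)"
  show "\<exists>i\<in>?C. cone_le ?C i a \<and> cone_le ?C i b \<and>
           (\<forall>c\<in>?C. cone_le ?C c a \<and> cone_le ?C c b \<longrightarrow> cone_le ?C c i)"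
  proof (intro bexI[of _ ?i] conjI ballI impI)
    have pm: "conformal0 ?i" by (rule path_measure_conformal0[OF i])
    then show "?i \<in> ?C" by simp
    show "cone_le ?C ?i a"
      "cone_le ?C ?i b"
      using ab pm s(2,3) by (auto simp: cone_le_conformal0_iff measure_path_measure_Z[OF i])
    fix c assume c: "c \<in> ?C" "cone_le ?C c a \<and> cone_le ?C c b"
    then have le: "measure c (Z v) \<le> ?f v" "measure c (Z v) \<le> ?g v" if "v \<in> verts G" for v
      using ab that by (auto simp: cone_le_conformal0_iff)
    have d: "harmonic (\<lambda>v. ?f v + ?g v - measure c (Z v))"
      using c(1) le by (intro harmonic_diff harmonic_add f g harmonic_measure_Z) (auto simp: add_increasing2)
    have "s v \<le> ?f v + ?g v - measure c (Z v)" if "v \<in> verts G" for v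
      by (rule s(4)[OF d _ _ that]) (use le in \<open>auto simp: algebra_simps\<close>)
    then show "cone_le ?C c ?i"
      using c(1) pm by (force simp: cone_le_conformal0_iff measure_path_measure_Z[OF i])
  qed
qed

lemma harmonic_walk_le:
  assumes h: "harmonic h" and "awalk v as w"
  shows "wt as * h w \<le> h v"
  using assms(2)
proof (induction as arbitrary: v)
  case Nil
  then show ?case by (simp add: awalk_Nil_iff)
next
  case (Cons a as)
  then have a: "a \<in> out_arcs G v" "awalk (head G a) as w" "v \<in> verts G" by (auto simp: awalk_Cons_iff)
  have "wt (a # as) * h w = wt [a] * (wt as * h w)" by (simp add: wt_Cons[of a as])
  also have "\<dots> \<le> wt [a] * h (head G a)" using Cons.IH[OF a(2)] by (intro mult_left_mono) auto
  also have "\<dots> \<le> (\<Sum>a\<in>out_arcs G v. wt [a] * h (head G a))"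
    by (rule member_le_sum[OF a(1) _ finite_out_arcs]) (use harmonic_nonneg[OF h] in auto)
  finally show ?case using harmonic_eq[OF h a(3)] by simp
qed

end

context transient_digraph begin

lemma normalized_conformal_iff:
  "m \<in> normalized_conformal G F \<beta> v0 \<longleftrightarrow> conformal0 m \<and> measure m (Z v0) = 1"
proof
  assume "m \<in> normalized_conformal G F \<beta> v0"
  then show "conformal0 m \<and> measure m (Z v0) = 1"
    by (simp add: normalized_conformal_def conformal_iff measure_def)
next
  assume m: "conformal0 m \<and> measure m (Z v0) = 1"
  then have 1: "emeasure m (Z v0) = 1" using emeasure_Z_eq[of m v0] v0 by simp
  moreover have "emeasure m (Z v0) \<le> emeasure m (space m)"
    by (rule emeasure_space)
  ultimately have "emeasure m (space m) \<noteq> 0" by auto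
  then show "m \<in> normalized_conformal G F \<beta> v0"
    using m 1 by (simp add: normalized_conformal_def conformal_iff)
qed

abbreviation K :: "(nat \<Rightarrow> 'b) measure set" where
  "K \<equiv> normalized_conformal G F \<beta> v0"

abbreviation T :: "(nat \<Rightarrow> 'b) measure topology" where
  "T \<equiv> cylinder_topology G K"

abbreviation subbasis :: "(nat \<Rightarrow> 'b) measure set set" where
  "subbasis \<equiv> {{m \<in> K. measure m (cylinder G v as) \<in> U} | v as w U. awalk v as w \<and> open (U :: real set)}"

lemma convex_normalized_conformal: "convex_measures K"
  unfolding convex_measures_def
proof (intro ballI)
  fix m1 m2 and t :: real assume m: "m1 \<in> K" "m2 \<in> K" and t: "t \<in> {0..1}"
  have s: "sets m1 = sets m2" using m by (simp add: normalized_conformal_iff conformal0_sets)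
  have "emeasure (mix_measure t m1 m2) (Z v0) = ennreal (1 - t) + ennreal t"
    using m by (simp add: emeasure_mix_measure[OF s] normalized_conformal_iff emeasure_Z_eq v0)
  also have "\<dots> = 1" using t by (simp flip: ennreal_plus)
  finally show "mix_measure t m1 m2 \<in> K"
    using m by (simp add: normalized_conformal_iff conformal0_mix_measure measure_def)
qed

text \<open>
  A measure that vanishes on \<open>Z v0\<close> vanishes, since every vertex is reached from \<open>v0\<close>; every other one
  can be normalized.
\<close>
lemma measure_cone_normalized_conformal:
  assumes "K \<noteq> {}"
  shows "measure_cone K = Collect conformal0"
proof (intro equalityI subsetI)
  fix m assume "m \<in> measure_cone K"
  then show "m \<in> Collect conformal0"
    by (auto simp: measure_cone_def normalized_conformal_iff conformal0_scale_measure)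
next
  fix m assume "m \<in> Collect conformal0"
  then have m: "conformal0 m" by simp
  let ?c = "measure m (Z v0)"
  show "m \<in> measure_cone K"
  proof (cases "?c = 0")
    case True
    obtain m1 where m1: "m1 \<in> K" using assms by auto
    have "m = scale_measure (ennreal 0) m1"
    proof (rule conformal0_eqI[OF m conformal0_scale_measure])
      show "conformal0 m1" using m1 by (simp add: normalized_conformal_iff)
      fix v assume v: "v \<in> verts G"
      obtain as where as: "awalk v0 as v" using ex_walk_from_v0[OF v] .
      have "wt as * measure m (Z v) \<le> 0"
        using harmonic_walk_le[OF harmonic_measure_Z[OF m] as] True by simp
      then have "measure m (Z v) \<le> 0" using wt_pos[of as] by (metis mult_pos_pos not_le)
      then have "measure m (Z v) = 0" using measure_nonneg[of m "Z v"] by linarith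
      then show "emeasure m (Z v) = emeasure (scale_measure (ennreal 0) m1) (Z v)"
        by (simp add: emeasure_Z_eq[OF m v])
    qed
    moreover have "(0::real) \<le> 0" by simp
    ultimately show ?thesis using m1 unfolding measure_cone_def by blast
  next
    case False
    then have c: "?c > 0" using measure_nonneg[of m "Z v0"] by linarith
    let ?m = "scale_measure (ennreal (1 / ?c)) m"
    have cm: "conformal0 ?m" by (rule conformal0_scale_measure[OF m])
    have "emeasure ?m (Z v0) = 1"
      using c by (simp add: emeasure_Z_eq[OF m v0] ennreal_mult[symmetric])
    then have "?m \<in> K" using cm by (simp add: normalized_conformal_iff measure_def)
    moreover have "m = scale_measure (ennreal ?c) ?m"
    proof (rule conformal0_eqI[OF m conformal0_scale_measure[OF cm]])
      fix v
      have "ennreal ?c * ennreal (1 / ?c) = 1" using c by (simp add: ennreal_mult[symmetric])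
      then show "emeasure m (Z v) = emeasure (scale_measure (ennreal ?c) ?m) (Z v)"
        by (simp add: mult.assoc[symmetric])
    qed
    ultimately show ?thesis using c by (auto simp: measure_cone_def intro!: exI[of _ ?c] exI[of _ ?m])
  qed
qed

lemma topspace_T: "topspace T = K"
proof -
  have "K \<in> subbasis"
    by (rule CollectI, rule exI[of _ v0], rule exI[of _ "[]"], rule exI[of _ v0], rule exI[of _ UNIV])
      (simp add: awalk_Nil_iff v0)
  then show ?thesis unfolding cylinder_topology_def topology_generated_by_topspace by blast
qed

lemma continuous_map_measure_Z:
  assumes v: "v \<in> verts G"
  shows "continuous_map T euclideanreal (\<lambda>m. measure m (Z v))"
  unfolding continuous_map_def
proof (intro conjI allI impI)
  fix U :: "real set" assume "openin euclideanreal U"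
  then have "{m \<in> K. measure m (Z v) \<in> U} \<in> subbasis"
    using v by (intro CollectI exI[of _ v] exI[of _ "[]"] exI[of _ v] exI[of _ U]) (simp add: awalk_Nil_iff)
  then show "openin T {m \<in> topspace T. measure m (Z v) \<in> U}"
    unfolding topspace_T unfolding cylinder_topology_def by (rule topology_generated_by_Basis)
qed simp

lemma Hausdorff_T: "Hausdorff_space T"
  unfolding Hausdorff_space_def
proof (intro allI impI)
  fix m m' assume "m \<in> topspace T \<and> m' \<in> topspace T \<and> m \<noteq> m'"
  then have m: "m \<in> topspace T" "m' \<in> topspace T" "m \<noteq> m'" by auto
  then have c: "conformal0 m" "conformal0 m'" by (simp_all add: topspace_T normalized_conformal_iff)
  have "\<exists>v\<in>verts G. measure m (Z v) \<noteq> measure m' (Z v)"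
  proof (rule ccontr)
    assume "\<not> ?thesis"
    then have "m = m'" by (intro conformal0_eqI c) (simp add: emeasure_Z_eq c)
    then show False using m by simp
  qed
  then obtain v where v: "v \<in> verts G" "measure m (Z v) \<noteq> measure m' (Z v)" by auto
  obtain U V where UV: "open U" "open V" "measure m (Z v) \<in> U" "measure m' (Z v) \<in> V" "U \<inter> V = {}"
    using hausdorff[OF v(2)] by blast
  have "openin T {m \<in> topspace T. measure m (Z v) \<in> U}" "openin T {m \<in> topspace T. measure m (Z v) \<in> V}"
    using UV by (auto intro!: openin_continuous_map_preimage[OF continuous_map_measure_Z[OF v(1)]])
  moreover have "disjnt {m \<in> topspace T. measure m (Z v) \<in> U} {m \<in> topspace T. measure m (Z v) \<in> V}"
    using UV by (auto simp: disjnt_def)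
  ultimately show "\<exists>U V. openin T U \<and> openin T V \<and> m \<in> U \<and> m' \<in> V \<and> disjnt U V"
    using m UV by (intro exI[of _ "{m \<in> topspace T. measure m (Z v) \<in> U}"] exI[of _ "{m \<in> topspace T. measure m (Z v) \<in> V}"]) auto
qed

lemma harmonic_bounds:
  obtains b :: "'a \<Rightarrow> real" where "\<And>h v. harmonic h \<Longrightarrow> h v0 = 1 \<Longrightarrow> v \<in> verts G \<Longrightarrow> h v \<le> b v"
proof
  fix h v assume h: "harmonic h" "h v0 = 1" and v: "v \<in> verts G"
  have "awalk v0 (SOME as. awalk v0 as v) v" using ex_walk_from_v0[OF v] by (metis someI)
  then have "wt (SOME as. awalk v0 as v) * h v \<le> 1" using harmonic_walk_le[OF h(1)] h(2) by metis
  then show "h v \<le> 1 / wt (SOME as. awalk v0 as v)" by (simp add: field_simps)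
qed

text \<open>
  The normalized measures are the continuous image of a closed subset of a product of compact intervals;
  closedness uses that the sums in the harmonic equations are finite.
\<close>
lemma compact_T: "compact_space T"
proof -
  obtain b where b: "\<And>h v. harmonic h \<Longrightarrow> h v0 = 1 \<Longrightarrow> v \<in> verts G \<Longrightarrow> h v \<le> b v"
    using harmonic_bounds by blast
  let ?X = "product_topology (\<lambda>_. euclideanreal) (verts G)"
  define B where "B = (\<Pi>\<^sub>E v\<in>verts G. {0..b v})"
  define C where "C = {h \<in> B. harmonic h \<and> h v0 = 1}"
  have proj: "continuous_map ?X euclideanreal (\<lambda>h. h v)" if "v \<in> verts G" for v
    using that by (rule continuous_map_product_projection)
  have B: "compactin ?X B" unfolding B_def by (subst compactin_PiE) simp
  define Q where "Q v = {h \<in> topspace ?X. h v - (\<Sum>a\<in>out_arcs G v. wt [a] * h (head G a)) \<in> {0}}" for v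
  have Q: "closedin ?X (Q v)" if v: "v \<in> verts G" for v
    unfolding Q_def
  proof (rule closedin_continuous_map_preimage)
    show "continuous_map ?X euclideanreal (\<lambda>h. h v - (\<Sum>a\<in>out_arcs G v. wt [a] * h (head G a)))"
      using v finite_out_arcs by (intro continuous_map_diff continuous_map_sum continuous_map_real_mult_left proj) auto
  qed simp
  have "closedin ?X {h \<in> topspace ?X. h v0 \<in> {1}}"
    by (rule closedin_continuous_map_preimage[OF proj[OF v0]]) simp
  then have "closedin ?X ({h \<in> topspace ?X. h v0 \<in> {1}} \<inter> (\<Inter>v\<in>verts G. Q v))"
    using Q v0 by (intro closedin_Int closedin_INT) auto
  then have "compactin ?X ({h \<in> topspace ?X. h v0 \<in> {1}} \<inter> (\<Inter>v\<in>verts G. Q v) \<inter> B)"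
    using B by (intro closed_Int_compactin)
  also have "{h \<in> topspace ?X. h v0 \<in> {1}} \<inter> (\<Inter>v\<in>verts G. Q v) \<inter> B = C"
  proof -
    have Bt: "h \<in> topspace ?X" if "h \<in> B" for h using that by (auto simp: B_def PiE_iff)
    have Bn: "0 \<le> h v" if "h \<in> B" "v \<in> verts G" for h v using that by (auto simp: B_def PiE_iff)
    have "harmonic h \<longleftrightarrow> (\<forall>v\<in>verts G. h \<in> Q v)" if "h \<in> B" for h
      unfolding harmonic_def
      by (rule ball_cong[OF refl]) (use Bt[OF that] Bn[OF that] in \<open>simp add: Q_def\<close>)
    then show ?thesis unfolding C_def using Bt by blast
  qed
  finally have C: "compactin (subtopology ?X C) C" by (simp add: compactin_subtopology)
  have topC: "topspace (subtopology ?X C) = C"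
    by (auto simp: C_def B_def PiE_iff extensional_def)
  have pmK: "path_measure h \<in> K" if "h \<in> C" for h
    using that v0 by (auto simp: C_def normalized_conformal_iff path_measure_conformal0 measure_path_measure_Z)
  have cont: "continuous_map (subtopology ?X C) T path_measure"
    unfolding cylinder_topology_def
  proof (rule continuous_on_generated_topo)
    fix W assume "W \<in> subbasis"
    then obtain v as w U where W: "W = {m \<in> K. measure m (cylinder G v as) \<in> U}" "awalk v as w" "open (U :: real set)"
      by auto
    have w: "w \<in> verts G" using W(2) by (rule awalk_last_in_verts)
    have "continuous_map (subtopology ?X C) euclideanreal (\<lambda>h. wt as * h w)"
      by (intro continuous_map_from_subtopology continuous_map_real_mult_left proj w)
    then have "openin (subtopology ?X C) {h \<in> topspace (subtopology ?X C). wt as * h w \<in> U}"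
      using W(3) by (intro openin_continuous_map_preimage) auto
    also have "{h \<in> topspace (subtopology ?X C). wt as * h w \<in> U} = path_measure -` W \<inter> topspace (subtopology ?X C)"
      unfolding topC W(1) using pmK w
      by (auto simp: measure_cylinder[OF path_measure_conformal0 W(2)] measure_path_measure_Z C_def)
    finally show "openin (subtopology ?X C) (path_measure -` W \<inter> topspace (subtopology ?X C))" .
  next
    have "\<Union> subbasis = K"
      using topspace_T unfolding cylinder_topology_def topology_generated_by_topspace .
    then show "path_measure ` topspace (subtopology ?X C)
        \<subseteq> \<Union> subbasis"
      unfolding topC using pmK by auto
  qed
  have "path_measure ` C = K"
  proof (intro equalityI subsetI)
    fix m assume m: "m \<in> K"
    then have c: "conformal0 m" and 1: "measure m (Z v0) = 1" by (auto simp: normalized_conformal_iff)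
    let ?h = "\<lambda>v. measure m (Z v)"
    have h: "harmonic ?h" by (rule harmonic_measure_Z[OF c])
    have r: "harmonic (restrict ?h (verts G))" "path_measure ?h = path_measure (restrict ?h (verts G))"
      using path_measure_cong[OF h, of "restrict ?h (verts G)"] by auto
    have "restrict ?h (verts G) \<in> C"
      using r(1) b[OF h 1] 1 v0 by (auto simp: C_def B_def)
    moreover have "m = path_measure (restrict ?h (verts G))"
      using r(2) path_measure_measure_Z[OF c] by simp
    ultimately show "m \<in> path_measure ` C" by blast
  qed (use pmK in auto)
  then have "compactin T K" using image_compactin[OF C cont] by simp
  then show ?thesis by (simp add: compact_space_def topspace_T)
qed

theorem choquet_simplex_T: "choquet_simplex T"
proof -
  have "lattice_cone (measure_cone K)"
  proof (cases "K = {}")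
    case True
    then show ?thesis by (simp add: measure_cone_def lattice_cone_def)
  next
    case False
    then show ?thesis using measure_cone_normalized_conformal lattice_cone_conformal0 by simp
  qed
  then show ?thesis
    unfolding choquet_simplex_def topspace_T
    using compact_T Hausdorff_T convex_normalized_conformal by blast
qed

text \<open>
  A convex combination with positive coefficients vanishes on a set only if both measures do.
\<close>
theorem conformal_on_end_face: "measure_face_of (conformal_on_end G F \<beta> v0 E) K"
proof -
  have c: "m \<in> conformal_on_end G F \<beta> v0 E \<longleftrightarrow> m \<in> K \<and> inf_paths G - E \<in> sets (path_borel G) \<and> emeasure m (inf_paths G - E) = 0" for m
    by (auto simp: conformal_on_end_def concentrated_on_def normalized_conformal_iff conformal0_space conformal0_sets null_sets_def)
  have mix: "emeasure (mix_measure t m1 m2) X = ennreal (1 - t) * emeasure m1 X + ennreal t * emeasure m2 X"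
    if "m1 \<in> K" "m2 \<in> K" for t m1 m2 X
    using that by (intro emeasure_mix_measure) (simp add: normalized_conformal_iff conformal0_sets)
  show ?thesis unfolding measure_face_of_def
  proof (intro conjI ballI impI)
    show "conformal_on_end G F \<beta> v0 E \<subseteq> K" by (auto simp: c)
    show "convex_measures (conformal_on_end G F \<beta> v0 E)"
      using convex_normalized_conformal by (auto simp: convex_measures_def c mix)
  next
    fix m1 m2 and t :: real assume *: "m1 \<in> K" "m2 \<in> K" "t \<in> {0<..<1}" "mix_measure t m1 m2 \<in> conformal_on_end G F \<beta> v0 E"
    then have "ennreal (1 - t) * emeasure m1 (inf_paths G - E) + ennreal t * emeasure m2 (inf_paths G - E) = 0"
      by (simp add: c mix)
    then have "emeasure m1 (inf_paths G - E) = 0" "emeasure m2 (inf_paths G - E) = 0"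
      using *(3) by (auto simp: ennreal_eq_0_iff)
    then show "m1 \<in> conformal_on_end G F \<beta> v0 E" "m2 \<in> conformal_on_end G F \<beta> v0 E"
      using * by (auto simp: c)
  qed
qed

end

section \<open>Conformal measures and their values along an exhaustion\<close>

locale exhausted_digraph = transient_digraph +
  fixes D :: "nat \<Rightarrow> 'a set"
  assumes exh: "exhaustion G v0 D"
begin

lemma D_0: "D 0 = {v0}"
  and finite_D: "finite (D n)"
  and D_subset_verts: "D n \<subseteq> verts G"
  and UN_D: "(\<Union>n. D n) = verts G"
  using exh by (auto simp: exhaustion_def)

lemma head_in_D_Suc: "a \<in> out_arcs G v \<Longrightarrow> v \<in> D n \<Longrightarrow> head G a \<in> D (Suc n)"
proof -
  assume a: "a \<in> out_arcs G v" "v \<in> D n"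
  have "D n \<subseteq> interior_verts G (D (Suc n))" using exh by (simp add: exhaustion_def)
  then have "head G ` out_arcs G v \<subseteq> D (Suc n)" using a(2) unfolding interior_verts_def by blast
  then show ?thesis using a(1) by blast
qed

lemma D_mono: "n \<le> k \<Longrightarrow> D n \<subseteq> D k"
proof (rule lift_Suc_mono_le[of D])
  show "D n \<subseteq> D (Suc n)" for n
    using exh unfolding exhaustion_def interior_verts_def by blast
qed

lemma ex_D_superset:
  assumes "finite H" "H \<subseteq> verts G"
  obtains n where "n \<ge> k" "H \<subseteq> D n"
proof -
  have "\<exists>n\<ge>k. H \<subseteq> D n" using assms
  proof (induction H rule: finite_induct)
    case (insert v H)
    then obtain n where n: "n \<ge> k" "H \<subseteq> D n" by auto
    obtain n' where n': "v \<in> D n'" using insert.prems UN_D by blast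
    show ?case using n n' D_mono[of n "max n n'"] D_mono[of n' "max n n'"]
      by (intro exI[of _ "max n n'"]) auto
  qed auto
  then show thesis using that by blast
qed

lemma ex_D_member:
  assumes "v \<in> verts G"
  obtains n where "n \<ge> k" "v \<in> D n"
  using ex_D_superset[of "{v}" k] assms by auto

lemma finite_bdry: "finite (bdry G (D n))"
  and bdry_subset: "bdry G (D n) \<subseteq> D n"
  using finite_D[of n] by (auto simp: bdry_def)

lemma bdry_verts: "w \<in> bdry G (D n) \<Longrightarrow> w \<in> verts G"
  using bdry_subset D_subset_verts by blast

lemma Omega_not_bdry: "w \<in> D n - bdry G (D n) \<Longrightarrow> Omega G (D n) w = {}"
  by (auto simp: bdry_def)

text \<open>
  The arrows out of \<open>D n\<close> end in \<open>D (Suc n)\<close>, so a path from \<open>D n\<close> cannot leave \<open>D (Suc n)\<close> at once.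
\<close>
lemma bdry_Suc_disjoint:
  assumes "w \<in> bdry G (D (Suc n))"
  shows "w \<notin> D n"
proof
  assume w: "w \<in> D n"
  obtain x where x: "x \<in> Omega G (D (Suc n)) w" using assms by (auto simp: bdry_def)
  then have "x 0 \<in> out_arcs G w" by (auto simp: Omega_iff cylinder_def inf_paths_arcs)
  then show False using head_in_D_Suc[OF _ w] x by (auto simp: Omega_iff)
qed

lemma emeasure_Omega_finite:
  assumes "conformal0 m" "v \<in> verts G"
  shows "emeasure m (Omega G H v) < \<infinity>"
proof -
  have "emeasure m (Omega G H v) \<le> emeasure m (Z v)"
    by (rule emeasure_mono) (auto simp: Omega_iff conformal0_sets[OF assms(1)])
  then show ?thesis using conformal0_finite[OF assms] by (rule order.strict_trans1)
qed

lemma emeasure_Omega_eq: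
  "conformal0 m \<Longrightarrow> v \<in> verts G \<Longrightarrow> emeasure m (Omega G H v) = ennreal (measure m (Omega G H v))"
  using emeasure_Omega_finite[of m v H] by (intro emeasure_eq_ennreal_measure) (simp add: less_top)

lemma last_exit_bdry:
  assumes m: "conformal0 m" and "H \<subseteq> D n" "v \<in> D n"
  shows "emeasure m (Omega G H v) = (\<Sum>w\<in>bdry G (D n). green_off H v w * emeasure m (Omega G (D n) w))"
proof -
  have "emeasure m (Omega G H v) = (\<Sum>w\<in>D n. green_off H v w * emeasure m (Omega G (D n) w))"
    by (rule last_exit_emeasure[OF m finite_D assms(2,3)])
  also have "\<dots> = (\<Sum>w\<in>bdry G (D n). green_off H v w * emeasure m (Omega G (D n) w))"
    by (rule sum.mono_neutral_right[OF finite_D bdry_subset]) (simp add: Omega_not_bdry)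
  finally show ?thesis .
qed

lemma emeasure_Z_boundary:
  assumes m: "conformal0 m" and "v \<in> D n"
  shows "emeasure m (Z v) = (\<Sum>w\<in>bdry G (D n). green_off {} v w * emeasure m (Omega G (D n) w))"
  using last_exit_bdry[OF m, of "{}" n v] assms by (simp add: Omega_empty_emeasure)

lemma green_v0_v0: "green_off {} v0 v0 * inverse (green_off {} v0 v0) = 1"
proof -
  have "green_off {} v0 v0 \<noteq> 0" "green_off {} v0 v0 < top"
    using green_v0[OF v0] green_eq[OF v0] by auto
  then show ?thesis using ennreal_divide_self by (simp add: divide_ennreal_def)
qed

abbreviation boundary_values :: "(nat \<Rightarrow> 'b) measure \<Rightarrow> nat \<Rightarrow> 'a \<Rightarrow> real" where
  "boundary_values m \<equiv> \<lambda>k\<in>{1..}. \<lambda>w\<in>bdry G (D k). measure m (Omega G (D k) w)"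

lemma boundary_values_in_Delta:
  assumes m: "m \<in> K"
  shows "boundary_values m \<in> Delta G F \<beta> v0 D"
    (is "?\<psi> \<in> _")
proof -
  have c: "conformal0 m" and 1: "emeasure m (Z v0) = 1"
    using m by (auto simp: normalized_conformal_iff emeasure_Z_eq v0)
  have psi: "ennreal (?\<psi> k w) = emeasure m (Omega G (D k) w)" if "k \<ge> 1" "w \<in> bdry G (D k)" for k w
    using that bdry_verts by (simp add: emeasure_Omega_eq[OF c])
  have step: "(\<Sum>w\<in>bdry G (D (Suc n)). M_mat G F \<beta> D n v w * ennreal (?\<psi> (Suc n) w)) = emeasure m (Omega G (D n) v)"
    if v: "v \<in> D n" for v n
  proof -
    have "D n \<subseteq> D (Suc n)" "v \<in> D (Suc n)" using D_mono[of n "Suc n"] v by auto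
    from last_exit_bdry[OF c this]
    have "emeasure m (Omega G (D n) v) = (\<Sum>w\<in>bdry G (D (Suc n)). green_off (D n) v w * emeasure m (Omega G (D (Suc n)) w))" .
    also have "\<dots> = (\<Sum>w\<in>bdry G (D (Suc n)). M_mat G F \<beta> D n v w * ennreal (?\<psi> (Suc n) w))"
    proof (intro sum.cong refl)
      fix w assume w: "w \<in> bdry G (D (Suc n))"
      have "ennreal (?\<psi> (Suc n) w) = emeasure m (Omega G (D (Suc n)) w)"
        by (rule psi) (simp_all add: w)
      then show "green_off (D n) v w * emeasure m (Omega G (D (Suc n)) w) = M_mat G F \<beta> D n v w * ennreal (?\<psi> (Suc n) w)"
        by (simp only: M_mat_eq_green_off)
    qed
    finally show ?thesis by simp
  qed
  \<comment> \<open>cut the paths of \<open>Z v0\<close> at their last visit to \<open>v0\<close>\<close>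
  have "green_off {} v0 v0 * emeasure m (Omega G (D 0) v0) = 1"
    using last_exit_emeasure[OF c, of "D 0" "{}" v0] 1 by (simp add: D_0 Omega_empty_emeasure[OF c])
  moreover have "emeasure m (Omega G (D 0) v0)
      = (green_off {} v0 v0 * emeasure m (Omega G (D 0) v0)) * inverse (green_off {} v0 v0)"
    using arg_cong[OF green_v0_v0, of "\<lambda>t. t * emeasure m (Omega G (D 0) v0)"] by (simp add: ac_simps)
  ultimately have "emeasure m (Omega G (D 0) v0) = inverse (green_off {} v0 v0)" by simp
  then have "(\<Sum>w\<in>bdry G (D 1). M_mat G F \<beta> D 0 v0 w * ennreal (?\<psi> 1 w)) = inverse (green G F \<beta> v0 v0)"
    using step[of v0 0] by (simp add: D_0 green_eq[OF v0])
  moreover have "(\<Sum>w\<in>bdry G (D (Suc n)). M_mat G F \<beta> D n v w * ennreal (?\<psi> (Suc n) w)) = ennreal (?\<psi> n v)"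
    if "n \<ge> 1" "v \<in> bdry G (D n)" for n v
    using step[of v n] psi[OF that] that bdry_subset by auto
  moreover have "?\<psi> \<in> (\<Pi>\<^sub>E k\<in>{1..}. \<Pi>\<^sub>E w\<in>bdry G (D k). {0..})" by auto
  ultimately show ?thesis unfolding Delta_def by blast
qed

lemma boundary_values_determine:
  assumes m: "m \<in> K" "m' \<in> K"
    and "\<And>k w. k \<ge> 1 \<Longrightarrow> w \<in> bdry G (D k) \<Longrightarrow> emeasure m (Omega G (D k) w) = emeasure m' (Omega G (D k) w)"
  shows "m = m'"
proof -
  have c: "conformal0 m" "conformal0 m'" using m by (auto simp: normalized_conformal_iff)
  show ?thesis
  proof (rule conformal0_eqI[OF c])
    fix v assume "v \<in> verts G"
    then obtain n where n: "n \<ge> 1" "v \<in> D n" by (rule ex_D_member)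
    show "emeasure m (Z v) = emeasure m' (Z v)"
      unfolding emeasure_Z_boundary[OF c(1) n(2)] emeasure_Z_boundary[OF c(2) n(2)]
      by (intro sum.cong refl) (simp add: assms(3)[OF n(1)])
  qed
qed

text \<open>
  A walk that leaves \<open>w\<close> without returning to \<open>D\<^sub>n\<close>, followed by a wandering path that does not return
  either, would make \<open>w\<close> a boundary point.
\<close>
lemma green_off_non_bdry:
  assumes "w \<in> D n - bdry G (D n)" "u \<in> bdry G (D (Suc n))"
  shows "green_off (D n) w u = 0"
proof -
  obtain y where y: "y \<in> Omega G (D (Suc n)) u" using assms(2) by (auto simp: bdry_def)
  have "L_paths G (D n) w u = {}"
  proof (rule ccontr)
    assume "L_paths G (D n) w u \<noteq> {}"
    then obtain as where as: "as \<in> L_paths G (D n) w u" by auto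
    then have z: "as \<frown> y \<in> Z w"
      using y conc_inf_paths[of w as u y] by (auto simp: L_paths_def Omega_iff)
    then have "as \<frown> y \<in> Wan G" using y by (intro conc_Wan) (auto simp: Omega_iff cylinder_def)
    then have "as \<frown> y \<in> Omega G (D n) w"
      using as y z D_mono[of n "Suc n"] by (auto simp: Omega_iff heads_conc L_paths_def)
    then show False using assms(1) by (auto simp: bdry_def)
  qed
  then show ?thesis by (simp add: green_off_def walk_sum_def nn_integral_count_space_finite)
qed

text \<open>
  The only candidate for \<open>m (Z v)\<close> when \<open>v \<in> D\<^sub>n\<close> and \<open>m\<close> has the boundary values \<open>\<psi>\<close>, by
  \<open>emeasure_Z_boundary\<close>.
\<close>
definition green_potential :: "(nat \<Rightarrow> 'a \<Rightarrow> real) \<Rightarrow> nat \<Rightarrow> 'a \<Rightarrow> ennreal" where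
  "green_potential \<psi> n v = (\<Sum>w\<in>bdry G (D n). green_off {} v w * ennreal (\<psi> n w))"

lemma Delta_step:
  assumes "\<psi> \<in> Delta G F \<beta> v0 D" "n \<ge> 1" "w \<in> bdry G (D n)"
  shows "(\<Sum>u\<in>bdry G (D (Suc n)). green_off (D n) w u * ennreal (\<psi> (Suc n) u)) = ennreal (\<psi> n w)"
  using assms unfolding Delta_def by (simp add: M_mat_eq_green_off)

text \<open>
  Last exit decomposition at \<open>D\<^sub>n\<close>, followed by the equation between \<open>\<psi>\<close> at the levels \<open>n\<close> and \<open>Suc n\<close>.
\<close>
lemma green_potential_Suc:
  assumes psi: "\<psi> \<in> Delta G F \<beta> v0 D" and n: "n \<ge> 1" and v: "v \<in> D n"
  shows "green_potential \<psi> (Suc n) v = green_potential \<psi> n v"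
proof -
  have "green_potential \<psi> (Suc n) v =
      (\<Sum>u\<in>bdry G (D (Suc n)). (\<Sum>w\<in>D n. green_off {} v w * green_off (D n) w u) * ennreal (\<psi> (Suc n) u))"
    unfolding green_potential_def
    by (intro sum.cong refl, subst last_exit_decomposition[OF finite_D v]) (rule refl)
  also have "\<dots> = (\<Sum>w\<in>D n. green_off {} v w * (\<Sum>u\<in>bdry G (D (Suc n)). green_off (D n) w u * ennreal (\<psi> (Suc n) u)))"
    unfolding sum_distrib_right sum_distrib_left by (subst sum.swap) (simp add: mult.assoc)
  also have "\<dots> = (\<Sum>w\<in>bdry G (D n). green_off {} v w * (\<Sum>u\<in>bdry G (D (Suc n)). green_off (D n) w u * ennreal (\<psi> (Suc n) u)))"
    by (rule sum.mono_neutral_right[OF finite_D bdry_subset]) (simp add: green_off_non_bdry)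
  also have "\<dots> = green_potential \<psi> n v"
    unfolding green_potential_def by (intro sum.cong refl) (simp add: Delta_step[OF psi n])
  finally show ?thesis .
qed

lemma green_potential_eq:
  assumes psi: "\<psi> \<in> Delta G F \<beta> v0 D" and "n \<ge> 1" "v \<in> D n" "k \<ge> 1" "v \<in> D k"
  shows "green_potential \<psi> n v = green_potential \<psi> k v"
proof -
  have *: "green_potential \<psi> (n + i) v = green_potential \<psi> n v" if "n \<ge> 1" "v \<in> D n" for n i
  proof (induction i)
    case (Suc i)
    have "v \<in> D (n + i)" using that D_mono[of n "n + i"] by auto
    then show ?case using Suc green_potential_Suc[OF psi, of "n + i" v] that by simp
  qed simp
  show ?thesis
    using *[of n "k - n"] *[of k "n - k"] assms by (cases "n \<le> k") auto
qed

lemma green_potential_finite: "v \<in> verts G \<Longrightarrow> green_potential \<psi> n v < \<infinity>"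
  unfolding green_potential_def
  using bdry_verts green_off_finite[of v] finite_bdry by (auto simp: ennreal_mult_less_top)

text \<open>
  The potential of \<open>\<psi>\<close> is a harmonic function with value \<open>1\<close> at \<open>v0\<close>.  Its boundary values are recovered
  by subtracting from the potential the part of the paths that return to \<open>D\<^sub>k\<close>: the first return
  decompositions of the measure and of the Green function contain the same finite sum.
\<close>
lemma Delta_measure_exists:
  assumes psi: "\<psi> \<in> Delta G F \<beta> v0 D"
  shows "\<exists>m\<in>K. \<forall>k\<ge>1. \<forall>w\<in>bdry G (D k). emeasure m (Omega G (D k) w) = ennreal (\<psi> k w)"
proof -
  define N where "N v = (SOME n. n \<ge> 1 \<and> v \<in> D n)" for v
  have N: "N v \<ge> 1" "v \<in> D (N v)" if "v \<in> verts G" for v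
    using ex_D_member[OF that, of 1] unfolding N_def by (metis (mono_tags, lifting) someI)+
  define h where "h v = enn2real (green_potential \<psi> (N v) v)" for v
  have h: "ennreal (h v) = green_potential \<psi> n v" if "n \<ge> 1" "v \<in> D n" for n v
  proof -
    have v: "v \<in> verts G" using that D_subset_verts by auto
    have "ennreal (h v) = green_potential \<psi> (N v) v"
      unfolding h_def using green_potential_finite[OF v] by (simp add: less_top)
    then show ?thesis using green_potential_eq[OF psi N[OF v] that] by simp
  qed
  have harm: "harmonic h"
    unfolding harmonic_def
  proof (intro ballI conjI)
    fix v assume v: "v \<in> verts G"
    show "0 \<le> h v" by (simp add: h_def)
    obtain n where n: "n \<ge> 1" "v \<in> D n" using ex_D_member[OF v] .
    \<comment> \<open>one level up, so that \<open>v\<close> is not a boundary point and the term \<open>v = w\<close> of the Green function is absent\<close>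
    have vS: "v \<in> D (Suc n)" using n D_mono[of n "Suc n"] by auto
    have "ennreal (h v) = (\<Sum>w\<in>bdry G (D (Suc n)). (\<Sum>a\<in>out_arcs G v. ennreal (wt [a]) * green_off {} (head G a) w) * ennreal (\<psi> (Suc n) w))"
      unfolding h[of "Suc n", simplified, OF vS] green_potential_def
    proof (intro sum.cong refl)
      fix w assume "w \<in> bdry G (D (Suc n))"
      then have "v \<noteq> w" using bdry_Suc_disjoint n by auto
      then show "green_off {} v w * ennreal (\<psi> (Suc n) w) =
          (\<Sum>a\<in>out_arcs G v. ennreal (wt [a]) * green_off {} (head G a) w) * ennreal (\<psi> (Suc n) w)"
        by (simp add: green_off_step[OF v, of w])
    qed
    also have "\<dots> = (\<Sum>a\<in>out_arcs G v. ennreal (wt [a]) * green_potential \<psi> (Suc n) (head G a))"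
      unfolding green_potential_def sum_distrib_right sum_distrib_left by (subst sum.swap) (simp add: mult.assoc)
    also have "\<dots> = (\<Sum>a\<in>out_arcs G v. ennreal (wt [a] * h (head G a)))"
    proof (intro sum.cong refl)
      fix a assume "a \<in> out_arcs G v"
      then have "green_potential \<psi> (Suc n) (head G a) = ennreal (h (head G a))"
        using head_in_D_Suc[OF _ n(2)] by (intro h[symmetric]) auto
      then show "ennreal (wt [a]) * green_potential \<psi> (Suc n) (head G a) = ennreal (wt [a] * h (head G a))"
        by (simp add: ennreal_mult h_def)
    qed
    also have "\<dots> = ennreal (\<Sum>a\<in>out_arcs G v. wt [a] * h (head G a))"
      by (intro sum_ennreal) (simp add: h_def)
    finally show "h v = (\<Sum>a\<in>out_arcs G v. wt [a] * h (head G a))"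
      by (subst (asm) ennreal_inj) (auto simp: h_def intro!: sum_nonneg)
  qed
  have v0D: "v0 \<in> D n" for n using D_0 D_mono[of 0 n] by auto
  have "ennreal (h v0) = (\<Sum>w\<in>bdry G (D 1). green_off {} v0 v0 * (M_mat G F \<beta> D 0 v0 w * ennreal (\<psi> 1 w)))"
    unfolding h[OF order.refl v0D] green_potential_def
  proof (intro sum.cong refl)
    fix w
    have "green_off {} v0 w = green_off {} v0 v0 * green_off {v0} v0 w"
      using last_exit_decomposition[of "{v0}" v0 w] by simp
    then show "green_off {} v0 w * ennreal (\<psi> 1 w) = green_off {} v0 v0 * (M_mat G F \<beta> D 0 v0 w * ennreal (\<psi> 1 w))"
      by (simp only: M_mat_eq_green_off D_0 mult.assoc)
  qed
  also have "\<dots> = green_off {} v0 v0 * inverse (green G F \<beta> v0 v0)"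
    using psi unfolding Delta_def sum_distrib_left[symmetric] by simp
  also have "\<dots> = 1" using green_v0_v0 green_eq[OF v0] by simp
  finally have h1: "h v0 = 1" by (simp add: h_def)
  let ?m = "path_measure h"
  have c: "conformal0 ?m" by (rule path_measure_conformal0[OF harm])
  have Z: "emeasure ?m (Z v) = green_potential \<psi> n v" if "n \<ge> 1" "v \<in> D n" for n v
    using that D_subset_verts[of n] by (subst emeasure_path_measure_Z[OF harm]) (auto simp: h)
  have "?m \<in> K" using c h1 by (simp add: normalized_conformal_iff measure_path_measure_Z[OF harm v0])
  moreover have "emeasure ?m (Omega G (D k) w) = ennreal (\<psi> k w)" if k: "k \<ge> 1" and w: "w \<in> bdry G (D k)" for k w
  proof -
    let ?X = "\<Sum>d\<in>D k. return_sum (D k) w d * green_potential \<psi> k d"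
    have wD: "w \<in> D k" "w \<in> verts G" using w bdry_subset D_subset_verts by auto
    have fin: "?X < \<infinity>"
      using return_sum_finite[OF wD(2)] green_potential_finite D_subset_verts[of k] finite_D[of k]
      by (auto simp: ennreal_mult_less_top subset_iff)
    have A: "green_potential \<psi> k w = emeasure ?m (Omega G (D k) w) + ?X"
      using first_return_emeasure[OF c finite_D, of w k] Z[OF k] wD by simp
    have B: "green_potential \<psi> k w = ennreal (\<psi> k w) + ?X"
    proof -
      have "green_potential \<psi> k w = (\<Sum>u\<in>bdry G (D k). (green_off (D k) w u + (\<Sum>d\<in>D k. return_sum (D k) w d * green_off {} d u)) * ennreal (\<psi> k u))"
        unfolding green_potential_def
        by (intro sum.cong refl, subst first_return_decomposition[OF finite_D[of k] D_subset_verts[of k], where v=w]) (rule refl)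
      also have "\<dots> = (\<Sum>u\<in>bdry G (D k). green_off (D k) w u * ennreal (\<psi> k u))
          + (\<Sum>u\<in>bdry G (D k). \<Sum>d\<in>D k. return_sum (D k) w d * green_off {} d u * ennreal (\<psi> k u))"
        by (simp add: distrib_right sum.distrib sum_distrib_right)
      also have "(\<Sum>u\<in>bdry G (D k). \<Sum>d\<in>D k. return_sum (D k) w d * green_off {} d u * ennreal (\<psi> k u)) = ?X"
        unfolding green_potential_def sum_distrib_left by (subst sum.swap) (simp add: mult.assoc)
      also have "(\<Sum>u\<in>bdry G (D k). green_off (D k) w u * ennreal (\<psi> k u)) = (\<Sum>u\<in>bdry G (D k). (if w = u then ennreal (\<psi> k u) else 0))"
        using bdry_subset[of k] wD by (intro sum.cong refl) (auto simp: green_off_in subset_iff)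
      also have "\<dots> = ennreal (\<psi> k w)" using w finite_bdry by simp
      finally show ?thesis .
    qed
    have "?X + emeasure ?m (Omega G (D k) w) = ?X + ennreal (\<psi> k w)"
      using A B by (metis add.commute)
    moreover have "?X \<noteq> \<infinity>" using fin by (rule less_imp_neq)
    ultimately show ?thesis unfolding ennreal_add_left_cancel by blast
  qed
  ultimately show ?thesis by blast
qed

lemma psi_measure_values:
  assumes psi: "\<psi> \<in> Delta G F \<beta> v0 D"
  shows "psi_measure G F \<beta> v0 D \<psi> \<in> K"
    and "\<And>k w. k \<ge> 1 \<Longrightarrow> w \<in> bdry G (D k) \<Longrightarrow> emeasure (psi_measure G F \<beta> v0 D \<psi>) (Omega G (D k) w) = ennreal (\<psi> k w)"
proof -
  let ?P = "\<lambda>m. m \<in> K \<and> (\<forall>k\<ge>1. \<forall>w\<in>bdry G (D k). emeasure m (Omega G (D k) w) = ennreal (\<psi> k w))"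
  have "\<exists>!m. ?P m"
  proof (rule ex_ex1I)
    show "\<exists>m. ?P m" using Delta_measure_exists[OF psi] by blast
    show "m = m'" if "?P m" "?P m'" for m m'
      by (rule boundary_values_determine) (use that in auto)
  qed
  from theI'[OF this] have "?P (psi_measure G F \<beta> v0 D \<psi>)" unfolding psi_measure_def .
  then show "psi_measure G F \<beta> v0 D \<psi> \<in> K"
    "\<And>k w. k \<ge> 1 \<Longrightarrow> w \<in> bdry G (D k) \<Longrightarrow> emeasure (psi_measure G F \<beta> v0 D \<psi>) (Omega G (D k) w) = ennreal (\<psi> k w)"
    by auto
qed

lemma psi_measure_boundary_values:
  assumes m: "m \<in> K"
  shows "psi_measure G F \<beta> v0 D (boundary_values m) = m"
proof (rule boundary_values_determine[OF psi_measure_values(1)[OF boundary_values_in_Delta[OF m]] m])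
  fix k :: nat and w assume k: "k \<ge> 1" and w: "w \<in> bdry G (D k)"
  then have "conformal0 m" "w \<in> verts G" using m bdry_subset D_subset_verts by (auto simp: normalized_conformal_iff)
  then show "emeasure (psi_measure G F \<beta> v0 D (boundary_values m)) (Omega G (D k) w) = emeasure m (Omega G (D k) w)"
    using psi_measure_values(2)[OF boundary_values_in_Delta[OF m] k w] k w by (simp add: emeasure_Omega_eq)
qed

end

section \<open>Measures concentrated on a minimal end\<close>

context wf_digraph begin

abbreviation joined :: "'a set \<Rightarrow> 'a \<Rightarrow> 'a \<Rightarrow> bool" where
  "joined H u w \<equiv> \<exists>as. awalk u as w \<and> set (awalk_verts u as) \<inter> H = {}"

lemma path_to_refl:
  assumes "p \<in> Wan G"
  shows "path_to G p p"
  unfolding path_to_def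
proof (intro allI impI)
  fix H N assume H: "finite H \<and> H \<subseteq> verts G"
  then obtain M where M: "\<forall>i\<ge>M. tail G (p i) \<notin> H" using assms by (auto simp: Wan_def)
  have "p (max M N) \<in> arcs G" using assms by (simp add: Wan_def inf_paths_def)
  then show "\<exists>n1\<ge>N. \<exists>n2\<ge>N. joined H (tail G (p n1)) (tail G (p n2))"
    using M by (intro exI[of _ "max M N"] exI[of _ "[]"] conjI) (auto simp: awalk_Nil_iff)
qed

lemma path_segment:
  assumes "p \<in> inf_paths G" "i \<le> j"
  obtains as where "awalk (tail G (p i)) as (tail G (p j))"
    "set (awalk_verts (tail G (p i)) as) \<subseteq> {tail G (p k) |k. i \<le> k}"
proof -
  have "\<exists>as. awalk (tail G (p i)) as (tail G (p j)) \<and> set (awalk_verts (tail G (p i)) as) \<subseteq> {tail G (p k) |k. i \<le> k}"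
    using assms(2)
  proof (induction j rule: dec_induct)
    case base
    have "p i \<in> arcs G" using assms(1) by (simp add: inf_paths_def)
    then show ?case by (intro exI[of _ "[]"]) (auto simp: awalk_Nil_iff)
  next
    case (step j)
    then obtain as where as: "awalk (tail G (p i)) as (tail G (p j))" "set (awalk_verts (tail G (p i)) as) \<subseteq> {tail G (p k) |k. i \<le> k}"
      by auto
    have j: "p j \<in> arcs G" "head G (p j) = tail G (p (Suc j))" using assms(1) by (auto simp: inf_paths_def)
    then have "awalk (tail G (p j)) [p j] (tail G (p (Suc j)))" by (metis arc_implies_awalk)
    then have a: "awalk (tail G (p i)) (as @ [p j]) (tail G (p (Suc j)))" by (rule awalk_appendI[OF as(1)])
    have "set (awalk_verts (tail G (p i)) (as @ [p j])) = set (awalk_verts (tail G (p i)) as) \<union> {tail G (p j), tail G (p (Suc j))}"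
      unfolding set_awalk_verts[OF a] set_awalk_verts[OF as(1)] using j by auto
    also have "\<dots> \<subseteq> {tail G (p k) |k. i \<le> k}" using as(2) step.hyps by force
    finally show ?case using a by blast
  qed
  then show thesis using that by blast
qed

text \<open>
  Two connecting walks are joined along \<open>q\<close>, which avoids \<open>H\<close> from some time on.
\<close>
lemma path_to_trans:
  assumes q: "q \<in> Wan G" and "path_to G p q" "path_to G q r"
  shows "path_to G p r"
  unfolding path_to_def
proof (intro allI impI)
  fix H N assume H: "finite H \<and> H \<subseteq> verts G"
  then obtain M where M: "\<forall>i\<ge>M. tail G (q i) \<notin> H" using q by (auto simp: Wan_def)
  obtain n1 n2 as where 1: "n1 \<ge> max M N" "n2 \<ge> max M N" "awalk (tail G (p n1)) as (tail G (q n2))"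
    "set (awalk_verts (tail G (p n1)) as) \<inter> H = {}"
    using assms(2) H unfolding path_to_def by metis
  obtain n3 n4 bs where 2: "n3 \<ge> max n2 N" "n4 \<ge> max n2 N" "awalk (tail G (q n3)) bs (tail G (r n4))"
    "set (awalk_verts (tail G (q n3)) bs) \<inter> H = {}"
    using assms(3) H unfolding path_to_def by metis
  have "q \<in> inf_paths G" "n2 \<le> n3" using q 2(1) by (auto simp: Wan_def)
  then obtain cs where 3: "awalk (tail G (q n2)) cs (tail G (q n3))"
    "set (awalk_verts (tail G (q n2)) cs) \<subseteq> {tail G (q k) |k. n2 \<le> k}"
    by (rule path_segment)
  have "set (awalk_verts (tail G (q n2)) cs) \<inter> H = {}" using 3(2) M 1(2) by fastforce
  moreover have aw: "awalk (tail G (p n1)) (as @ cs @ bs) (tail G (r n4))"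
    using 1(3) 3(1) 2(3) by (blast intro: awalk_appendI)
  moreover have "set (awalk_verts (tail G (p n1)) (as @ cs @ bs)) \<subseteq>
      set (awalk_verts (tail G (p n1)) as) \<union> set (awalk_verts (tail G (q n2)) cs) \<union> set (awalk_verts (tail G (q n3)) bs)"
    unfolding set_awalk_verts[OF aw] set_awalk_verts[OF 1(3)] set_awalk_verts[OF 3(1)] set_awalk_verts[OF 2(3)] by auto
  ultimately show "\<exists>n1\<ge>N. \<exists>n2\<ge>N. joined H (tail G (p n1)) (tail G (r n2))"
    using 1 2 by (intro exI[of _ n1] exI[of _ n4] exI[of _ "as @ cs @ bs"] conjI) auto
qed

text \<open>
  The class of a wandering path \<open>x\<close> with \<open>x \<rightarrow> q\<close> lies below \<open>E\<close>, hence equals \<open>E\<close>; the other inclusion is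
  transitivity.  So one of the two relations in the definition of an end describes a minimal end.
\<close>
lemma minimal_end_eq:
  assumes E: "minimal_end G E" and q: "q \<in> E"
  shows "q \<in> Wan G" "E = {x \<in> Wan G. path_to G x q}"
proof -
  obtain p where p: "p \<in> Wan G" "E = end_rel G `` {p}"
    using E by (auto simp: minimal_end_def ends_def quotient_def)
  show qW: "q \<in> Wan G" using p q by (auto simp: end_rel_def)
  show "E = {x \<in> Wan G. path_to G x q}"
  proof (intro equalityI subsetI)
    fix x assume "x \<in> E"
    then have "x \<in> Wan G" "path_to G x p" "path_to G p q" using p q by (auto simp: end_rel_def)
    then show "x \<in> {x \<in> Wan G. path_to G x q}" using path_to_trans[OF p(1)] by blast
  next
    fix x assume x: "x \<in> {x \<in> Wan G. path_to G x q}"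
    let ?E' = "end_rel G `` {x}"
    have "?E' \<in> ends G" using x by (auto simp: ends_def quotient_def)
    moreover have xE': "x \<in> ?E'" using x path_to_refl by (auto simp: end_rel_def)
    then have "end_le G ?E' E" using x q unfolding end_le_def by blast
    ultimately have "?E' = E" using E unfolding minimal_end_def by blast
    then show "x \<in> E" using xE' by simp
  qed
qed

lemma minimal_end_nonempty:
  assumes "minimal_end G E"
  shows "E \<noteq> {}"
proof -
  obtain p where "p \<in> Wan G" "E = end_rel G `` {p}"
    using assms by (auto simp: minimal_end_def ends_def quotient_def)
  then have "p \<in> E" using path_to_refl by (auto simp: end_rel_def)
  then show ?thesis by auto
qed

end

context exhausted_digraph begin

abbreviation upstream :: "(nat \<Rightarrow> 'b) \<Rightarrow> (nat \<Rightarrow> 'b) set" where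
  "upstream q \<equiv> {x \<in> Wan G. path_to G x q}"

lemma path_to_D:
  assumes "path_to G x q"
  shows "\<exists>n1\<ge>N. \<exists>n2\<ge>N. joined (D k) (tail G (x n1)) (tail G (q n2))"
proof -
  have "finite (D k) \<and> D k \<subseteq> verts G" by (simp add: finite_D D_subset_verts)
  from mp[OF spec[OF spec[OF assms[unfolded path_to_def], of "D k"], of N] this] show ?thesis .
qed

text \<open>
  The sets of the exhaustion are cofinal among the finite sets, so countably many conditions suffice and
  measurability follows.
\<close>
lemma path_to_iff:
  "path_to G x q \<longleftrightarrow> (\<forall>k N. \<exists>n1\<in>{N..}. \<exists>n2\<in>{N..}. joined (D k) (tail G (x n1)) (tail G (q n2)))" (is "?L \<longleftrightarrow> ?R")
proof
  assume ?L
  then show ?R using path_to_D[of x q] unfolding Bex_def atLeast_iff by simp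
next
  assume R: ?R
  show ?L unfolding path_to_def
  proof (intro allI impI)
    fix H N assume "finite H \<and> H \<subseteq> verts G"
    then obtain k where k: "H \<subseteq> D k" using ex_D_superset by metis
    from spec[OF spec[OF R, of k], of N]
    obtain n1 n2 as where "n1 \<ge> N" "n2 \<ge> N" "awalk (tail G (x n1)) as (tail G (q n2))"
      "set (awalk_verts (tail G (x n1)) as) \<inter> D k = {}"
      unfolding Bex_def atLeast_iff by blast
    then show "\<exists>n1\<ge>N. \<exists>n2\<ge>N. joined H (tail G (x n1)) (tail G (q n2))"
      using k by (intro exI[of _ n1] exI[of _ n2] exI[of _ as] conjI) auto
  qed
qed

lemma not_path_to_D:
  assumes "\<not> path_to G x q"
  shows "\<exists>k N. \<forall>n1\<ge>N. \<forall>n2\<ge>N. \<forall>as. awalk (tail G (x n1)) as (tail G (q n2)) \<longrightarrow>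
      set (awalk_verts (tail G (x n1)) as) \<inter> D k \<noteq> {}"
  using assms unfolding path_to_iff Bex_def atLeast_iff by blast

lemma Wan_avoids_D:
  assumes "x \<in> Wan G"
  obtains N where "\<forall>i\<ge>N. tail G (x i) \<notin> D k"
proof -
  have avoid: "\<forall>H. finite H \<and> H \<subseteq> verts G \<longrightarrow> (\<exists>N. \<forall>i\<ge>N. tail G (x i) \<notin> H)"
    using assms by (simp add: Wan_def)
  have "finite (D k) \<and> D k \<subseteq> verts G" by (simp add: finite_D D_subset_verts)
  from mp[OF spec[OF avoid, of "D k"] this] show thesis using that by blast
qed

lemma upstream_measurable: "upstream q \<in> sets (path_borel G)"
proof -
  have "{x \<in> inf_paths G. path_to G x q} \<in> sets (path_borel G)"
    unfolding path_to_iff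
    by (rule sets_coord_pred, rule pred_intros_countable(1), rule pred_intros_countable(1),
        rule pred_intros_countable_bounded(4), rule coord_pred)
  moreover have "upstream q = Wan G \<inter> {x \<in> inf_paths G. path_to G x q}"
    by (auto simp: Wan_def)
  ultimately show ?thesis using Wan_measurable by auto
qed

lemma suffix_preimage_null:
  assumes m: "conformal0 m" and S: "S \<in> sets (path_borel G)" "S \<subseteq> Z w" "emeasure m S = 0"
  shows "{x \<in> inf_paths G. suffix j x \<in> S} \<in> null_sets m"
proof (rule null_sets_subset)
  let ?I = "{(v, as). v \<in> verts G \<and> as \<in> lists (arcs G) \<and> awalk v as w}"
  have "countable ?I"
    by (rule countable_subset[of _ "verts G \<times> lists (arcs G)"]) (auto simp: countable_verts countable_arcs)
  then show "(\<Union>z\<in>?I. (\<lambda>y. snd z \<frown> y) ` S) \<in> null_sets m"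
  proof (rule null_sets_UN')
    fix z assume "z \<in> ?I"
    then have "awalk (fst z) (snd z) w" by auto
    then show "(\<lambda>y. snd z \<frown> y) ` S \<in> null_sets m"
      using emeasure_conc_image[OF m _ S(2,1)] conc_image_measurable[OF _ S(2,1)] S(3)
      by (auto simp: null_sets_def conformal0_sets[OF m])
  qed
  have "{x \<in> inf_paths G. suffix j x \<in> S} = suffix j -` S \<inter> space (path_borel G)" by auto
  then show "{x \<in> inf_paths G. suffix j x \<in> S} \<in> sets m"
    using measurable_sets[OF suffix_measurable S(1)] conformal0_sets[OF m] by simp
  show "{x \<in> inf_paths G. suffix j x \<in> S} \<subseteq> (\<Union>z\<in>?I. (\<lambda>y. snd z \<frown> y) ` S)"
  proof
    fix x assume "x \<in> {x \<in> inf_paths G. suffix j x \<in> S}"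
    then have x: "x \<in> inf_paths G" "suffix j x \<in> S" by auto
    then have "tail G (x j) = w" using S(2) by (force simp: cylinder_def)
    then have aw: "awalk (tail G (x 0)) (prefix j x) w" using awalk_prefix[OF x(1), of j] by simp
    then have "set (prefix j x) \<subseteq> arcs G" "tail G (x 0) \<in> verts G"
      using inf_paths_arcs[OF x(1)] by (auto simp: subsequence_def)
    then have "(tail G (x 0), prefix j x) \<in> ?I" using aw by auto
    moreover have "x \<in> (\<lambda>y. snd (tail G (x 0), prefix j x) \<frown> y) ` S"
      using x(2) prefix_conc_suffix[of x j] by (auto intro!: image_eqI[of _ _ "suffix j x"])
    ultimately show "x \<in> (\<Union>z\<in>?I. (\<lambda>y. snd z \<frown> y) ` S)" by blast
  qed
qed

text \<open>
  If \<open>x \<in> Omega D\<^sub>n y\<close> and \<open>x \<rightarrow> q\<close>, then following \<open>x\<close> and changing over to \<open>q\<close> far out gives walks from \<open>y\<close> to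
  \<open>q\<close> outside \<open>D\<^sub>n\<close>, so that \<open>y\<close> is in the bracket; hence for \<open>y\<close> outside the bracket \<open>Omega D\<^sub>n y\<close> misses the
  end.  Conversely let \<open>x \<rightarrow> q\<close> fail, say no walk outside \<open>D\<^sub>k\<close> leads from \<open>x\<close> to \<open>q\<close> beyond time \<open>N\<close>.  Choose
  \<open>n \<ge> k\<close> so large that \<open>x\<close> meets \<open>D\<^sub>n\<close> after it has left \<open>D\<^sub>k\<close> forever, and let \<open>y\<close> be its last vertex in \<open>D\<^sub>n\<close>.
  Then \<open>y\<close> is outside the bracket of \<open>q\<close>, so \<open>x\<close> lies in one of countably many null sets.
\<close>
lemma concentrated_upstream_iff:
  assumes m: "conformal0 m" and q: "q \<in> Wan G"
  shows "inf_paths G - upstream q \<in> null_sets m \<longleftrightarrow>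
    (\<forall>n\<ge>1. \<forall>y\<in>D n - bracket G (D n) q. emeasure m (Omega G (D n) y) = 0)" (is "?L \<longleftrightarrow> ?R")
proof
  assume L: ?L
  show ?R
  proof (intro allI impI ballI)
    fix n :: nat and y assume y: "y \<in> D n - bracket G (D n) q"
    have "Omega G (D n) y \<subseteq> inf_paths G - upstream q"
    proof
      fix x assume x: "x \<in> Omega G (D n) y"
      then have xi: "x \<in> inf_paths G" "tail G (x 0) = y" "\<And>i. head G (x i) \<notin> D n"
        by (auto simp: Omega_iff cylinder_def)
      have False if to: "path_to G x q"
      proof -
        have "\<exists>i\<ge>N. tail G (q i) \<notin> D n \<and> L_paths G (D n) y (tail G (q i)) \<noteq> {}" for N
        proof -
          obtain n1 n2 as where as: "n2 \<ge> N" "awalk (tail G (x n1)) as (tail G (q n2))"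
            "set (awalk_verts (tail G (x n1)) as) \<inter> D n = {}"
            using path_to_D[OF to, of N n] by blast
          have aw: "awalk y (prefix n1 x @ as) (tail G (q n2))"
            using awalk_prefix[OF xi(1), of n1] xi(2) as(2) by (auto intro: awalk_appendI)
          have "\<forall>a\<in>set (prefix n1 x @ as). head G a \<notin> D n"
            using xi(3) as(3) unfolding set_awalk_verts[OF as(2)] by (auto simp: subsequence_def)
          then have "prefix n1 x @ as \<in> L_paths G (D n) y (tail G (q n2))"
            unfolding L_paths_def using aw by blast
          moreover have "tail G (q n2) \<in> set (awalk_verts (tail G (x n1)) as)"
            using awlast_of_awalk[OF as(2)] last_in_set[OF awalk_verts_non_Nil, of "tail G (x n1)" as] by simp
          ultimately show ?thesis using as(1,3) by blast
        qed
        then show False using y by (auto simp: bracket_def)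
      qed
      then show "x \<in> inf_paths G - upstream q" using xi by auto
    qed
    then have "emeasure m (Omega G (D n) y) \<le> emeasure m (inf_paths G - upstream q)"
      using L by (intro emeasure_mono) auto
    then show "emeasure m (Omega G (D n) y) = 0" using L by (simp add: null_sets_def)
  qed
next
  assume R: ?R
  let ?I = "{(n, y, j). n \<ge> (1::nat) \<and> y \<in> D n - bracket G (D n) q \<and> j \<in> (UNIV :: nat set)}"
  let ?N = "\<lambda>(n, y, j). {x \<in> inf_paths G. suffix j x \<in> Omega G (D n) y}"
  have "countable ?I"
    by (rule countable_subset[of _ "UNIV \<times> verts G \<times> UNIV"]) (use D_subset_verts in \<open>auto simp: countable_verts\<close>)
  then have "(\<Union>z\<in>?I. ?N z) \<in> null_sets m"
  proof (rule null_sets_UN')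
    fix z assume z: "z \<in> ?I"
    obtain n y j where [simp]: "z = (n, y, j)" by (cases z)
    have "{x \<in> inf_paths G. suffix j x \<in> Omega G (D n) y} \<in> null_sets m"
      by (rule suffix_preimage_null[OF m Omega_measurable, where w=y]) (use z R in \<open>auto simp: Omega_iff\<close>)
    then show "?N z \<in> null_sets m" by simp
  qed
  then have null: "(inf_paths G - Wan G) \<union> (\<Union>z\<in>?I. ?N z) \<in> null_sets m"
    using Wan_conull[OF m] by (rule null_sets.Un[rotated])
  have "x \<in> (\<Union>z\<in>?I. ?N z)" if x: "x \<in> Wan G" and nto: "\<not> path_to G x q" for x
  proof -
    have xi: "x \<in> inf_paths G" using x by (simp add: Wan_def)
    obtain k N where kN: "\<forall>n1\<ge>N. \<forall>n2\<ge>N. \<forall>as. awalk (tail G (x n1)) as (tail G (q n2)) \<longrightarrow>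
        set (awalk_verts (tail G (x n1)) as) \<inter> D k \<noteq> {}"
      using not_path_to_D[OF nto] by blast
    obtain M where M: "\<forall>i\<ge>M. tail G (x i) \<notin> D k"
      using Wan_avoids_D[OF x] .
    define i where "i = max M N"
    \<comment> \<open>\<open>n \<ge> k\<close> makes walks outside \<open>D n\<close> avoid \<open>D k\<close>; at time \<open>i\<close> the path has left \<open>D k\<close> forever\<close>
    obtain n where n: "n \<ge> max 1 k" "tail G (x i) \<in> D n"
      using ex_D_member[OF inf_paths_tail_verts[OF xi]] .
    obtain j where j: "j \<ge> i" "tail G (x j) \<in> D n" "suffix j x \<in> Omega G (D n) (tail G (x j))"
      using ex_last_exit[OF x finite_D n(2)] .
    have "tail G (x j) \<notin> bracket G (D n) q"
    proof
      assume "tail G (x j) \<in> bracket G (D n) q"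
      then obtain n2 as where as: "n2 \<ge> N" "as \<in> L_paths G (D n) (tail G (x j)) (tail G (q n2))"
        unfolding bracket_def by blast
      then have aw: "awalk (tail G (x j)) as (tail G (q n2))" by (simp add: L_paths_def)
      have "D k \<subseteq> D n" using D_mono n(1) by simp
      then have h: "\<forall>a\<in>set as. head G a \<notin> D k" using as(2) by (auto simp: L_paths_def)
      have "set (awalk_verts (tail G (x j)) as) \<subseteq> {tail G (x j)} \<union> head G ` set as"
      proof -
        have "cas (tail G (x j)) as (tail G (q n2))" using aw by (simp add: awalk_def)
        from awalk_verts_conv'[OF this] this show ?thesis by (cases as) auto
      qed
      then have "set (awalk_verts (tail G (x j)) as) \<inter> D k = {}"
        using h M j(1) by (auto simp: i_def)
      moreover have "j \<ge> N" using j(1) by (simp add: i_def)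
      ultimately show False using kN as(1) aw by blast
    qed
    then have "(n, tail G (x j), j) \<in> ?I" using n j by auto
    moreover have "x \<in> ?N (n, tail G (x j), j)" using xi j by auto
    ultimately show ?thesis by blast
  qed
  then have "inf_paths G - upstream q \<subseteq> (inf_paths G - Wan G) \<union> (\<Union>z\<in>?I. ?N z)"
    by blast
  moreover have "inf_paths G - upstream q \<in> sets m"
    using sets.compl_sets[OF upstream_measurable[of q]] conformal0_sets[OF m] by simp
  ultimately show ?L using null by (blast intro: null_sets_subset)
qed

lemma conformal_on_end_iff:
  assumes E: "minimal_end G E"
  shows "m \<in> conformal_on_end G F \<beta> v0 E \<longleftrightarrow>
    m \<in> K \<and> (\<forall>n\<ge>1. \<forall>y\<in>D n - end_bracket G E (D n). emeasure m (Omega G (D n) y) = 0)"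
proof -
  have q: "(SOME p. p \<in> E) \<in> E" using minimal_end_nonempty[OF E] by (simp add: some_in_eq)
  have "concentrated_on m E \<longleftrightarrow> inf_paths G - upstream (SOME p. p \<in> E) \<in> null_sets m" if "m \<in> K"
    using that minimal_end_eq(2)[OF E q] by (simp add: concentrated_on_def normalized_conformal_iff conformal0_space)
  then show ?thesis
    using concentrated_upstream_iff[OF _ minimal_end_eq(1)[OF E q], of m]
    by (auto simp: conformal_on_end_def end_bracket_def normalized_conformal_iff)
qed

lemma return_sum_real:
  "v \<in> verts G \<Longrightarrow> d \<in> verts G \<Longrightarrow> return_sum H v d = ennreal (enn2real (return_sum H v d))"
  using return_sum_finite[of v d H] by (simp add: less_top)

text \<open>
  First return decomposition, solved for the measure of \<open>Omega H y\<close>: it is a finite linear combination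
  of values of the harmonic function of \<open>m\<close>.
\<close>
lemma measure_Omega:
  assumes m: "conformal0 m" and H: "finite H" "H \<subseteq> verts G" and y: "y \<in> verts G"
  shows "measure m (Omega G H y) = measure m (Z y) - (\<Sum>d\<in>H. enn2real (return_sum H y d) * measure m (Z d))"
proof -
  have "ennreal (measure m (Z y)) = ennreal (measure m (Omega G H y)) + (\<Sum>d\<in>H. return_sum H y d * emeasure m (Z d))"
    using first_return_emeasure[OF m H(1), of y] by (simp add: emeasure_Z_eq[OF m y] emeasure_Omega_eq[OF m y])
  also have "(\<Sum>d\<in>H. return_sum H y d * emeasure m (Z d)) = (\<Sum>d\<in>H. ennreal (enn2real (return_sum H y d) * measure m (Z d)))"
    using H(2) return_sum_real[OF y, of _ H] emeasure_Z_eq[OF m]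
    by (intro sum.cong refl) (metis enn2real_nonneg ennreal_mult measure_nonneg subsetD)
  also have "\<dots> = ennreal (\<Sum>d\<in>H. enn2real (return_sum H y d) * measure m (Z d))"
    by (rule sum_ennreal) simp
  finally have "ennreal (measure m (Z y)) = ennreal (measure m (Omega G H y) + (\<Sum>d\<in>H. enn2real (return_sum H y d) * measure m (Z d)))"
    by (simp add: ennreal_plus sum_nonneg)
  then show ?thesis by (subst (asm) ennreal_inj) (auto simp: sum_nonneg)
qed

lemma conformal_on_end_closed:
  assumes E: "minimal_end G E"
  shows "closedin T (conformal_on_end G F \<beta> v0 E)"
proof -
  let ?I = "{(n, y). n \<ge> (1::nat) \<and> y \<in> D n - end_bracket G E (D n)}"
  define f where "f = (\<lambda>(n, y) m. measure m (Z y) - (\<Sum>d\<in>D n. enn2real (return_sum (D n) y d) * measure m (Z d)))"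
  define Q where "Q z = {m \<in> topspace T. f z m \<in> {0}}" for z
  have Q: "closedin T (Q z)" if "z \<in> ?I" for z
    unfolding Q_def
  proof (rule closedin_continuous_map_preimage)
    obtain n y where z: "z = (n, y)" by (cases z)
    have "y \<in> verts G" "\<And>d. d \<in> D n \<Longrightarrow> d \<in> verts G" using that z D_subset_verts by auto
    then show "continuous_map T euclideanreal (f z)"
      unfolding f_def z prod.case using finite_D[of n]
      by (intro continuous_map_diff continuous_map_sum continuous_map_real_mult_left continuous_map_measure_Z) auto
  qed simp
  have f: "emeasure m (Omega G (D n) y) = 0 \<longleftrightarrow> f (n, y) m = 0" if "m \<in> K" "y \<in> D n" for m n y
  proof -
    have "conformal0 m" "y \<in> verts G" using that D_subset_verts by (auto simp: normalized_conformal_iff)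
    then have "emeasure m (Omega G (D n) y) = 0 \<longleftrightarrow> measure m (Omega G (D n) y) = 0"
      by (simp add: emeasure_Omega_eq measure_le_0_iff)
    then show ?thesis
      using measure_Omega[OF \<open>conformal0 m\<close> finite_D D_subset_verts \<open>y \<in> verts G\<close>, of n] by (simp add: f_def)
  qed
  have eq: "conformal_on_end G F \<beta> v0 E = {m \<in> K. \<forall>z\<in>?I. m \<in> Q z}"
    using f by (auto simp: conformal_on_end_iff[OF E] Q_def topspace_T)
  show ?thesis
  proof (cases "?I = {}")
    case True
    then have "conformal_on_end G F \<beta> v0 E = topspace T" unfolding eq topspace_T by blast
    then show ?thesis by simp
  next
    case False
    then have "closedin T (\<Inter>z\<in>?I. Q z)" using Q by (intro closedin_INT) auto
    also have "(\<Inter>z\<in>?I. Q z) = conformal_on_end G F \<beta> v0 E"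
      unfolding eq using False by (auto simp: Q_def topspace_T)
    finally show ?thesis .
  qed
qed

lemma conformal_on_end_eq_psi_measures:
  assumes E: "minimal_end G E"
  shows "conformal_on_end G F \<beta> v0 E = psi_measure G F \<beta> v0 D ` Delta_end G F \<beta> v0 D E"
proof (intro equalityI subsetI)
  fix m assume "m \<in> conformal_on_end G F \<beta> v0 E"
  then have m: "m \<in> K" and 0: "\<And>n y. n \<ge> 1 \<Longrightarrow> y \<in> D n - end_bracket G E (D n) \<Longrightarrow> emeasure m (Omega G (D n) y) = 0"
    by (auto simp: conformal_on_end_iff[OF E])
  let ?\<psi> = "boundary_values m"
  have "?\<psi> \<in> Delta_end G F \<beta> v0 D E"
    unfolding Delta_end_def using boundary_values_in_Delta[OF m] 0 subsetD[OF bdry_subset] by (auto simp: measure_def)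
  then have "psi_measure G F \<beta> v0 D ?\<psi> \<in> psi_measure G F \<beta> v0 D ` Delta_end G F \<beta> v0 D E"
    by (rule imageI)
  then show "m \<in> psi_measure G F \<beta> v0 D ` Delta_end G F \<beta> v0 D E"
    unfolding psi_measure_boundary_values[OF m] .
next
  fix m assume "m \<in> psi_measure G F \<beta> v0 D ` Delta_end G F \<beta> v0 D E"
  then obtain \<psi> where psi: "\<psi> \<in> Delta G F \<beta> v0 D" "m = psi_measure G F \<beta> v0 D \<psi>"
    and 0: "\<And>n w. n \<ge> 1 \<Longrightarrow> w \<in> bdry G (D n) - end_bracket G E (D n) \<Longrightarrow> \<psi> n w = 0"
    by (auto simp: Delta_end_def)
  have "emeasure m (Omega G (D n) y) = 0" if "n \<ge> 1" "y \<in> D n - end_bracket G E (D n)" for n y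
  proof (cases "y \<in> bdry G (D n)")
    case True
    then show ?thesis using psi_measure_values(2)[OF psi(1) that(1) True] 0[of n y] that psi(2) by simp
  next
    case False
    then show ?thesis using Omega_not_bdry[of y n] that by simp
  qed
  then show "m \<in> conformal_on_end G F \<beta> v0 E"
    using psi_measure_values(1)[OF psi(1)] psi(2) by (simp add: conformal_on_end_iff[OF E])
qed

text \<open>
  The Martin kernels \<open>G v w / G v0 w\<close> are bounded at each \<open>v\<close>, because walks from \<open>v\<close> to \<open>w\<close> can be continued
  backwards to \<open>v0\<close>, so for \<open>w\<close> moving along \<open>q\<close> a diagonal subsequence converges at all vertices.  The
  kernels are harmonic except at \<open>w\<close>, and \<open>w\<close> leaves every finite set.
\<close>
lemma ex_martin_limit:
  assumes q: "q \<in> Wan G"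
  obtains r h where "strict_mono (r :: nat \<Rightarrow> nat)" "harmonic h" "h v0 = 1"
    "\<And>v. v \<in> verts G \<Longrightarrow> (\<lambda>i. enn2real (green_off {} v (tail G (q (r i)))) / enn2real (green_off {} v0 (tail G (q (r i))))) \<longlonglongrightarrow> h v"
proof -
  define u where "u i = tail G (q i)" for i
  define g where "g v w = enn2real (green_off {} v w)" for v w
  define k where "k i v = g v (u i) / g v0 (u i)" for i v
  have u: "u i \<in> verts G" for i using q inf_paths_tail_verts by (simp add: u_def Wan_def)
  have g: "green_off {} v w = ennreal (g v w)" if "v \<in> verts G" "w \<in> verts G" for v w
    using green_off_finite[OF that, of "{}"] by (simp add: g_def less_top)
  have g0: "g v w \<ge> 0" for v w by (simp add: g_def)
  have gpos: "g v0 w > 0" if "w \<in> verts G" for w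
    using green_v0[OF that] green_eq[OF v0, of w] g[OF v0 that] by simp
  obtain a where a: "\<And>v. v \<in> verts G \<Longrightarrow> awalk v0 (a v) v"
  proof -
    have "\<forall>v. \<exists>as. v \<in> verts G \<longrightarrow> awalk v0 as v" using ex_walk_from_v0 by blast
    then show thesis using that by metis
  qed
  \<comment> \<open>scaled by the weight of a walk from \<open>v0\<close>, the kernels have one bound for all vertices\<close>
  have bound: "norm (wt (a v) * k i v) \<le> 1" if v: "v \<in> verts G" for i v
  proof -
    have "ennreal (wt (a v) * g v (u i)) \<le> ennreal (g v0 (u i))"
      using green_off_prepend[OF a[OF v], of "u i"] g[OF v u] g[OF v0 u] by (simp add: ennreal_mult g0)
    then have "wt (a v) * g v (u i) \<le> g v0 (u i)" by (simp add: g0)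
    then show ?thesis using gpos[OF u, of i] g0 by (simp add: k_def abs_mult)
  qed
  obtain r where r: "strict_mono (r :: nat \<Rightarrow> nat)"
    and conv: "\<And>v. v \<in> verts G \<Longrightarrow> \<exists>l. (\<lambda>i. wt (a v) * k (r i) v) \<longlonglongrightarrow> l"
    using function_convergent_subsequence[OF countable_verts, of "\<lambda>i v. wt (a v) * k i v" 1] bound by metis
  define h where "h v = lim (\<lambda>i. k (r i) v)" for v
  have lim: "(\<lambda>i. k (r i) v) \<longlonglongrightarrow> h v" if v: "v \<in> verts G" for v
  proof -
    obtain l where "(\<lambda>i. wt (a v) * k (r i) v) \<longlonglongrightarrow> l" using conv[OF v] by auto
    then have "(\<lambda>i. (1 / wt (a v)) * (wt (a v) * k (r i) v)) \<longlonglongrightarrow> (1 / wt (a v)) * l"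
      by (rule tendsto_mult_left)
    then have "(\<lambda>i. k (r i) v) \<longlonglongrightarrow> (1 / wt (a v)) * l" by simp
    then show ?thesis unfolding h_def by (metis limI)
  qed
  have step: "k i v = (\<Sum>b\<in>out_arcs G v. wt [b] * k i (head G b))" if v: "v \<in> verts G" and "u i \<noteq> v" for i v
  proof -
    have "ennreal (g v (u i)) = (\<Sum>b\<in>out_arcs G v. ennreal (wt [b] * g (head G b) (u i)))"
      using green_off_step[OF v, of "u i"] that(2) u g[OF v u]
      by (simp add: g ennreal_mult g0)
    also have "\<dots> = ennreal (\<Sum>b\<in>out_arcs G v. wt [b] * g (head G b) (u i))"
      by (rule sum_ennreal) (simp add: g0)
    finally have "g v (u i) = (\<Sum>b\<in>out_arcs G v. wt [b] * g (head G b) (u i))"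
      by (subst (asm) ennreal_inj) (auto simp: g0 intro!: sum_nonneg)
    then show ?thesis by (simp add: k_def sum_divide_distrib)
  qed
  have "harmonic h" unfolding harmonic_def
  proof (intro ballI conjI)
    fix v assume v: "v \<in> verts G"
    show "0 \<le> h v" by (rule LIMSEQ_le_const[OF lim[OF v]]) (auto simp: k_def g0)
    obtain N where N: "\<forall>i\<ge>N. tail G (q i) \<noteq> v" using q v by (auto simp: Wan_iff)
    have "(\<lambda>i. \<Sum>b\<in>out_arcs G v. wt [b] * k (r i) (head G b)) \<longlonglongrightarrow> (\<Sum>b\<in>out_arcs G v. wt [b] * h (head G b))"
      by (intro tendsto_sum tendsto_mult tendsto_const lim) auto
    moreover have "eventually (\<lambda>i. (\<Sum>b\<in>out_arcs G v. wt [b] * k (r i) (head G b)) = k (r i) v) sequentially"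
      unfolding eventually_sequentially
    proof (intro exI allI impI)
      fix i assume "N \<le> i"
      then have "u (r i) \<noteq> v" using N seq_suble[OF r, of i] by (simp add: u_def)
      then show "(\<Sum>b\<in>out_arcs G v. wt [b] * k (r i) (head G b)) = k (r i) v" by (rule step[OF v, symmetric])
    qed
    ultimately have "(\<lambda>i. k (r i) v) \<longlonglongrightarrow> (\<Sum>b\<in>out_arcs G v. wt [b] * h (head G b))"
      by (rule Lim_transform_eventually)
    then show "h v = (\<Sum>b\<in>out_arcs G v. wt [b] * h (head G b))"
      using lim[OF v] LIMSEQ_unique by blast
  qed
  moreover have "h v0 = 1"
  proof -
    have "k i v0 = 1" for i using gpos[OF u, of i] by (simp add: k_def)
    then show ?thesis using lim[OF v0] by (simp add: LIMSEQ_const_iff)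
  qed
  ultimately show thesis using that[OF r] lim by (simp add: k_def g_def u_def)
qed

text \<open>
  For \<open>y\<close> outside the bracket no walk leads from \<open>y\<close> to a late vertex of \<open>q\<close> without returning to \<open>D\<^sub>n\<close>.
  The Martin kernels of these vertices thus satisfy the linear equation of \<open>measure_Omega\<close> for measure
  zero, and it passes to the limit.
\<close>
lemma conformal_on_end_nonempty:
  assumes E: "minimal_end G E"
  shows "conformal_on_end G F \<beta> v0 E \<noteq> {}"
proof -
  define q where "q = (SOME p. p \<in> E)"
  have "q \<in> E" using minimal_end_nonempty[OF E] by (simp add: q_def some_in_eq)
  then have q: "q \<in> Wan G" by (rule minimal_end_eq[OF E])
  have u: "tail G (q i) \<in> verts G" for i using q inf_paths_tail_verts by (simp add: Wan_def)
  let ?g = "\<lambda>v i. enn2real (green_off {} v (tail G (q i)))"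
  obtain r h where r: "strict_mono (r :: nat \<Rightarrow> nat)" and h: "harmonic h" "h v0 = 1"
    and lim: "\<And>v. v \<in> verts G \<Longrightarrow> (\<lambda>i. ?g v (r i) / ?g v0 (r i)) \<longlonglongrightarrow> h v"
    using ex_martin_limit[OF q] by blast
  let ?m = "path_measure h"
  have c: "conformal0 ?m" by (rule path_measure_conformal0[OF h(1)])
  have mK: "?m \<in> K" using c h by (simp add: normalized_conformal_iff measure_path_measure_Z v0)
  have "emeasure ?m (Omega G (D n) y) = 0" if y: "y \<in> D n - bracket G (D n) q" for n y
  proof -
    have yv: "y \<in> verts G" and Dv: "\<And>d. d \<in> D n \<Longrightarrow> d \<in> verts G" using y D_subset_verts by auto
    let ?rr = "\<lambda>d. enn2real (return_sum (D n) y d)"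
    obtain N1 where N1: "\<forall>i\<ge>N1. \<not> (tail G (q i) \<notin> D n \<and> L_paths G (D n) y (tail G (q i)) \<noteq> {})"
      using y by (auto simp: bracket_def)
    obtain N2 where N2: "\<forall>i\<ge>N2. tail G (q i) \<notin> D n"
      using Wan_avoids_D[OF q] .
    have "?g y i = (\<Sum>d\<in>D n. ?rr d * ?g d i)" if i: "i \<ge> N1" "i \<ge> N2" for i
    proof -
      have "L_paths G (D n) y (tail G (q i)) = {}" using N1 N2 i by blast
      then have "green_off (D n) y (tail G (q i)) = 0"
        by (simp add: green_off_def walk_sum_def nn_integral_count_space_finite)
      then have "green_off {} y (tail G (q i)) = (\<Sum>d\<in>D n. return_sum (D n) y d * green_off {} d (tail G (q i)))"
        using first_return_decomposition[OF finite_D[of n] D_subset_verts[of n], where v=y and u="tail G (q i)"] by simp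
      also have "enn2real \<dots> = (\<Sum>d\<in>D n. enn2real (return_sum (D n) y d * green_off {} d (tail G (q i))))"
        by (subst enn2real_sum)
          (use return_sum_finite[OF yv Dv] green_off_finite[OF Dv u] in \<open>auto simp: ennreal_mult_less_top\<close>)
      finally show ?thesis by (simp add: enn2real_mult)
    qed
    note g_y = this
    have ev: "eventually (\<lambda>i. (\<Sum>d\<in>D n. ?rr d * (?g d (r i) / ?g v0 (r i))) = ?g y (r i) / ?g v0 (r i)) sequentially"
      unfolding eventually_sequentially
    proof (intro exI allI impI)
      fix i assume "max N1 N2 \<le> i"
      then have "?g y (r i) = (\<Sum>d\<in>D n. ?rr d * ?g d (r i))"
        using seq_suble[OF r, of i] by (intro g_y) auto
      then show "(\<Sum>d\<in>D n. ?rr d * (?g d (r i) / ?g v0 (r i))) = ?g y (r i) / ?g v0 (r i)"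
        by (simp add: sum_divide_distrib)
    qed
    have "(\<lambda>i. \<Sum>d\<in>D n. ?rr d * (?g d (r i) / ?g v0 (r i))) \<longlonglongrightarrow> (\<Sum>d\<in>D n. ?rr d * h d)"
      by (intro tendsto_sum tendsto_mult tendsto_const lim Dv)
    from Lim_transform_eventually[OF this ev] have "h y = (\<Sum>d\<in>D n. ?rr d * h d)"
      using lim[OF yv] LIMSEQ_unique by blast
    then have "measure ?m (Omega G (D n) y) = 0"
      unfolding measure_Omega[OF c finite_D D_subset_verts yv]
      using measure_path_measure_Z[OF h(1)] yv Dv by simp
    then show ?thesis by (simp add: emeasure_Omega_eq[OF c yv])
  qed
  then have "?m \<in> conformal_on_end G F \<beta> v0 E"
    using mK by (auto simp: conformal_on_end_iff[OF E] end_bracket_def q_def)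
  then show ?thesis by auto
qed

end

theorem theorem8p25:
  fixes G :: "('v, 'a) pre_digraph" and F :: "'a \<Rightarrow> real" and \<beta> :: real
    and v0 :: 'v and D :: "nat \<Rightarrow> 'v set" and E :: "(nat \<Rightarrow> 'a) set"
  assumes "row_finite_digraph G"
    and "v0 \<in> verts G"
    and "\<forall>v\<in>verts G. 0 < green G F \<beta> v0 v \<and> green G F \<beta> v0 v < \<infinity>"
    and "exhaustion G v0 D"
    and "minimal_end G E"
  shows "choquet_simplex (cylinder_topology G (normalized_conformal G F \<beta> v0))
      \<and> conformal_on_end G F \<beta> v0 E \<noteq> {}
      \<and> closedin (cylinder_topology G (normalized_conformal G F \<beta> v0)) (conformal_on_end G F \<beta> v0 E)
      \<and> measure_face_of (conformal_on_end G F \<beta> v0 E) (normalized_conformal G F \<beta> v0)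
      \<and> conformal_on_end G F \<beta> v0 E = psi_measure G F \<beta> v0 D ` Delta_end G F \<beta> v0 D E"
proof -
  interpret wf_digraph G using assms(1) by (simp add: row_finite_digraph_def)
  interpret exhausted_digraph G F \<beta> v0 D
    by unfold_locales (use assms in auto)
  show ?thesis
    using choquet_simplex_T conformal_on_end_nonempty[OF assms(5)] conformal_on_end_closed[OF assms(5)]
      conformal_on_end_face conformal_on_end_eq_psi_measures[OF assms(5)] by blast
qed

end
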